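(* Let $\Gamma\subset SL(2,\mathbb Z)$ be a congruence subgroup, let $(\lambda_0,\mu_0)$ be a partition pair, and let $(\lambda_1,\mu_1)$ be the largest partition pair (for the total order below) with $(\lambda_1,\mu_1)<(\lambda_0,\mu_0)$ and $|\lambda_1|+|\mu_1|=|\lambda_0|+|\mu_0|$ (assumed to exist). Let $\alpha:(V_{\lambda_0,\mu_0})^\Gamma_0\to M_{2(p(\mu_0)-p(\lambda_0))}(\Gamma)$ be the map $\sum_{(\lambda,\mu)\le(\lambda_0,\mu_0)}a_{-\lambda}b_{-\mu}f_{\lambda,\mu}\mapsto f_{\lambda_0,\mu_0}$. Then \[ 0\longrightarrow (V_{\lambda_1,\mu_1})^\Gamma_0 \longrightarrow (V_{\lambda_0,\mu_0})^\Gamma_0 \overset{\alpha}{\longrightarrow} M_{2(p(\mu_0)-p(\lambda_0))}(\Gamma)\longrightarrow 0 \] is a short exact sequence.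
   Context: Let $\mathbb H$ be the upper half plane and $\mathcal O(\mathbb H)$ its ring of holomorphic functions. Let $V=\mathbb C[a_{-1},a_{-2},\dots,b_0,b_{-1},\dots]$ be the vacuum module of the Heisenberg Lie algebra $[a_m,b_n]=\delta_{m,-n}C$ (with $a_m1=0$ for $m\ge0$, $b_n1=0$ for $n>0$, $C=1$), a vertex algebra with fields $a(z)=\sum a_nz^{-n-1}$, $b(z)=\sum b_nz^{-n}$ and conformal vector $a_{-1}b_{-1}$. Let $\mathscr D^{ch}(\mathbb H)=V\otimes_{\mathbb C[b_0]}\mathcal O(\mathbb H)$ ($b_0\mapsto\tau$, write $b=b_0$), the vertex algebra of chiral differential operators on $\mathbb H$, with $Y(f,z)=\sum_{i\ge0}\frac{f^{(i)}(b)}{i!}(\sum_{n\ne0}b_nz^{-n})^i$ for $f\in\mathcal O(\mathbb H)$. For a partition $\lambda=(\lambda_{(1)}\ge\dots\ge\lambda_{(d)}\ge1)$ set $p(\lambda)=d$, $|\lambda|=\sum\lambda_{(i)}$, $a_{-\lambda}=a_{-\lambda_{(1)}}\cdots a_{-\lambda_{(d)}}$, similarly $b_{-\mu}$ (the empty partition is allowed, with $a_{-\emptyset}=b_{-\emptyset}=1$, $p(\emptyset)=|\emptyset|=0$). Every element of $\mathscr D^{ch}(\mathbb H)$ is uniquely a finite sum $\sum a_{-\lambda}b_{-\mu}f_{\lambda,\mu}(b)$, $f_{\lambda,\mu}\in\mathcal O(\mathbb H)$. $SL(2,\mathbb R)$ acts on the right on $\mathscr D^{ch}(\mathbb H)$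 by vertex algebra automorphisms $\pi(g)$, integrating the zero modes of $E=-a_{-1}$, $F=a_{-1}b_0^2+2b_{-1}$, $H=-2a_{-1}b_0$ via $\pi(e^x)=\exp(-x_{(0)})$; for $g=\begin{pmatrix}\alpha&\beta\\\gamma&\delta\end{pmatrix}$, $\pi(g)a_{-1}=a_{-1}(\gamma b+\delta)^2+2\gamma^2b_{-1}$ and $\pi(g)f(b)=f(\frac{\alpha b+\beta}{\gamma b+\delta})$. Order on partitions: $\lambda>\lambda'$ if either $\lambda_{(i)}=\lambda'_{(i)}$ for $i<j$ and $\lambda_{(j)}>\lambda'_{(j)}$ for some $j\le\min(p(\lambda),p(\lambda'))$, or $p(\lambda)>p(\lambda')$ and $\lambda_{(i)}=\lambda'_{(i)}$ for all $i\le p(\lambda')$. Put $l(\lambda,\mu)=p(\lambda)-p(\mu)$. Order on partition pairs: $(\lambda,\mu)>(\lambda',\mu')$ if (1) $l(\lambda,\mu)>l(\lambda',\mu')$, or (2) $l(\lambda,\mu)=l(\lambda',\mu')$ and $\lambda>\lambda'$, or (3) $\lambda=\lambda'$, $p(\mu)=p(\mu')$ and $\mu<\mu'$. Let $V_{\lambda,\mu}$ be the span of all $a_{-\lambda'}b_{-\mu'}f(b)$ with $f\in\mathcal O(\mathbb H)$, $(\lambda',\mu')\le(\lambda,\mu)$ and $|\lambda'|+|\mu'|=|\lambda|+|\mu|$. For a congruence subgroup $\Gamma$, $(V_{\lambda,\mu})^\Gamma_0$ is the subspace of $\Gamma$-invariant elements of $V_{\lambda,\mu}$ holomorphic at all cusps,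 where a $\Gamma$-invariant $v$ is holomorphic at the cusp $c$ if, choosing $\rho\in SL(2,\mathbb Z)$ with $\rho(c)=\infty$ and writing $\pi(\rho)v=\sum a_{-\lambda}b_{-\mu}\tilde f_{\lambda,\mu}$ (each $\tilde f_{\lambda,\mu}$ is $N$-periodic for some integer $N>0$), every Fourier expansion $\tilde f_{\lambda,\mu}=\sum_m\tilde u(m)e^{2\pi im\tau/N}$ has $\tilde u(m)=0$ for $m<0$. $M_k(\Gamma)$ denotes holomorphic modular forms of weight $k$ for $\Gamma$ ($M_k(\Gamma)=0$ for $k<0$, $M_0(\Gamma)=\mathbb C$). *)

theory Defs
  imports "HOL-Complex_Analysis.Complex_Analysis" "HOL-Library.Multiset" "HOL-Library.Function_Algebras"
begin

text \<open>A key (lambda, mu) is a pair of partitions, given as multisets of positive naturals.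
An element of D^ch(H) is a finitely supported family of coefficient functions f_{lambda,mu},
holomorphic on the upper half plane; we normalise them to vanish off the upper half plane.\<close>

type_synonym key = "nat multiset \<times> nat multiset"
type_synonym cdo = "key \<Rightarrow> complex \<Rightarrow> complex"
type_synonym mat = "int \<times> int \<times> int \<times> int"

definition UHP :: "complex set" where "UHP = {z. 0 < Im z}"

definition mask :: "(complex \<Rightarrow> complex) \<Rightarrow> complex \<Rightarrow> complex" where
  "mask f = (\<lambda>z. if 0 < Im z then f z else 0)"

definition hderiv :: "nat \<Rightarrow> (complex \<Rightarrow> complex) \<Rightarrow> complex \<Rightarrow> complex" where
  "hderiv i h = mask ((deriv ^^ i) h)"

definition is_partition :: "nat multiset \<Rightarrow> bool" where
  "is_partition l \<longleftrightarrow> 0 \<notin># l"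

definition cdo_elem :: "cdo \<Rightarrow> bool" where
  "cdo_elem v \<longleftrightarrow> finite {k. v k \<noteq> 0}
     \<and> (\<forall>k. v k \<noteq> 0 \<longrightarrow> is_partition (fst k) \<and> is_partition (snd k))
     \<and> (\<forall>k. v k holomorphic_on UHP \<and> (\<forall>z. Im z \<le> 0 \<longrightarrow> v k z = 0))"

definition fsum :: "('i \<Rightarrow> 'a::comm_monoid_add) \<Rightarrow> 'i set \<Rightarrow> 'a" where
  "fsum F S = sum F {x \<in> S. F x \<noteq> 0}"

text \<open>a_n (n<0) creates a_{-n}; a_0 = d/d tau; a_n (n>0) = d/d b_{-n}.
      b_n (n<0) creates b_{-n}; b_0 = multiplication by tau; b_n (n>0) = - d/d a_{-n}.\<close>
definition amode :: "int \<Rightarrow> cdo \<Rightarrow> cdo" where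
  "amode n v = (\<lambda>(l, m) z.
     if n < 0 then (if nat (-n) \<in># l then v (l - {#nat (-n)#}, m) z else 0)
     else if n = 0 then mask (deriv (v (l, m))) z
     else of_nat (count m (nat n) + 1) * v (l, add_mset (nat n) m) z)"

definition bmode :: "int \<Rightarrow> cdo \<Rightarrow> cdo" where
  "bmode n v = (\<lambda>(l, m) z.
     if n < 0 then (if nat (-n) \<in># m then v (l, m - {#nat (-n)#}) z else 0)
     else if n = 0 then z * v (l, m) z
     else - of_nat (count l (nat n) + 1) * v (add_mset (nat n) l, m) z)"

definition bprod :: "int multiset \<Rightarrow> cdo \<Rightarrow> cdo" where
  "bprod R v = foldr bmode (sorted_list_of_multiset R) v"

text \<open>Y(h,z) = sum_i h^{(i)}(b)/i! (sum_{n\<noteq>0} b_n z^{-n})^i = sum_m Hmode h m z^{-m};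
  so the n-th mode h_{(n)} is Hmode h (n+1).\<close>
definition Hmode :: "(complex \<Rightarrow> complex) \<Rightarrow> int \<Rightarrow> cdo \<Rightarrow> cdo" where
  "Hmode h m v = fsum (\<lambda>R. (\<lambda>k z. hderiv (size R) h z
        / of_nat (\<Prod>r\<in>set_mset R. fact (count R r)) * bprod R v k z))
     {R. 0 \<notin># R \<and> sum_mset R = m}"

text \<open>n-th mode of the normally ordered product a_{-1} h (Borcherds identity).\<close>
definition ahmode :: "(complex \<Rightarrow> complex) \<Rightarrow> int \<Rightarrow> cdo \<Rightarrow> cdo" where
  "ahmode h n v =
     fsum (\<lambda>i::nat. amode (-1 - int i) (Hmode h (n + int i + 1) v)) UNIV
   + fsum (\<lambda>j::nat. Hmode h (n - int j) (amode (int j) v)) UNIV"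

definition mob :: "mat \<Rightarrow> complex \<Rightarrow> complex" where
  "mob g z = (case g of (a, b, c, d) \<Rightarrow> (of_int a * z + of_int b) / (of_int c * z + of_int d))"

definition jfac :: "mat \<Rightarrow> complex \<Rightarrow> complex" where
  "jfac g z = (case g of (a, b, c, d) \<Rightarrow> of_int c * z + of_int d)"

definition lowleft :: "mat \<Rightarrow> int" where
  "lowleft g = (case g of (a, b, c, d) \<Rightarrow> c)"

text \<open>pi(g) a_{-1} = a_{-1}(c b + d)^2 + 2 c^2 b_{-1}. Aop g n is the mode
  (pi(g) a_{-1})_{(-n)} (image of a_{-n}); Bop g n is (pi(g) b)_{(-n-1)} (image of b_{-n}).
  Note (b_{-1})_{(k)} = -k b_k.\<close>
definition Aop :: "mat \<Rightarrow> nat \<Rightarrow> cdo \<Rightarrow> cdo" where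
  "Aop g n v = ahmode (mask (\<lambda>z. (jfac g z)^2)) (- int n) v
     + (\<lambda>k z. 2 * (of_int (lowleft g))^2 * of_nat n * bmode (- int n) v k z)"

definition Bop :: "mat \<Rightarrow> nat \<Rightarrow> cdo \<Rightarrow> cdo" where
  "Bop g n v = Hmode (mask (mob g)) (- int n) v"

definition vac :: "(complex \<Rightarrow> complex) \<Rightarrow> cdo" where
  "vac f = (\<lambda>k. if k = ({#}, {#}) then mask f else 0)"

text \<open>pi(g)(a_{-lambda} b_{-mu} f(b)) computed via the vertex algebra automorphism property.\<close>
definition pi_mono :: "mat \<Rightarrow> nat multiset \<Rightarrow> nat multiset \<Rightarrow> (complex \<Rightarrow> complex) \<Rightarrow> cdo" where
  "pi_mono g l m f = foldr (Aop g) (sorted_list_of_multiset l)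
      (foldr (Bop g) (sorted_list_of_multiset m) (vac (\<lambda>z. f (mob g z))))"

definition piact :: "mat \<Rightarrow> cdo \<Rightarrow> cdo" where
  "piact g v = sum (\<lambda>k. pi_mono g (fst k) (snd k) (v k)) {k. v k \<noteq> 0}"

definition SL2Z :: "mat set" where
  "SL2Z = {(a, b, c, d). a * d - b * c = 1}"

definition matmul :: "mat \<Rightarrow> mat \<Rightarrow> mat" where
  "matmul g h = (case g of (a, b, c, d) \<Rightarrow> case h of (e, f, g', h') \<Rightarrow>
     (a * e + b * g', a * f + b * h', c * e + d * g', c * f + d * h'))"

definition matinv :: "mat \<Rightarrow> mat" where
  "matinv g = (case g of (a, b, c, d) \<Rightarrow> (d, -b, -c, a))"

definition principal_congruence :: "int \<Rightarrow> mat set" where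
  "principal_congruence N = {(a, b, c, d) \<in> SL2Z.
     a mod N = 1 mod N \<and> b mod N = 0 \<and> c mod N = 0 \<and> d mod N = 1 mod N}"

definition congruence_subgroup :: "mat set \<Rightarrow> bool" where
  "congruence_subgroup G \<longleftrightarrow> G \<subseteq> SL2Z \<and> (1, 0, 0, 1) \<in> G
     \<and> (\<forall>g\<in>G. \<forall>h\<in>G. matmul g h \<in> G) \<and> (\<forall>g\<in>G. matinv g \<in> G)
     \<and> (\<exists>N>0. principal_congruence N \<subseteq> G)"

definition fourier_coeff :: "nat \<Rightarrow> (complex \<Rightarrow> complex) \<Rightarrow> int \<Rightarrow> complex" where
  "fourier_coeff N f m = integral {0..real N}
      (\<lambda>x. f (Complex x 1) * exp (- 2 * of_real pi * \<i> * of_int m * Complex x 1 / of_nat N))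
      / of_nat N"

definition hol_at_infty :: "(complex \<Rightarrow> complex) \<Rightarrow> bool" where
  "hol_at_infty f \<longleftrightarrow> (\<forall>N::nat. N > 0 \<longrightarrow> (\<forall>z. 0 < Im z \<longrightarrow> f (z + of_nat N) = f z)
      \<longrightarrow> (\<forall>m::int. m < 0 \<longrightarrow> fourier_coeff N f m = 0))"

definition slash :: "int \<Rightarrow> mat \<Rightarrow> (complex \<Rightarrow> complex) \<Rightarrow> complex \<Rightarrow> complex" where
  "slash k g f = mask (\<lambda>z. (jfac g z) powi (- k) * f (mob g z))"

definition modular_forms :: "int \<Rightarrow> mat set \<Rightarrow> (complex \<Rightarrow> complex) set" where
  "modular_forms k G = {f. f holomorphic_on UHP \<and> (\<forall>z. Im z \<le> 0 \<longrightarrow> f z = 0)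
      \<and> (\<forall>g\<in>G. \<forall>z. 0 < Im z \<longrightarrow> f (mob g z) = (jfac g z) powi k * f z)
      \<and> (\<forall>r\<in>SL2Z. hol_at_infty (slash k r f))}"

definition plist :: "nat multiset \<Rightarrow> nat list" where
  "plist l = rev (sorted_list_of_multiset l)"

definition part_gt_list :: "nat list \<Rightarrow> nat list \<Rightarrow> bool" where
  "part_gt_list xs ys \<longleftrightarrow>
     (\<exists>j < min (length xs) (length ys). take j xs = take j ys \<and> xs ! j > ys ! j)
   \<or> (length xs > length ys \<and> take (length ys) xs = ys)"

definition part_gt :: "nat multiset \<Rightarrow> nat multiset \<Rightarrow> bool" where
  "part_gt l l' \<longleftrightarrow> part_gt_list (plist l) (plist l')"

definition lval :: "key \<Rightarrow> int" where
  "lval k = int (size (fst k)) - int (size (snd k))"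

definition pp_gt :: "key \<Rightarrow> key \<Rightarrow> bool" where
  "pp_gt k k' \<longleftrightarrow> lval k > lval k'
     \<or> (lval k = lval k' \<and> part_gt (fst k) (fst k'))
     \<or> (fst k = fst k' \<and> size (snd k) = size (snd k') \<and> part_gt (snd k') (snd k))"

definition pp_le :: "key \<Rightarrow> key \<Rightarrow> bool" where
  "pp_le k k' \<longleftrightarrow> k = k' \<or> pp_gt k' k"

definition weight :: "key \<Rightarrow> nat" where
  "weight k = sum_mset (fst k) + sum_mset (snd k)"

definition Vfilt :: "key \<Rightarrow> cdo set" where
  "Vfilt k0 = {v. cdo_elem v \<and> (\<forall>k. v k \<noteq> 0 \<longrightarrow> pp_le k k0 \<and> weight k = weight k0)}"

text \<open>(V_{lambda,mu})^Gamma_0: Gamma-invariant elements, holomorphic at all cusps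
  (quantifying over all rho in SL(2,Z) covers every cusp; the condition is independent of the choice).\<close>
definition Vinv0 :: "mat set \<Rightarrow> key \<Rightarrow> cdo set" where
  "Vinv0 G k0 = {v \<in> Vfilt k0. (\<forall>g\<in>G. piact g v = v)
      \<and> (\<forall>r\<in>SL2Z. \<forall>k. hol_at_infty (piact r v k))}"

end

theory Submission
  imports Defs "HOL-Library.Groups_Big_Fun"
begin

text \<open>
  All fields involved are built from the commuting modes of \<open>f(b(z))\<close> and from \<open>a(z)\<close>. For
  \<open>A[h] = :a h(b):\<close> and \<open>D[q] = q(b) \<partial>b\<close> the commutators close up, the anomaly of
  \<open>[A[h]\<^sub>m, A[p]\<^sub>n]\<close> being \<open>D[h' p''] + n (h' p')\<close>; hence the modes of \<open>A[h] + D[h'\<^sup>2 / 2h]\<close> commute.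
  With \<open>h = (c\<tau> + d)\<^sup>2\<close> this is the field \<open>\<pi>(g) a\<close>, and one obtains that \<open>\<pi>(g)\<close> intertwines \<open>a\<close>
  and \<open>f(b)\<close> with their images for all modes.

  Every \<open>\<pi>(g)\<close> changes the leading coefficient by \<open>(c\<tau> + d)\<^sup>2\<^sup>l\<close>, \<open>l = p(\<lambda>) - p(\<mu>)\<close>, and otherwise
  only produces terms of strictly smaller \<open>l\<close>. For surjectivity let \<open>\<psi> = G\<^sub>2 / \<pi>i\<close> and let \<open>p\<close> be a
  nowhere vanishing solution of \<open>p' = \<psi> p\<close> (so \<open>p = \<eta>\<^sup>-\<^sup>4\<close> up to a constant): it has weight \<open>-2\<close> with
  a character \<open>\<chi>\<close>, so \<open>\<pi>(g)\<close> merely multiplies the fields \<open>A[p] + D[p'\<^sup>2 / 2p]\<close> and \<open>D[1/p]\<close> by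
  \<open>\<chi>(g)\<close> and \<open>\<chi>(g)\<^sup>-\<^sup>1\<close>. Applying their modes to \<open>f p\<^sup>k\<^sup>/\<^sup>2\<close> lifts a modular form \<open>f\<close> of weight \<open>k\<close>
  to an invariant vector; its coefficients are differential polynomials in \<open>f\<close> and \<open>\<psi>\<close>, hence
  bounded at the cusps.
\<close>


subsection \<open>Holomorphic functions on the upper half plane\<close>

text \<open>The action is defined on ordered monomials only: each creation mode is replaced by a
  mode of the image field, in sorted order, and nothing is said about annihilation modes. So the
  image modes must be shown to commute first, and this is what fixes the correction: for h =
  (c\<tau> + d)^2 the quotient h'^2 / 2h is the constant 2c^2 in front of b_{-1}. The other modes
  follow by induction over creation operators, as both sides have the same commutators. Derivatives
  of f alone are not modular, so a lift needs corrections. The frame p, on which every g acts by a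
  constant, replaces corrections order by order with one product of operators; the constants met by
  the operators cancel those met by the power of p in the vacuum coefficient. The price is that p
  grows at the cusp, so growth is recorded relative to a monomial in p and 1/p, and these monomials
  cancel in the end as well. Cusp conditions are phrased by integrals for Fourier coefficients, so
  relating them to boundedness is a separate analytic task.\<close>

lemma open_UHP: "open UHP"
  unfolding UHP_def by (rule open_halfspace_Im_gt)

lemma convex_UHP: "convex UHP"
  unfolding UHP_def by (rule convex_halfspace_Im_gt)

lemma mask_holomorphic: "f holomorphic_on UHP \<Longrightarrow> mask f holomorphic_on UHP"
  by (rule holomorphic_transform) (auto simp: mask_def UHP_def)

text \<open>With the value zero forced off the half plane, equality of functions means equality on
  the half plane. The coefficients thereby form a commutative ring, whose unit is the indicator of
  the half plane, and identities among them become ring normalisation.\<close>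

typedef hol = "{f. f holomorphic_on UHP \<and> (\<forall>z. Im z \<le> 0 \<longrightarrow> f z = 0)}"
  morphisms hfun Abs_hol
  by (rule exI[of _ "\<lambda>_. 0"]) auto

setup_lifting type_definition_hol

lemma hfun_holomorphic: "hfun f holomorphic_on UHP"
  using hfun[of f] by auto

lemma hfun_off: "Im z \<le> 0 \<Longrightarrow> hfun f z = 0"
  using hfun[of f] by auto

lemma hol_eqI: "(\<And>z. 0 < Im z \<Longrightarrow> hfun f z = hfun g z) \<Longrightarrow> f = g"
  by (metis hfun_inject hfun_off ext linorder_not_less)

definition hmask :: "(complex \<Rightarrow> complex) \<Rightarrow> hol" where
  "hmask f = Abs_hol (mask f)"

lemma hfun_hmask: "f holomorphic_on UHP \<Longrightarrow> hfun (hmask f) = mask f"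
  unfolding hmask_def by (rule Abs_hol_inverse) (simp add: mask_holomorphic, simp add: mask_def)

instantiation hol :: comm_ring_1
begin

lift_definition zero_hol :: hol is "\<lambda>_. 0" by auto
lift_definition one_hol :: hol is "mask (\<lambda>_. 1)"
  by (simp add: mask_holomorphic) (simp add: mask_def)
lift_definition plus_hol :: "hol \<Rightarrow> hol \<Rightarrow> hol" is "\<lambda>f g z. f z + g z"
  by (auto intro: holomorphic_intros)
lift_definition minus_hol :: "hol \<Rightarrow> hol \<Rightarrow> hol" is "\<lambda>f g z. f z - g z"
  by (auto intro: holomorphic_intros)
lift_definition uminus_hol :: "hol \<Rightarrow> hol" is "\<lambda>f z. - f z"
  by (auto intro: holomorphic_intros)
lift_definition times_hol :: "hol \<Rightarrow> hol \<Rightarrow> hol" is "\<lambda>f g z. f z * g z"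
  by (auto intro: holomorphic_intros)

instance
proof
  show "(0::hol) \<noteq> 1"
    by transfer (auto simp: mask_def fun_eq_iff intro: exI[of _ \<i>])
  show "1 * f = f" for f :: hol
    by transfer (auto simp: mask_def fun_eq_iff)
qed (transfer; simp add: algebra_simps)+

end

lemma hfun_simps [simp]:
  "hfun 0 z = 0" "hfun (f + g) z = hfun f z + hfun g z"
  "hfun (f - g) z = hfun f z - hfun g z" "hfun (- f) z = - hfun f z"
  "hfun (f * g) z = hfun f z * hfun g z"
  by (transfer; simp)+

lemma hfun_one: "hfun 1 z = (if 0 < Im z then 1 else 0)"
  by transfer (simp add: mask_def)

lemma hfun_power: "0 < Im z \<Longrightarrow> hfun (f ^ n) z = hfun f z ^ n"
  by (induction n) (simp_all add: hfun_one)

definition hconst :: "complex \<Rightarrow> hol" where "hconst c = hmask (\<lambda>_. c)"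

definition hvar :: hol where "hvar = hmask (\<lambda>z. z)"

lemma hfun_hconst: "hfun (hconst c) z = (if 0 < Im z then c else 0)"
  unfolding hconst_def by (subst hfun_hmask) (auto simp: mask_def)

lemma hfun_hvar: "hfun hvar z = (if 0 < Im z then z else 0)"
  unfolding hvar_def by (subst hfun_hmask) (auto simp: mask_def)

lemma hconst_simps [simp]:
  "hconst 0 = 0" "hconst 1 = 1"
  by (rule hol_eqI; simp add: hfun_hconst hfun_one)+

lemma hconst_add: "hconst (a + b) = hconst a + hconst b"
  by (rule hol_eqI) (simp add: hfun_hconst)

lemma hconst_mult: "hconst (a * b) = hconst a * hconst b"
  by (rule hol_eqI) (simp add: hfun_hconst)

lemma hconst_uminus: "hconst (- a) = - hconst a"
  by (rule hol_eqI) (simp add: hfun_hconst)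

lemma hconst_of_nat: "hconst (of_nat n) = of_nat n"
  by (induction n) (simp_all add: hconst_add)

definition hD :: "hol \<Rightarrow> hol" where "hD f = hmask (deriv (hfun f))"

lemma hfun_hD: "0 < Im z \<Longrightarrow> hfun (hD f) z = deriv (hfun f) z"
  unfolding hD_def
  by (subst hfun_hmask) (auto simp: mask_def intro: holomorphic_deriv hfun_holomorphic open_UHP)

lemma hfun_has_derivative:
  "0 < Im z \<Longrightarrow> (hfun f has_field_derivative hfun (hD f) z) (at z)"
  using holomorphic_derivI[OF hfun_holomorphic open_UHP, of z f] by (simp add: hfun_hD UHP_def)

lemma hD_eqI:
  assumes "\<And>z. 0 < Im z \<Longrightarrow> (hfun f has_field_derivative hfun g z) (at z)"
  shows "hD f = g"
  by (rule hol_eqI) (simp add: hfun_hD DERIV_imp_deriv assms)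

lemma has_field_derivative_UHP_cong:
  assumes "(f has_field_derivative c) (at z)" "0 < Im z" "\<And>w. 0 < Im w \<Longrightarrow> f w = g w"
  shows "(g has_field_derivative c) (at z)"
  by (rule has_field_derivative_transform_within_open[OF assms(1) open_UHP])
     (use assms in \<open>auto simp: UHP_def\<close>)

lemma hD_add: "hD (f + g) = hD f + hD g"
  by (rule hD_eqI, rule has_field_derivative_UHP_cong)
     (auto intro!: derivative_eq_intros hfun_has_derivative)

lemma hD_mult: "hD (f * g) = hD f * g + f * hD g"
  by (rule hD_eqI, rule has_field_derivative_UHP_cong)
     (auto intro!: derivative_eq_intros hfun_has_derivative)

lemma hD_hconst [simp]: "hD (hconst c) = 0"
  by (rule hD_eqI, rule has_field_derivative_UHP_cong[of "\<lambda>_. c"])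
     (auto simp: hfun_hconst)

lemma hD_hvar [simp]: "hD hvar = 1"
  by (rule hD_eqI, rule has_field_derivative_UHP_cong[of "\<lambda>z. z"])
     (auto simp: hfun_hvar hfun_one)

lemma hD_0 [simp]: "hD 0 = 0" and hD_1 [simp]: "hD 1 = 0"
  using hD_hconst[of 0] hD_hconst[of 1] by simp_all

lemma hD_uminus: "hD (- f) = - hD f"
  using hD_add[of f "- f"] by (simp add: eq_neg_iff_add_eq_0 add.commute)

lemma hD_diff: "hD (f - g) = hD f - hD g"
  using hD_add[of f "- g"] by (simp add: hD_uminus)

lemma hD_of_nat [simp]: "hD (of_nat n) = 0"
  by (simp flip: hconst_of_nat)

lemma hD_hconst_mult: "hD (hconst c * f) = hconst c * hD f"
  by (simp add: hD_mult)

lemma hD_funpow_add: "(hD ^^ n) (f + g) = (hD ^^ n) f + (hD ^^ n) g"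
  by (induction n) (simp_all add: hD_add)

lemma hD_funpow_hconst_mult: "(hD ^^ n) (hconst c * f) = hconst c * (hD ^^ n) f"
  by (induction n) (simp_all add: hD_hconst_mult)

lemma hD_funpow_0 [simp]: "(hD ^^ n) 0 = 0"
  by (induction n) simp_all

lemma hderiv_hfun: "hderiv n (hfun f) = hfun ((hD ^^ n) f)"
proof -
  have "(deriv ^^ n) (hfun f) z = hfun ((hD ^^ n) f) z" if "0 < Im z" for z
    using that
  proof (induction n arbitrary: z)
    case (Suc n)
    have "deriv ((deriv ^^ n) (hfun f)) z = deriv (hfun ((hD ^^ n) f)) z"
      by (rule complex_derivative_transform_within_open[OF _ _ open_UHP])
         (use Suc in \<open>auto simp: UHP_def intro: holomorphic_higher_deriv hfun_holomorphic open_UHP[unfolded UHP_def] hfun_holomorphic[unfolded UHP_def]\<close>)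
    then show ?case using Suc.prems by (simp add: hfun_hD)
  qed simp
  then show ?thesis
    by (auto simp: hderiv_def mask_def fun_eq_iff hfun_off)
qed

lifting_forget hol.lifting

subsection \<open>The Fock space\<close>

text \<open>The elements of \<open>cdo\<close> with coefficients in the ring \<open>hol\<close>. The
  operator calculus takes place here, where group and ring structure are available;
  \<open>to_cdo\<close> carries the results back.\<close>

typedef cdv = "{v :: key \<Rightarrow> hol. finite {k. v k \<noteq> 0} \<and>
    (\<forall>k. v k \<noteq> 0 \<longrightarrow> is_partition (fst k) \<and> is_partition (snd k))}"
  morphisms cf Abs_cdv
  by (rule exI[of _ "\<lambda>_. 0"]) auto

setup_lifting type_definition_cdv

lemma cf_finite: "finite {k. cf v k \<noteq> 0}"
  using cf[of v] by auto

lemma cf_partition: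
  "cf v k \<noteq> 0 \<Longrightarrow> is_partition (fst k)" "cf v k \<noteq> 0 \<Longrightarrow> is_partition (snd k)"
  using cf[of v] by blast+

lemma cdv_eqI: "(\<And>k. cf v k = cf w k) \<Longrightarrow> v = w"
  by (simp add: cf_inject[symmetric] fun_eq_iff)

instantiation cdv :: ab_group_add
begin

lift_definition zero_cdv :: cdv is "\<lambda>_. 0" by auto
lift_definition plus_cdv :: "cdv \<Rightarrow> cdv \<Rightarrow> cdv" is "\<lambda>v w k. v k + w k"
proof -
  fix v w :: "key \<Rightarrow> hol"
  assume "finite {k. v k \<noteq> 0} \<and> (\<forall>k. v k \<noteq> 0 \<longrightarrow> is_partition (fst k) \<and> is_partition (snd k))"
    "finite {k. w k \<noteq> 0} \<and> (\<forall>k. w k \<noteq> 0 \<longrightarrow> is_partition (fst k) \<and> is_partition (snd k))"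
  then have "finite ({k. v k \<noteq> 0} \<union> {k. w k \<noteq> 0})" and
    "\<forall>k. v k + w k \<noteq> 0 \<longrightarrow> is_partition (fst k) \<and> is_partition (snd k)"
    by (auto, (metis add_0)+)
  moreover have "{k. v k + w k \<noteq> 0} \<subseteq> {k. v k \<noteq> 0} \<union> {k. w k \<noteq> 0}" by auto
  ultimately show "finite {k. v k + w k \<noteq> 0} \<and> (\<forall>k. v k + w k \<noteq> 0 \<longrightarrow> is_partition (fst k) \<and> is_partition (snd k))"
    using finite_subset by blast
qed
lift_definition uminus_cdv :: "cdv \<Rightarrow> cdv" is "\<lambda>v k. - v k" by auto
definition minus_cdv :: "cdv \<Rightarrow> cdv \<Rightarrow> cdv" where "minus_cdv v w = v + - w"

instance
  by standard (simp only: minus_cdv_def | (transfer; simp add: fun_eq_iff algebra_simps))+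

end

lemma cf_simps [simp]:
  "cf 0 k = 0" "cf (v + w) k = cf v k + cf w k" "cf (- v) k = - cf v k"
  by (transfer; simp)+

lemma cf_diff [simp]: "cf (v - w) k = cf v k - cf w k"
  by (simp only: diff_conv_add_uminus cf_simps)

lemma cf_sum: "cf (sum F A) k = (\<Sum>x\<in>A. cf (F x) k)"
  by (induction A rule: infinite_finite_induct) auto

lift_definition scale :: "hol \<Rightarrow> cdv \<Rightarrow> cdv" is "\<lambda>f v k. f * v k"
proof -
  fix f :: hol and v :: "key \<Rightarrow> hol"
  assume *: "finite {k. v k \<noteq> 0} \<and> (\<forall>k. v k \<noteq> 0 \<longrightarrow> is_partition (fst k) \<and> is_partition (snd k))"
  have "{k. f * v k \<noteq> 0} \<subseteq> {k. v k \<noteq> 0}" by auto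
  with * show "finite {k. f * v k \<noteq> 0} \<and> (\<forall>k. f * v k \<noteq> 0 \<longrightarrow> is_partition (fst k) \<and> is_partition (snd k))"
    using finite_subset by (metis mult_zero_right)
qed

lemma cf_scale [simp]: "cf (scale f v) k = f * cf v k"
  by transfer simp

abbreviation sc :: "complex \<Rightarrow> cdv \<Rightarrow> cdv" where "sc c \<equiv> scale (hconst c)"

lemma scale_add_right: "scale f (v + w) = scale f v + scale f w"
  and scale_add_left: "scale (f + g) v = scale f v + scale g v"
  and scale_scale: "scale f (scale g v) = scale (f * g) v"
  and scale_0_left [simp]: "scale 0 v = 0"
  and scale_0_right [simp]: "scale f 0 = 0"
  and scale_1 [simp]: "scale 1 v = v"
  and scale_minus_left: "scale (- f) v = - scale f v"
  by (rule cdv_eqI; simp add: algebra_simps)+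

definition fmono :: "key \<Rightarrow> hol \<Rightarrow> cdv" where
  "fmono k f = Abs_cdv (\<lambda>k'. if k' = k \<and> is_partition (fst k) \<and> is_partition (snd k) then f else 0)"

lemma cf_mono: "cf (fmono k f) k' = (if k' = k \<and> is_partition (fst k) \<and> is_partition (snd k) then f else 0)"
  unfolding fmono_def
  by (subst Abs_cdv_inverse) (auto intro!: finite_subset[of _ "{k}"] split: if_splits)

abbreviation cvac :: "hol \<Rightarrow> cdv" where "cvac \<equiv> fmono ({#}, {#})"

lemma is_partition_simps [simp]:
  "is_partition {#}" "is_partition (add_mset n l) \<longleftrightarrow> 0 < n \<and> is_partition l"
  by (auto simp: is_partition_def)

lemma is_partition_diff [simp]: "is_partition l \<Longrightarrow> is_partition (l - m)"
  unfolding is_partition_def by (meson in_diffD)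

lemma finite_vimage_key:
  assumes "finite {k. v k \<noteq> (0::hol)}" "\<And>k. F k \<noteq> 0 \<Longrightarrow> \<exists>k'. v k' \<noteq> 0 \<and> k \<in> S k'" "\<And>k. finite (S k)"
  shows "finite {k. F k \<noteq> (0::hol)}"
  by (rule finite_subset[of _ "\<Union>k\<in>{k. v k \<noteq> 0}. S k"]) (use assms in auto)

lift_definition am :: "int \<Rightarrow> cdv \<Rightarrow> cdv" is
  "\<lambda>n v (l, m). if n < 0 then (if nat (-n) \<in># l then v (l - {#nat (-n)#}, m) else 0)
     else if n = 0 then hD (v (l, m))
     else of_nat (count m (nat n) + 1) * v (l, add_mset (nat n) m)"
proof -
  fix n and v :: "key \<Rightarrow> hol"
  assume *: "finite {k. v k \<noteq> 0} \<and> (\<forall>k. v k \<noteq> 0 \<longrightarrow> is_partition (fst k) \<and> is_partition (snd k))"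
  let ?F = "\<lambda>(l, m). if n < 0 then (if nat (-n) \<in># l then v (l - {#nat (-n)#}, m) else 0)
     else if n = 0 then hD (v (l, m))
     else of_nat (count m (nat n) + 1) * v (l, add_mset (nat n) m)"
  have "finite {k. ?F k \<noteq> 0}"
    by (rule finite_vimage_key[OF conjunct1[OF *], where S = "\<lambda>(l, m). {(add_mset (nat (-n)) l, m), (l, m), (l, m - {#nat n#})}"])
       (rule_tac x = "if n < 0 then (fst k - {#nat (-n)#}, snd k)
          else if n = 0 then k else (fst k, add_mset (nat n) (snd k))" in exI, auto split: if_splits)
  moreover have "is_partition l \<and> is_partition m" if "?F (l, m) \<noteq> 0" for l m
    using that *
    by (auto split: if_splits)
       (metis (no_types, lifting) fst_conv snd_conv hD_0 mult_zero_right insert_DiffM is_partition_simps(2) is_partition_diff zero_less_nat_eq neg_0_less_iff_less)+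
  ultimately show "finite {k. ?F k \<noteq> 0} \<and> (\<forall>k. ?F k \<noteq> 0 \<longrightarrow> is_partition (fst k) \<and> is_partition (snd k))"
    by auto
qed

lift_definition bm :: "int \<Rightarrow> cdv \<Rightarrow> cdv" is
  "\<lambda>n v (l, m). if n < 0 then (if nat (-n) \<in># m then v (l, m - {#nat (-n)#}) else 0)
     else if n = 0 then hvar * v (l, m)
     else - of_nat (count l (nat n) + 1) * v (add_mset (nat n) l, m)"
proof -
  fix n and v :: "key \<Rightarrow> hol"
  assume *: "finite {k. v k \<noteq> 0} \<and> (\<forall>k. v k \<noteq> 0 \<longrightarrow> is_partition (fst k) \<and> is_partition (snd k))"
  let ?F = "\<lambda>(l, m). if n < 0 then (if nat (-n) \<in># m then v (l, m - {#nat (-n)#}) else 0)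
     else if n = 0 then hvar * v (l, m)
     else - of_nat (count l (nat n) + 1) * v (add_mset (nat n) l, m)"
  have "finite {k. ?F k \<noteq> 0}"
    by (rule finite_vimage_key[OF conjunct1[OF *], where S = "\<lambda>(l, m). {(l, add_mset (nat (-n)) m), (l, m), (l - {#nat n#}, m)}"])
       (rule_tac x = "if n < 0 then (fst k, snd k - {#nat (-n)#})
          else if n = 0 then k else (add_mset (nat n) (fst k), snd k)" in exI, auto split: if_splits)
  moreover have "is_partition l \<and> is_partition m" if "?F (l, m) \<noteq> 0" for l m
    using that *
    by (auto split: if_splits)
       (metis (no_types, lifting) fst_conv snd_conv mult_zero_right insert_DiffM is_partition_simps(2) is_partition_diff zero_less_nat_eq neg_0_less_iff_less)+
  ultimately show "finite {k. ?F k \<noteq> 0} \<and> (\<forall>k. ?F k \<noteq> 0 \<longrightarrow> is_partition (fst k) \<and> is_partition (snd k))"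
    by auto
qed


lemma cf_am: "cf (am n v) (l, m) =
    (if n < 0 then (if nat (-n) \<in># l then cf v (l - {#nat (-n)#}, m) else 0)
     else if n = 0 then hD (cf v (l, m))
     else of_nat (count m (nat n) + 1) * cf v (l, add_mset (nat n) m))"
  by transfer simp

lemma cf_bm: "cf (bm n v) (l, m) =
    (if n < 0 then (if nat (-n) \<in># m then cf v (l, m - {#nat (-n)#}) else 0)
     else if n = 0 then hvar * cf v (l, m)
     else - of_nat (count l (nat n) + 1) * cf v (add_mset (nat n) l, m))"
  by transfer simp

lemma am_commute: "am i (am j v) = am j (am i v)"
proof (rule cdv_eqI, clarify)
  fix l m
  consider "i < 0" "j < 0" | "i < 0" "j = 0" | "i < 0" "j > 0" | "i = 0" "j < 0" | "i = 0" "j = 0"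
    | "i = 0" "j > 0" | "i > 0" "j < 0" | "i > 0" "j = 0" | "i > 0" "j > 0" by linarith
  then show "cf (am i (am j v)) (l, m) = cf (am j (am i v)) (l, m)"
    by cases (auto simp: cf_am hD_mult hD_add algebra_simps diff_right_commute add_mset_commute
        in_diff_count dest: in_diffD)
qed

lemma bm_commute: "bm i (bm j v) = bm j (bm i v)"
proof (rule cdv_eqI, clarify)
  fix l m
  consider "i < 0" "j < 0" | "i < 0" "j = 0" | "i < 0" "j > 0" | "i = 0" "j < 0" | "i = 0" "j = 0"
    | "i = 0" "j > 0" | "i > 0" "j < 0" | "i > 0" "j = 0" | "i > 0" "j > 0" by linarith
  then show "cf (bm i (bm j v)) (l, m) = cf (bm j (bm i v)) (l, m)"
    by cases (auto simp: cf_bm algebra_simps diff_right_commute add_mset_commute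
        in_diff_count dest: in_diffD)
qed

lemma am_bm: "am i (bm j v) = bm j (am i v) + (if i + j = 0 then v else 0)"
proof (rule cdv_eqI, clarify)
  fix l m
  show "cf (am i (bm j v)) (l, m) = cf (bm j (am i v) + (if i + j = 0 then v else 0)) (l, m)"
  proof (cases "i + j = 0")
    case True
    then have i: "i = - j" by simp
    \<comment> \<open>Positive modes carry the new multiplicity as a factor, so creating and
      deleting a part in the two orders differ by one unit of multiplicity; this is the central
      term.\<close>
    have 1: "of_nat (count L n) = 1 + (of_nat (count (L - {#n#}) n) :: hol)"
      if "n \<in># L" for L :: "nat multiset" and n
      using that by (cases "count L n") (auto simp: count_eq_zero_iff)
    have 2: "of_nat (count L n) = (0 :: hol)" if "n \<notin># L" for L :: "nat multiset" and n
      using that by (simp add: not_in_iff)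
    show ?thesis unfolding i
      by (cases j "0 :: int" rule: linorder_cases)
         (auto simp: cf_bm cf_am hD_mult algebra_simps 1 2 insert_DiffM simp del: count_diff)
  next
    case False
    then have [simp]: "i < 0 \<Longrightarrow> j > 0 \<Longrightarrow> nat j \<noteq> nat (- i)" "j < 0 \<Longrightarrow> i > 0 \<Longrightarrow> nat i \<noteq> nat (- j)"
      "i < 0 \<Longrightarrow> j > 0 \<Longrightarrow> nat (- i) \<noteq> nat j" "j < 0 \<Longrightarrow> i > 0 \<Longrightarrow> nat (- j) \<noteq> nat i"
      by linarith+
    consider "i < 0" "j < 0" | "i < 0" "j = 0" | "i < 0" "j > 0" | "i = 0" "j < 0" | "i = 0" "j = 0"
      | "i = 0" "j > 0" | "i > 0" "j < 0" | "i > 0" "j = 0" | "i > 0" "j > 0" by linarith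
    then show ?thesis
      using False
      by cases (auto simp: cf_bm cf_am hD_mult hD_add hD_diff hD_uminus algebra_simps)
  qed
qed

section \<open>Passage between \<open>cdv\<close> and the concrete space \<open>cdo\<close>\<close>

definition to_cdo :: "cdv \<Rightarrow> cdo" where "to_cdo v = (\<lambda>k. hfun (cf v k))"

lemma hfun_eq_0_iff [simp]: "hfun f = 0 \<longleftrightarrow> f = 0"
  by (auto simp: fun_eq_iff intro: hol_eqI)

lemma to_cdo_inject: "to_cdo v = to_cdo w \<longleftrightarrow> v = w"
  by (auto simp: to_cdo_def fun_eq_iff hfun_inject[symmetric] intro: cdv_eqI)

lemma to_cdo_simps:
  "to_cdo 0 = 0" "to_cdo (v + w) = to_cdo v + to_cdo w"
  by (auto simp: to_cdo_def fun_eq_iff)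

lemma to_cdo_sum: "to_cdo (sum F A) = (\<Sum>x\<in>A. to_cdo (F x))"
  by (induction A rule: infinite_finite_induct) (auto simp: to_cdo_simps)

lemma to_cdo_eq_0_iff [simp]: "to_cdo v = 0 \<longleftrightarrow> v = 0"
  using to_cdo_inject[of v 0] by (simp add: to_cdo_simps)

lemma cdo_elem_to_cdo: "cdo_elem (to_cdo v)"
  using cf_finite[of v] cf_partition[of v]
  by (auto simp: cdo_elem_def to_cdo_def hfun_off intro: hfun_holomorphic)

lemma cdo_elem_imp_to_cdo:
  assumes "cdo_elem u" obtains v where "u = to_cdo v"
proof -
  have h: "hfun (Abs_hol (u k)) = u k" for k
    using assms unfolding cdo_elem_def by (intro Abs_hol_inverse) blast
  have 0: "Abs_hol (u k) = 0 \<longleftrightarrow> u k = 0" for k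
    using hfun_eq_0_iff[of "Abs_hol (u k)"] by (simp add: h)
  have "cf (Abs_cdv (\<lambda>k. Abs_hol (u k))) = (\<lambda>k. Abs_hol (u k))"
    using assms by (intro Abs_cdv_inverse) (auto simp: cdo_elem_def 0)
  then have "u = to_cdo (Abs_cdv (\<lambda>k. Abs_hol (u k)))"
    by (simp add: to_cdo_def h)
  then show ?thesis using that by blast
qed

lemma hfun_of_nat: "hfun (of_nat j) z = (if 0 < Im z then of_nat j else 0)"
  by (simp add: hfun_hconst flip: hconst_of_nat)

lemma amode_to_cdo: "amode n (to_cdo v) = to_cdo (am n v)"
  by (auto simp: fun_eq_iff to_cdo_def cf_am amode_def mask_def hfun_hD hfun_off hfun_of_nat hfun_one)

lemma bmode_to_cdo: "bmode n (to_cdo v) = to_cdo (bm n v)"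
  by (auto simp: fun_eq_iff to_cdo_def cf_bm bmode_def hfun_hvar hfun_off hfun_of_nat hfun_one)

lemma bm_scale: "bm n (scale f v) = scale f (bm n v)"
  by (rule cdv_eqI, clarify) (auto simp: cf_bm algebra_simps)

lemma am_scale: "am n (scale f v) = scale f (am n v) + (if n = 0 then scale (hD f) v else 0)"
  by (rule cdv_eqI, clarify) (auto simp: cf_am hD_mult algebra_simps)

text \<open>Linearity is over constants only, because \<open>am 0\<close> differentiates the
  coefficients and hence does not commute with \<open>scale f\<close> for general
  \<open>f\<close>.\<close>

definition clin :: "(cdv \<Rightarrow> cdv) \<Rightarrow> bool" where
  "clin T \<longleftrightarrow> (\<forall>v w. T (v + w) = T v + T w) \<and> (\<forall>c v. T (sc c v) = sc c (T v))"

lemma clin_add: "clin T \<Longrightarrow> T (v + w) = T v + T w"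
  and clin_sc: "clin T \<Longrightarrow> T (sc c v) = sc c (T v)"
  by (auto simp: clin_def)

lemma clin_0: "clin T \<Longrightarrow> T 0 = 0"
  using clin_add[of T 0 0] by simp

lemma clin_uminus: "clin T \<Longrightarrow> T (- v) = - T v"
  using clin_add[of T v "- v"] by (simp add: clin_0 eq_neg_iff_add_eq_0 add.commute)

lemma clin_diff: "clin T \<Longrightarrow> T (v - w) = T v - T w"
  using clin_add[of T v "- w"] by (simp add: clin_uminus)

lemma clin_sum: "clin T \<Longrightarrow> T (sum F A) = (\<Sum>x\<in>A. T (F x))"
  by (induction A rule: infinite_finite_induct) (auto simp: clin_add clin_0)

lemma clin_Sum_any:
  assumes "clin T" "finite {x. F x \<noteq> 0}"
  shows "T (Sum_any F) = Sum_any (\<lambda>x. T (F x))"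
proof -
  have "Sum_any (\<lambda>x. T (F x)) = (\<Sum>x\<in>{x. F x \<noteq> 0}. T (F x))"
    by (rule Sum_any.expand_superset) (use assms clin_0 in auto)
  then show ?thesis by (simp add: Sum_any.expand_set clin_sum assms)
qed

lemma clin_scale: "clin (scale f)"
  by (simp add: clin_def scale_add_right scale_scale mult.commute)

lemma scale_diff_right: "scale f (v - w) = scale f v - scale f w"
  by (rule clin_diff[OF clin_scale])

lemma clin_bm: "clin (bm n)"
  unfolding clin_def by (auto simp: bm_scale intro!: cdv_eqI) (auto simp: cf_bm algebra_simps)

lemma clin_am: "clin (am n)"
  unfolding clin_def by (auto simp: am_scale intro!: cdv_eqI) (auto simp: cf_am hD_add algebra_simps)

lemma clin_zero_op: "clin (\<lambda>v. 0)"
  by (simp add: clin_def)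

lemma clin_plus: "clin S \<Longrightarrow> clin T \<Longrightarrow> clin (\<lambda>v. S v + T v)"
  by (simp add: clin_def scale_add_right algebra_simps)

lemma clin_minus: "clin S \<Longrightarrow> clin T \<Longrightarrow> clin (\<lambda>v. S v - T v)"
  by (simp add: clin_def scale_add_right scale_diff_right)

lemma clin_comp: "clin S \<Longrightarrow> clin T \<Longrightarrow> clin (\<lambda>v. S (T v))"
  by (simp add: clin_def)

lemma clin_Sum_anyI:
  assumes "\<And>x. clin (F x)" "\<And>v. finite {x. F x v \<noteq> 0}"
  shows "clin (\<lambda>v. Sum_any (\<lambda>x. F x v))"
  using assms clin_Sum_any[OF clin_scale, of "\<lambda>x. F x _"]
  by (simp add: clin_def Sum_any.distrib)

section \<open>Supports, weights and the grading by \<open>lval\<close>\<close>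

definition supp :: "cdv \<Rightarrow> key set" where "supp v = {k. cf v k \<noteq> 0}"

lemma finite_supp: "finite (supp v)"
  unfolding supp_def by (rule cf_finite)

lemma supp_empty_iff: "supp v = {} \<longleftrightarrow> v = 0"
  by (auto simp: supp_def intro: cdv_eqI)

lemma supp_add: "supp (v + w) \<subseteq> supp v \<union> supp w"
  by (auto simp: supp_def)

lemma supp_scale: "supp (scale f v) \<subseteq> supp v"
  by (auto simp: supp_def)

lemma supp_sum: "supp (sum F A) \<subseteq> (\<Union>x\<in>A. supp (F x))"
  by (induction A rule: infinite_finite_induct) (use supp_add in \<open>auto simp: supp_def\<close>)

lemma supp_Sum_any: "supp (Sum_any F) \<subseteq> (\<Union>x. supp (F x))"
  unfolding Sum_any.expand_set using supp_sum by fastforce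

text \<open>Adding an a-part and removing a b-part both raise \<open>lval\<close> by one, and both
  change the weight by minus the mode index.\<close>

lemma supp_am:
  assumes "k \<in> supp (am n v)"
  shows "\<exists>k'\<in>supp v. int (weight k) = int (weight k') - n \<and> lval k = lval k' + (if n = 0 then 0 else 1)"
proof -
  obtain l m where k: "k = (l, m)" by (cases k)
  consider "n < 0" | "n = 0" | "n > 0" by linarith
  then show ?thesis
  proof cases
    case 1
    then have "nat (- n) \<in># l" "cf v (l - {#nat (- n)#}, m) \<noteq> 0"
      using assms by (auto simp: supp_def k cf_am split: if_splits)
    moreover from this obtain l' where "l = add_mset (nat (- n)) l'" by (meson multi_member_split)
    ultimately show ?thesis using 1
      by (intro bexI[of _ "(l', m)"]) (auto simp: supp_def weight_def lval_def k)
  next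
    case 2
    then show ?thesis using assms
      by (intro bexI[of _ k]) (auto simp: supp_def weight_def lval_def k cf_am)
  next
    case 3
    then have "cf v (l, add_mset (nat n) m) \<noteq> 0"
      using assms by (auto simp: supp_def k cf_am split: if_splits)
    then show ?thesis using 3
      by (intro bexI[of _ "(l, add_mset (nat n) m)"]) (auto simp: supp_def weight_def lval_def k)
  qed
qed

lemma supp_bm:
  assumes "k \<in> supp (bm n v)"
  shows "\<exists>k'\<in>supp v. int (weight k) = int (weight k') - n \<and> lval k = lval k' - (if n = 0 then 0 else 1)"
proof -
  obtain l m where k: "k = (l, m)" by (cases k)
  consider "n < 0" | "n = 0" | "n > 0" by linarith
  then show ?thesis
  proof cases
    case 1
    then have "nat (- n) \<in># m" "cf v (l, m - {#nat (- n)#}) \<noteq> 0"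
      using assms by (auto simp: supp_def k cf_bm split: if_splits)
    moreover from this obtain m' where "m = add_mset (nat (- n)) m'" by (meson multi_member_split)
    ultimately show ?thesis using 1
      by (intro bexI[of _ "(l, m')"]) (auto simp: supp_def weight_def lval_def k)
  next
    case 2
    then show ?thesis using assms
      by (intro bexI[of _ k]) (auto simp: supp_def weight_def lval_def k cf_bm)
  next
    case 3
    then have "cf v (add_mset (nat n) l, m) \<noteq> 0"
      using assms by (auto simp: supp_def k cf_bm split: if_splits)
    then show ?thesis using 3
      by (intro bexI[of _ "(add_mset (nat n) l, m)"]) (auto simp: supp_def weight_def lval_def k)
  qed
qed

text \<open>Every vector has finitely many weights, so a mode of index above the bound annihilates
  it. The infinite sums of modes below are finite for this reason.\<close>

definition wle :: "int \<Rightarrow> cdv \<Rightarrow> bool" where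
  "wle W v \<longleftrightarrow> (\<forall>k\<in>supp v. int (weight k) \<le> W)"

lemma wle_ex: "\<exists>W. wle W v"
proof (cases "supp v = {}")
  case False
  then show ?thesis
    using finite_supp[of v]
    by (intro exI[of _ "Max ((\<lambda>k. int (weight k)) ` supp v)"]) (auto simp: wle_def)
qed (auto simp: wle_def)

lemma wle_neg: "wle W v \<Longrightarrow> W < 0 \<Longrightarrow> v = 0"
  by (subst supp_empty_iff[symmetric]) (force simp: wle_def)

lemma wle_mono: "wle W v \<Longrightarrow> W \<le> W' \<Longrightarrow> wle W' v"
  by (force simp: wle_def)

lemma wle_am: "wle W v \<Longrightarrow> wle (W - n) (am n v)"
  unfolding wle_def by (fastforce dest: supp_am)

lemma wle_bm: "wle W v \<Longrightarrow> wle (W - n) (bm n v)"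
  unfolding wle_def by (fastforce dest: supp_bm)

lemma am_eq_0: "wle W v \<Longrightarrow> W < n \<Longrightarrow> am n v = 0"
  using wle_am wle_neg by fastforce

section \<open>Modes of f(b(z))\<close>

definition bpr :: "int multiset \<Rightarrow> cdv \<Rightarrow> cdv" where
  "bpr R v = foldr bm (sorted_list_of_multiset R) v"

lemma foldr_insort_commute:
  assumes "\<And>x y v. F x (F y v) = F y (F x v)"
  shows "foldr F (insort x xs) v = F x (foldr F xs v)"
  by (induction xs) (auto simp: assms)

lemma bpr_empty [simp]: "bpr {#} v = v"
  by (simp add: bpr_def)

lemma bpr_add_mset: "bpr (add_mset r R) v = bm r (bpr R v)"
  unfolding bpr_def sorted_list_of_multiset_insert
  by (rule foldr_insort_commute) (rule bm_commute)

lemma bpr_bm: "bpr R (bm n v) = bm n (bpr R v)"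
  by (induction R) (auto simp: bpr_add_mset bm_commute)

lemma bpr_union: "bpr (R + S) v = bpr R (bpr S v)"
  by (induction R) (auto simp: bpr_add_mset)

lemma clin_bpr: "clin (bpr R)"
proof (induction R)
  case empty
  then show ?case by (simp add: clin_def)
next
  case (add r R)
  then show ?case by (simp add: clin_def bpr_add_mset clin_add[OF clin_bm] clin_sc[OF clin_bm])
qed

lemma bpr_scale: "bpr R (scale f v) = scale f (bpr R v)"
  by (induction R) (auto simp: bpr_add_mset bm_scale)

lemma wle_bpr: "wle W v \<Longrightarrow> wle (W - sum_mset R) (bpr R v)"
proof (induction R)
  case (add r R)
  then show ?case using wle_bm[of "W - sum_mset R" "bpr R v" r] by (simp add: bpr_add_mset algebra_simps)
qed simp

lemma am_bpr: "am k (bpr R v) = bpr R (am k v) + sc (of_nat (count R (- k))) (bpr (R - {#- k#}) v)"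
proof (induction R)
  case (add r R)
  show ?case
  proof (cases "r = - k")
    case True
    show ?thesis
    proof (cases "- k \<in># R")
      case 2: True
      then obtain S where R: "R = add_mset (- k) S" by (meson multi_member_split)
      have "sc 2 w = w + w" for w using scale_add_left[of 1 1 w] hconst_add[of 1 1] by simp
      then show ?thesis unfolding True R using add.IH[unfolded R]
        by (simp add: bpr_add_mset am_bm clin_add[OF clin_bm] clin_sc[OF clin_bm] hconst_add scale_add_left algebra_simps)
    next
      case 2: False
      then show ?thesis unfolding True using add.IH
        by (simp add: bpr_add_mset am_bm clin_add[OF clin_bm] not_in_iff)
    qed
  next
    case False
    have "bm r (bpr (R - {#- k#}) v) = bpr (add_mset r (R - {#- k#})) v"
      by (simp add: bpr_add_mset)
    moreover have "add_mset r (R - {#- k#}) = add_mset r R - {#- k#}"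
      using False by auto
    moreover have "count (add_mset r R) (- k) = count R (- k)" using False by simp
    moreover have "k + r \<noteq> 0" using False by simp
    ultimately show ?thesis using add.IH
      by (simp add: bpr_add_mset am_bm clin_add[OF clin_bm] clin_sc[OF clin_bm] del: add_mset_remove_trivial_eq diff_add_mset_swap)
  qed
qed simp

lemma finite_multisets_bounded: "finite A \<Longrightarrow> finite {R. set_mset R \<subseteq> A \<and> size R \<le> K}"
proof -
  assume "finite A"
  have "{R. set_mset R \<subseteq> A \<and> size R \<le> K} \<subseteq> mset ` {xs. set xs \<subseteq> A \<and> length xs \<le> K}"
  proof
    fix R assume R: "R \<in> {R. set_mset R \<subseteq> A \<and> size R \<le> K}"
    obtain xs where "R = mset xs" by (metis ex_mset)
    with R show "R \<in> mset ` {xs. set xs \<subseteq> A \<and> length xs \<le> K}" by auto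
  qed
  then show ?thesis
    using finite_lists_length_le[OF \<open>finite A\<close>] finite_subset by blast
qed

lemma sum_mset_int_nonneg: "\<forall>r\<in>#R. 0 \<le> r \<Longrightarrow> 0 \<le> sum_mset (R :: int multiset)"
  by (induction R) auto

lemma sum_mset_int_uminus: "sum_mset (image_mset uminus R) = - sum_mset (R :: int multiset)"
  by (induction R) auto

lemma sum_mset_bound:
  fixes R :: "int multiset"
  assumes "\<forall>r\<in>#R. 0 < r" "sum_mset R \<le> K"
  shows "int (size R) \<le> K \<and> (\<forall>r\<in>#R. r \<le> K)"
  using assms
proof (induction R arbitrary: K)
  case (add r R)
  then have "int (size R) \<le> K - r \<and> (\<forall>x\<in>#R. x \<le> K - r)" by auto
  moreover have "0 \<le> sum_mset R" using add.prems(1) by (intro sum_mset_int_nonneg) auto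
  ultimately show ?case using add.prems by auto
qed auto

text \<open>Commutativity lets the positive indices act first; their sum cannot exceed the weight
  bound without killing the vector. The fixed total then bounds the negative indices, and with them
  the entries and the size of the multiset.\<close>

lemma bpr_finite: "finite {R. 0 \<notin># R \<and> sum_mset R = n \<and> bpr R v \<noteq> 0}"
proof -
  obtain W where W: "wle W v" using wle_ex by blast
  define K where "K = \<bar>W\<bar> + \<bar>n\<bar>"
  have "{R. 0 \<notin># R \<and> sum_mset R = n \<and> bpr R v \<noteq> 0} \<subseteq> {R. set_mset R \<subseteq> {-K..K} \<and> size R \<le> nat (2 * K)}"
  proof clarify
    fix R assume R: "0 \<notin># R" "n = sum_mset R" "bpr R v \<noteq> 0"
    define P where "P = filter_mset (\<lambda>r. 0 < r) R"
    define Q where "Q = image_mset uminus (filter_mset (\<lambda>r. \<not> 0 < r) R)"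
    have RPQ: "R = filter_mset (\<lambda>r. \<not> 0 < r) R + P"
      unfolding P_def using multiset_partition[of R "\<lambda>r. 0 < r"] by simp
    have P1: "sum_mset P \<le> W"
    proof (rule ccontr)
      assume "\<not> sum_mset P \<le> W"
      then have "bpr P v = 0" using wle_bpr[OF W, of P] wle_neg by force
      then have "bpr R v = 0" by (subst RPQ) (simp add: bpr_union clin_0[OF clin_bpr])
      with R show False by simp
    qed
    have "sum_mset R = sum_mset P - sum_mset Q"
      by (subst RPQ) (simp add: Q_def sum_mset_int_uminus)
    moreover have "0 \<le> sum_mset P" unfolding P_def by (intro sum_mset_int_nonneg) auto
    ultimately have "sum_mset P \<le> K" "sum_mset Q \<le> K" using P1 R(2) by (auto simp: K_def)
    moreover have "\<forall>r\<in>#P. 0 < r" by (auto simp: P_def)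
    moreover have "\<forall>r\<in>#Q. 0 < r" using R(1) by (force simp: Q_def not_less order_le_less)
    ultimately have PQ: "int (size P) \<le> K" "\<forall>r\<in>#P. r \<le> K" "int (size Q) \<le> K" "\<forall>r\<in>#Q. r \<le> K"
      using sum_mset_bound by blast+
    have "size R = size P + size Q"
      by (subst RPQ) (simp add: Q_def)
    moreover have "set_mset R \<subseteq> {-K..K}"
    proof
      fix r assume "r \<in># R"
      then consider "r > 0" "r \<in># P" | "r \<le> 0" "- r \<in># Q" by (force simp: P_def Q_def)
      then show "r \<in> {-K..K}"
      proof cases
        case 1
        then have "r \<le> K" using PQ(2) by blast
        with 1 show ?thesis by simp
      next
        case 2
        then have "- r \<le> K" using PQ(4) by blast
        with 2 show ?thesis by simp
      qed
    qed
    ultimately show "set_mset R \<subseteq> {-K..K} \<and> size R \<le> nat (2 * K)" using PQ by auto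
  qed
  then show ?thesis using finite_multisets_bounded finite_subset by blast
qed

text \<open>A multiset R arises from \<open>fact (size R) / mfact R\<close> sequences, so
  \<open>1 / mfact R\<close> is what remains of the coefficient 1/i! of the i-th power in Y(f, z)
  once commuting factors are collected.\<close>

definition mfact :: "int multiset \<Rightarrow> nat" where
  "mfact R = (\<Prod>r\<in>set_mset R. fact (count R r))"

lemma mfact_pos: "mfact R > 0"
  unfolding mfact_def by (intro prod_pos) auto

lemma mfact_add_mset: "mfact (add_mset r R) = Suc (count R r) * mfact R"
proof -
  have *: "mfact S = fact (count S r) * (\<Prod>x\<in>set_mset S - {r}. fact (count S x))" for S
    unfolding mfact_def by (cases "r \<in># S") (auto simp: prod.remove not_in_iff)
  have "(\<Prod>x\<in>set_mset (add_mset r R) - {r}. fact (count (add_mset r R) x)) =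
        (\<Prod>x\<in>set_mset R - {r}. fact (count R x) :: nat)"
    by (rule prod.cong) auto
  then show ?thesis unfolding *[of "add_mset r R"] *[of R] by (simp add: algebra_simps)
qed

definition Hterm :: "hol \<Rightarrow> int \<Rightarrow> int multiset \<Rightarrow> cdv \<Rightarrow> cdv" where
  "Hterm f n R v = (if 0 \<notin># R \<and> sum_mset R = n
     then scale (hconst (1 / of_nat (mfact R)) * (hD ^^ size R) f) (bpr R v) else 0)"

text \<open>\<open>Hm f n\<close> is the coefficient of \<open>z\<^sup>-\<^sup>n\<close> in \<open>f(b(z))\<close>.\<close>

definition Hm :: "hol \<Rightarrow> int \<Rightarrow> cdv \<Rightarrow> cdv" where
  "Hm f n v = Sum_any (\<lambda>R. Hterm f n R v)"

lemma Hterm_finite: "finite {R. Hterm f n R v \<noteq> 0}"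
  by (rule finite_subset[OF _ bpr_finite[of n v]]) (auto simp: Hterm_def)

lemma Hmode_to_cdo: "Hmode (hfun f) n (to_cdo v) = to_cdo (Hm f n v)"
proof -
  have "foldr bmode xs (to_cdo v) = to_cdo (foldr bm xs v)" for xs
    by (induction xs) (auto simp: bmode_to_cdo)
  then have b: "bprod R (to_cdo v) = to_cdo (bpr R v)" for R
    unfolding bprod_def bpr_def by simp
  let ?F = "\<lambda>R. (\<lambda>k z. hderiv (size R) (hfun f) z
        / of_nat (\<Prod>r\<in>set_mset R. fact (count R r)) * bprod R (to_cdo v) k z)"
  have F: "?F R = to_cdo (Hterm f n R v)" if "0 \<notin># R" "sum_mset R = n" for R
    unfolding b using that
    by (auto simp: Hterm_def to_cdo_def fun_eq_iff hderiv_hfun hfun_hconst hfun_off mfact_def)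
  have set: "{R \<in> {R. 0 \<notin># R \<and> sum_mset R = n}. ?F R \<noteq> 0} = {R. Hterm f n R v \<noteq> 0}"
  proof (intro set_eqI iffI)
    fix R assume "R \<in> {R. Hterm f n R v \<noteq> 0}"
    then show "R \<in> {R \<in> {R. 0 \<notin># R \<and> sum_mset R = n}. ?F R \<noteq> 0}"
      using F[of R] by (auto simp: Hterm_def split: if_splits)
  qed (use F in auto)
  have "Hmode (hfun f) n (to_cdo v) = sum ?F {R. Hterm f n R v \<noteq> 0}"
    unfolding Hmode_def fsum_def set ..
  also have "\<dots> = (\<Sum>R\<in>{R. Hterm f n R v \<noteq> 0}. to_cdo (Hterm f n R v))"
    by (rule sum.cong) (use F in \<open>auto simp: Hterm_def split: if_splits\<close>)
  finally show ?thesis by (simp add: Hm_def Sum_any.expand_set to_cdo_sum)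
qed

lemma clin_Hterm: "clin (Hterm f n R)"
  unfolding Hterm_def
  by (cases "0 \<notin># R \<and> sum_mset R = n")
     (simp_all add: clin_zero_op clin_comp[OF clin_scale clin_bpr] del: de_Morgan_conj)

lemma clin_Hm: "clin (Hm f n)"
  unfolding Hm_def by (intro clin_Sum_anyI clin_Hterm Hterm_finite)

lemma Hm_add_left: "Hm (f + g) n v = Hm f n v + Hm g n v"
  unfolding Hm_def Sum_any.distrib[OF Hterm_finite Hterm_finite, symmetric]
  by (rule Sum_any.cong) (auto simp: Hterm_def hD_funpow_add distrib_left scale_add_left)

lemma Hm_hconst_mult: "Hm (hconst c * f) n v = sc c (Hm f n v)"
  unfolding Hm_def clin_Sum_any[OF clin_scale Hterm_finite]
  by (rule Sum_any.cong) (auto simp: Hterm_def hD_funpow_hconst_mult scale_scale mult.left_commute)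

lemma Hm_0_left [simp]: "Hm 0 n v = 0"
  using Hm_hconst_mult[of 0 0] by simp

lemma Hm_bm: "Hm f n (bm k v) = bm k (Hm f n v)"
  unfolding Hm_def clin_Sum_any[OF clin_bm Hterm_finite]
  by (rule Sum_any.cong) (auto simp: Hterm_def bpr_bm bm_scale clin_0[OF clin_bm])

lemma Hm_scale: "Hm f n (scale g v) = scale g (Hm f n v)"
  unfolding Hm_def clin_Sum_any[OF clin_scale Hterm_finite]
  by (rule Sum_any.cong) (auto simp: Hterm_def bpr_scale scale_scale algebra_simps)

lemma Hm_bpr: "Hm f n (bpr R v) = bpr R (Hm f n v)"
  by (induction R) (auto simp: bpr_add_mset Hm_bm)

lemma Hm_commute: "Hm f m (Hm g n v) = Hm g n (Hm f m v)"
  unfolding Hm_def[of g] clin_Sum_any[OF clin_Hm Hterm_finite]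
  by (rule Sum_any.cong) (auto simp: Hterm_def Hm_scale Hm_bpr clin_0[OF clin_Hm])

lemma supp_bpr:
  "k \<in> supp (bpr R v) \<Longrightarrow> 0 \<notin># R \<Longrightarrow>
   \<exists>k'\<in>supp v. int (weight k) = int (weight k') - sum_mset R \<and> lval k = lval k' - int (size R)"
proof (induction R arbitrary: k)
  case (add r R)
  then obtain k' where "k' \<in> supp (bpr R v)" "int (weight k) = int (weight k') - r" "lval k = lval k' - 1"
    using supp_bm[of k r "bpr R v"] by (auto simp: bpr_add_mset)
  then show ?case using add.IH[of k'] add.prems by force
qed auto

text \<open>Each b-mode of nonzero index lowers \<open>lval\<close> by one. The only term without
  such a mode is that of the empty multiset, which occurs for n = 0 alone.\<close>

lemma supp_Hm:
  assumes "k \<in> supp (Hm f n v)"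
  shows "\<exists>k'\<in>supp v. int (weight k) = int (weight k') - n \<and>
     (lval k \<le> lval k' - 1 \<or> lval k = lval k' \<and> n = 0)"
proof -
  obtain R where R: "k \<in> supp (Hterm f n R v)"
    using assms supp_Sum_any unfolding Hm_def by fastforce
  then have "0 \<notin># R" "sum_mset R = n" "k \<in> supp (bpr R v)"
    using supp_scale by (auto simp: Hterm_def supp_def split: if_splits)
  then obtain k' where k': "k' \<in> supp v" "int (weight k) = int (weight k') - n" "lval k = lval k' - int (size R)"
    using supp_bpr[of k R v] by auto
  then show ?thesis using \<open>sum_mset R = n\<close> by (cases R) (auto intro!: bexI[of _ k'])
qed

lemma wle_Hm: "wle W v \<Longrightarrow> wle (W - n) (Hm f n v)"
  unfolding wle_def by (fastforce dest: supp_Hm)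

lemma Hm_eq_0: "wle W v \<Longrightarrow> W < n \<Longrightarrow> Hm f n v = 0"
  using wle_Hm wle_neg by fastforce

text \<open>For k \<noteq> 0 the commutator with a_k deletes one index -k from the multiset, and
  \<open>count R (- k)\<close> over \<open>mfact R\<close> equals 1 over \<open>mfact S\<close> when
  S is R with that index deleted; this gives back the coefficients belonging to f'. For k = 0 the
  coefficient functions are differentiated directly.\<close>

lemma am_Hm: "am k (Hm f n v) = Hm f n (am k v) + Hm (hD f) (n + k) v"
proof (cases "k = 0")
  case True
  show ?thesis
    unfolding Hm_def clin_Sum_any[OF clin_am Hterm_finite] Sum_any.distrib[OF Hterm_finite Hterm_finite, symmetric] True
  proof (rule Sum_any.cong)
    fix R
    show "am 0 (Hterm f n R v) = Hterm f n R (am 0 v) + Hterm (hD f) (n + 0) R v"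
      using am_bpr[of 0 R v]
      by (cases "0 \<in># R") (auto simp: Hterm_def am_scale clin_0[OF clin_am] hD_mult not_in_iff[THEN iffD1] funpow_swap1)
  qed
next
  case False
  define G where "G = (\<lambda>R. if - k \<in># R then Hterm (hD f) (n + k) (R - {#- k#}) v else 0)"
  have inj: "inj_on (add_mset (- k)) S" for S by (auto simp: inj_on_def)
  have sub: "{R. G R \<noteq> 0} \<subseteq> add_mset (- k) ` {R. Hterm (hD f) (n + k) R v \<noteq> 0}"
  proof
    fix R assume "R \<in> {R. G R \<noteq> 0}"
    then have "- k \<in># R" "Hterm (hD f) (n + k) (R - {#- k#}) v \<noteq> 0"
      by (auto simp: G_def split: if_splits)
    then show "R \<in> add_mset (- k) ` {R. Hterm (hD f) (n + k) R v \<noteq> 0}"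
      by (intro image_eqI[of _ _ "R - {#- k#}"]) auto
  qed
  have fin: "finite {R. G R \<noteq> 0}"
    by (rule finite_subset[OF sub]) (simp add: Hterm_finite)
  have "Sum_any G = (\<Sum>R\<in>add_mset (- k) ` {R. Hterm (hD f) (n + k) R v \<noteq> 0}. G R)"
    by (rule Sum_any.expand_superset) (use sub in \<open>simp_all add: Hterm_finite\<close>)
  also have "\<dots> = (\<Sum>R\<in>{R. Hterm (hD f) (n + k) R v \<noteq> 0}. Hterm (hD f) (n + k) R v)"
    by (subst sum.reindex[OF inj]) (simp add: G_def)
  finally have G: "Sum_any G = Hm (hD f) (n + k) v"
    by (simp add: Hm_def Sum_any.expand_set)
  show ?thesis
    unfolding G[symmetric] unfolding Hm_def clin_Sum_any[OF clin_am Hterm_finite] Sum_any.distrib[OF Hterm_finite fin, symmetric]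
  proof (rule Sum_any.cong)
    fix R
    show "am k (Hterm f n R v) = Hterm f n R (am k v) + G R"
    proof (cases "- k \<in># R")
      case True
      then obtain S where R: "R = add_mset (- k) S" by (meson multi_member_split)
      have c: "hconst (1 / of_nat (mfact R)) * hconst (of_nat (count R (- k))) = hconst (1 / of_nat (mfact S))"
        unfolding hconst_mult[symmetric] R mfact_add_mset of_nat_mult using mfact_pos[of S]
        by (simp del: of_nat_Suc)
      show ?thesis
      proof (cases "0 \<notin># R \<and> sum_mset R = n")
        case 2: True
        then have "G R = scale (hconst (1 / of_nat (mfact S)) * (hD ^^ size R) f) (bpr S v)"
          using True by (auto simp: G_def R Hterm_def funpow_swap1)
        also have "\<dots> = scale (hconst (1 / of_nat (mfact R)) * (hD ^^ size R) f) (sc (of_nat (count R (- k))) (bpr S v))"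
          unfolding scale_scale c[symmetric] by (simp add: algebra_simps)
        finally show ?thesis using 2 False am_bpr[of k R v]
          by (simp add: Hterm_def am_scale scale_add_right R)
      next
        case 2: False
        then have "G R = 0" using True False by (auto simp: G_def R Hterm_def)
        then show ?thesis using 2 by (auto simp: Hterm_def clin_0[OF clin_am])
      qed
    next
      case 2: False
      then have "count R (- k) = 0" by (simp add: not_in_iff)
      then show ?thesis using 2 False am_bpr[of k R v]
        by (simp add: G_def Hterm_def am_scale clin_0[OF clin_am])
    qed
  qed
qed

lemma Hm_hconst: "Hm (hconst c) n v = (if n = 0 then sc c v else 0)"
proof -
  have d: "(hD ^^ Suc j) (hconst c) = 0" for j
    by (simp add: funpow_swap1)
  have "Hterm (hconst c) n R v = (if R = {#} then (if n = 0 then sc c v else 0) else 0)" for R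
    by (cases R) (auto simp: Hterm_def d mfact_def simp del: funpow.simps)
  then show ?thesis unfolding Hm_def by simp
qed

lemma Hm_1: "Hm 1 n v = (if n = 0 then v else 0)"
  using Hm_hconst[of 1] by simp

lemma Hm_hvar: "Hm hvar n v = bm n v"
proof -
  have d: "(hD ^^ Suc (Suc j)) hvar = 0" for j
    by (simp add: funpow_swap1)
  have "Hterm hvar n R v = (if R = (if n = 0 then {#} else {#n#}) then bm n v else 0)" for R
  proof (cases "size R = 0 \<or> size R = 1")
    case True
    then consider "R = {#}" | r where "R = {#r#}" by (metis size_1_singleton_mset size_eq_0_iff_empty)
    then show ?thesis
    proof cases
      case 1
      then show ?thesis by (auto simp: Hterm_def mfact_def intro!: cdv_eqI) (simp add: cf_bm)
    next
      case 2
      then show ?thesis by (auto simp: Hterm_def mfact_def bpr_add_mset)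
    qed
  next
    case False
    then obtain j where "size R = Suc (Suc j)"
      by (metis One_nat_def not0_implies_Suc)
    moreover from this have "R \<noteq> (if n = 0 then {#} else {#n#})" by auto
    ultimately show ?thesis by (simp add: Hterm_def d del: funpow.simps)
  qed
  then show ?thesis unfolding Hm_def by simp
qed

lemma wle_cvac: "wle 0 (cvac F)"
  by (auto simp: wle_def supp_def cf_mono weight_def split: if_splits)

lemma am_cvac: "0 < n \<Longrightarrow> am n (cvac F) = 0" "am 0 (cvac F) = cvac (hD F)"
  by (rule am_eq_0[OF wle_cvac]) (auto simp: cf_am cf_mono intro!: cdv_eqI)

lemma Hm_cvac: "0 < n \<Longrightarrow> Hm f n (cvac F) = 0" "Hm f 0 (cvac F) = cvac (f * F)"
proof -
  show "0 < n \<Longrightarrow> Hm f n (cvac F) = 0"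
    by (rule Hm_eq_0[OF wle_cvac])
  have "Hterm f 0 R (cvac F) = (if R = {#} then cvac (f * F) else 0)" for R
  proof (cases "R = {#} \<or> sum_mset R \<noteq> 0 \<or> 0 \<in># R")
    case True
    then show ?thesis by (auto simp: Hterm_def mfact_def cf_mono intro!: cdv_eqI)
  next
    case False
    \<comment> \<open>A nonempty multiset of nonzero integers with sum zero contains a positive one,
      whose b-mode commutes to the vacuum and kills it.\<close>
    have "\<exists>r\<in>#R. 0 < r"
    proof (rule ccontr)
      assume *: "\<not> ?thesis"
      then have "\<forall>r\<in>#image_mset uminus R. 0 < r" using False by (force simp: not_less order_le_less)
      from sum_mset_bound[OF this, of 0] False show False
        by (auto simp: sum_mset_int_uminus)
    qed
    then obtain r S where "0 < r" "R = add_mset r S" by (meson multi_member_split)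
    moreover from this have "bm r (cvac F) = 0" using Hm_eq_0[OF wle_cvac, of r hvar] by (simp add: Hm_hvar)
    ultimately have "bpr R (cvac F) = 0"
      by (simp add: bpr_add_mset flip: bpr_bm) (simp add: clin_0[OF clin_bpr])
    then show ?thesis using False by (simp add: Hterm_def)
  qed
  then show "Hm f 0 (cvac F) = cvac (f * F)" unfolding Hm_def by simp
qed

section \<open>Fields determined by their commutators\<close>

lemma of_nat_Suc_hol_cancel: "of_nat (Suc j) * f = 0 \<Longrightarrow> f = (0 :: hol)"
proof -
  assume *: "of_nat (Suc j) * f = 0"
  have "f = hconst (1 / of_nat (Suc j)) * hconst (of_nat (Suc j)) * f"
    unfolding hconst_mult[symmetric] by (simp del: of_nat_Suc)
  with * show ?thesis by (metis hconst_of_nat mult.assoc mult_zero_right)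
qed

text \<open>Positive modes are, up to sign, the partial derivatives in the creation variables, so a
  vector killed by all of them consists of its vacuum coefficient. The multiplicities that appear as
  factors can be divided out over the complex numbers.\<close>

lemma singular_vector_zero:
  assumes "\<And>n. 0 < n \<Longrightarrow> am n w = 0" "\<And>n. 0 < n \<Longrightarrow> bm n w = 0" "cf w ({#}, {#}) = 0"
  shows "w = 0"
proof (rule cdv_eqI, clarify)
  fix l m
  show "cf w (l, m) = cf 0 (l, m)"
  proof (cases "is_partition l \<and> is_partition m")
    case False
    then show ?thesis using cf_partition[of w "(l, m)"] by auto
  next
    case True
    show ?thesis
    proof (cases m)
      case (add n m')
      then have "0 < n" using True by simp
      then have "of_nat (Suc (count m' n)) * cf w (l, m) = 0"
        using assms(1)[of "int n"] cf_am[of "int n" w l m'] by (simp add: add)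
      then show ?thesis using of_nat_Suc_hol_cancel by simp
    next
      case m: empty
      show ?thesis
      proof (cases l)
        case (add n l')
        then have "0 < n" using True by simp
        then have "- (of_nat (Suc (count l' n)) * cf w (l, m)) = 0"
          using assms(2)[of "int n"] cf_bm[of "int n" w l' m] by (simp add: add algebra_simps)
        then show ?thesis using of_nat_Suc_hol_cancel by simp
      qed (use m assms(3) in simp)
    qed
  qed
qed

lemma mono_add_mset_left: "0 < n \<Longrightarrow> fmono (add_mset n l, m) F = am (- int n) (fmono (l, m) F)"
  by (rule cdv_eqI, clarify) (auto simp: cf_am cf_mono dest: multi_member_split)

lemma mono_add_mset_right: "0 < n \<Longrightarrow> fmono (l, add_mset n m) F = bm (- int n) (fmono (l, m) F)"
  by (rule cdv_eqI, clarify) (auto simp: cf_bm cf_mono dest: multi_member_split)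

lemma mono_0 [simp]: "fmono k 0 = 0"
  by (rule cdv_eqI) (simp add: cf_mono)

lemma cdv_eq_sum_mono: "finite S \<Longrightarrow> supp v \<subseteq> S \<Longrightarrow> v = (\<Sum>k\<in>S. fmono k (cf v k))"
proof (rule cdv_eqI)
  fix k assume S: "finite S" "supp v \<subseteq> S"
  have "(\<Sum>k'\<in>S. cf (fmono k' (cf v k')) k) = (\<Sum>k'\<in>S. if k' = k then cf v k else 0)"
    using cf_partition[of v k] by (intro sum.cong) (auto simp: cf_mono)
  also have "\<dots> = cf v k" using S by (auto simp: supp_def)
  finally show "cf v k = cf (\<Sum>k\<in>S. fmono k (cf v k)) k" by (simp add: cf_sum)
qed

lemma cdv_induct [case_names vac a b add]:
  assumes vac: "\<And>F. P (cvac F)"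
    and a: "\<And>n v. 0 < n \<Longrightarrow> P v \<Longrightarrow> P (am (- n) v)"
    and b: "\<And>n v. 0 < n \<Longrightarrow> P v \<Longrightarrow> P (bm (- n) v)"
    and add: "\<And>v w. P v \<Longrightarrow> P w \<Longrightarrow> P (v + w)"
  shows "P v"
proof -
  have mb: "is_partition m \<Longrightarrow> P (fmono ({#}, m) F)" for m F
    by (induction m) (auto simp: mono_add_mset_right vac b)
  have m: "is_partition l \<Longrightarrow> is_partition m \<Longrightarrow> P (fmono (l, m) F)" for l m F
    by (induction l) (auto simp: mono_add_mset_left mb a)
  have P0: "P 0" using vac[of 0] by simp
  have Pk: "P (fmono k (cf v k))" for k
    using m[of "fst k" "snd k"] cf_partition[of v k] P0 by (cases "cf v k = 0") auto
  have "P (\<Sum>k\<in>S. fmono k (cf v k))" if fin: "finite S" for S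
    using fin by (induction S rule: finite_induct) (auto simp: P0 add Pk)
  then show ?thesis using cdv_eq_sum_mono[OF finite_supp subset_refl, of v] finite_supp[of v] by metis
qed

definition homog :: "int \<Rightarrow> cdv \<Rightarrow> bool" where
  "homog W v \<longleftrightarrow> (\<forall>k\<in>supp v. int (weight k) = W)"

lemma homog_am: "homog W v \<Longrightarrow> homog (W - n) (am n v)"
  unfolding homog_def by (fastforce dest: supp_am)

lemma homog_Hm: "homog W v \<Longrightarrow> homog (W - n) (Hm f n v)"
  unfolding homog_def by (fastforce dest: supp_Hm)

lemma homog_scale: "homog W v \<Longrightarrow> homog W (scale f v)"
  unfolding homog_def using supp_scale by blast

lemma homog_add: "homog W v \<Longrightarrow> homog W w \<Longrightarrow> homog W (v + w)"
  unfolding homog_def using supp_add by blast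

lemma homog_diff: "homog W v \<Longrightarrow> homog W w \<Longrightarrow> homog W (v - w)"
proof -
  have "supp (v - w) \<subseteq> supp v \<union> supp w" by (auto simp: supp_def)
  then show "homog W v \<Longrightarrow> homog W w \<Longrightarrow> homog W (v - w)" unfolding homog_def by blast
qed

lemma homog_Sum_any: "(\<And>x. homog W (F x)) \<Longrightarrow> homog W (Sum_any F)"
  unfolding homog_def using supp_Sum_any by blast

lemma homog_cvac: "homog 0 (cvac F)"
  by (auto simp: homog_def supp_def cf_mono weight_def split: if_splits)

lemma homog_0 [simp]: "homog W 0"
  by (simp add: homog_def supp_def)

text \<open>Since the only vectors of positive weight annihilated by all \<open>a\<^sub>n\<close>, \<open>b\<^sub>n\<close> with \<open>n > 0\<close> are zero,
  an identity between fields that is stable under commutation with \<open>a\<^sub>n\<close> and \<open>b\<^sub>n\<close> needs to be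
  checked only on the non-negative modes applied to the vacuum.\<close>

lemma operator_uniqueness:
  fixes X :: "hol \<Rightarrow> hol \<Rightarrow> int \<Rightarrow> cdv \<Rightarrow> cdv"
  assumes lin: "\<And>f g n. clin (X f g n)"
    and bm: "\<And>f g n k v. X f g n (bm k v) = bm k (X f g n v)"
    and am: "\<And>f g n k v. am k (X f g n v) = X f g n (am k v) + X (hD f) g (n + k) v + X f (hD g) (n + k) v"
    and hom: "\<And>f g n F. homog (- n) (X f g n (cvac F))"
    and vac: "\<And>f g n F. 0 \<le> n \<Longrightarrow> X f g n (cvac F) = 0"
  shows "X f g n v = 0"
proof -
  \<comment> \<open>Induction on -n: commuting with a_k for k > 0 leads to the modes n + k for
    derivatives of f and g, so all f and g are treated at once. For n < 0 the weight -n is positive,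
    which excludes a vacuum component.\<close>
  have vac0: "X f g n (cvac F) = 0" for f g n F
  proof (induction "nat (- n)" arbitrary: f g n rule: less_induct)
    case less
    show ?case
    proof (cases "0 \<le> n")
      case False
      have bz: "bm k (cvac F) = 0" if "0 < k" for k
        using Hm_cvac(1)[OF that, of hvar F] by (simp add: Hm_hvar)
      show ?thesis
      proof (rule singular_vector_zero)
        show "am k (X f g n (cvac F)) = 0" if "0 < k" for k
          using that False by (simp add: am am_cvac clin_0[OF lin] less)
        show "bm k (X f g n (cvac F)) = 0" if "0 < k" for k
          using bz[OF that] by (simp add: clin_0[OF lin] flip: bm)
        show "cf (X f g n (cvac F)) ({#}, {#}) = 0"
          using bspec[OF hom[of n f g F, unfolded homog_def], of "({#}, {#})"] False
          by (force simp: supp_def weight_def)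
      qed
    qed (rule vac)
  qed
  show ?thesis
  proof (induction v arbitrary: f g n rule: cdv_induct)
    case (a k v)
    have "X f g n (am (- k) v) = am (- k) (X f g n v) - X (hD f) g (n - k) v - X f (hD g) (n - k) v"
      by (simp add: am)
    then show ?case by (simp add: a clin_0[OF clin_am])
  qed (simp_all add: vac0 bm clin_0[OF clin_bm] clin_add[OF lin])
qed

section \<open>Products and z-derivatives of functions of b(z)\<close>

lemma finite_int_interval: "(\<And>k. F k \<noteq> 0 \<Longrightarrow> a \<le> k \<and> k \<le> b) \<Longrightarrow> finite {k :: int. F k \<noteq> (0 :: cdv)}"
  by (rule finite_subset[of _ "{a..b}"]) auto

lemma Hm_Hm_nonzero:
  assumes "wle W v" "Hm f i (Hm g j v) \<noteq> 0" shows "i \<le> W" "j \<le> W"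
proof -
  show "j \<le> W" using assms Hm_eq_0[OF assms(1), of j g] clin_0[OF clin_Hm] by force
  show "i \<le> W" using assms Hm_eq_0[OF assms(1), of i f] clin_0[OF clin_Hm] Hm_commute[of f i g j v] by force
qed

lemma Hm_Hm_finite:
  assumes "\<And>m. F m \<noteq> 0 \<Longrightarrow> Hm f (n - m) (Hm g m v) \<noteq> 0"
  shows "finite {m. F m \<noteq> (0 :: cdv)}"
proof -
  obtain W where W: "wle W v" using wle_ex by blast
  show ?thesis
    by (rule finite_int_interval[of _ "n - W" W]) (use Hm_Hm_nonzero[OF W] assms in force)
qed

lemma Sum_any_shift: "Sum_any (\<lambda>m::int. F (m + k)) = Sum_any F"
  by (rule Sum_any.reindex_cong[symmetric, of "\<lambda>m. m + k"])
     (auto simp: bij_plus_right fun_eq_iff)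

lemma Sum_any_reflect: "Sum_any (\<lambda>m::int. F (k - m)) = Sum_any F"
  by (rule Sum_any.reindex_cong[symmetric, of "\<lambda>m. k - m"])
     (auto simp: fun_eq_iff intro!: o_bij[of "\<lambda>m. k - m"])

lemma Sum_any_diff:
  assumes "finite {x. F x \<noteq> (0 :: cdv)}" "finite {x. G x \<noteq> 0}"
  shows "Sum_any (\<lambda>x. F x - G x) = Sum_any F - Sum_any G"
proof -
  have "finite {x. - G x \<noteq> 0}" using assms by simp
  moreover have "Sum_any (\<lambda>x. - G x) = - Sum_any G"
    by (simp add: Sum_any.expand_set sum_negf)
  ultimately show ?thesis using Sum_any.distrib[OF assms(1), of "\<lambda>x. - G x"] by simp
qed

text \<open>Coefficients of \<open>f(b(z)) g(b(z))\<close> with the \<open>m\<close>-th mode of the second factor weighted by \<open>w m\<close>;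
  the weight \<open>- m\<close> corresponds to \<open>f(b) z\<partial>\<^sub>z g(b)\<close>.\<close>

definition Cm :: "(int \<Rightarrow> int) \<Rightarrow> hol \<Rightarrow> hol \<Rightarrow> int \<Rightarrow> cdv \<Rightarrow> cdv" where
  "Cm w f g n v = Sum_any (\<lambda>m. sc (of_int (w m)) (Hm f (n - m) (Hm g m v)))"

lemma Cm_finite: "finite {m. sc (d m) (Hm f (n - m) (Hm g m v)) \<noteq> 0}"
  by (rule Hm_Hm_finite[where f = f and g = g and n = n and v = v]) force

lemma clin_Cm: "clin (Cm w f g n)"
  unfolding Cm_def
  by (intro clin_Sum_anyI clin_comp[OF clin_scale clin_comp[OF clin_Hm clin_Hm]] Cm_finite)

lemma Cm_bm: "Cm w f g n (bm k v) = bm k (Cm w f g n v)"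
  unfolding Cm_def clin_Sum_any[OF clin_bm Cm_finite]
  by (simp add: Hm_bm bm_scale)

lemma Cm_Hm: "Cm w f g n (Hm h k v) = Hm h k (Cm w f g n v)"
  unfolding Cm_def clin_Sum_any[OF clin_Hm Cm_finite]
  by (rule Sum_any.cong) (metis Hm_commute Hm_scale)

lemma Cm_add_weight: "Cm (\<lambda>m. w m + w' m) f g n v = Cm w f g n v + Cm w' f g n v"
  unfolding Cm_def Sum_any.distrib[OF Cm_finite Cm_finite, symmetric]
  by (simp add: hconst_add scale_add_left)

lemma Cm_const_weight: "Cm (\<lambda>m. c) f g n v = sc (of_int c) (Cm (\<lambda>m. 1) f g n v)"
  unfolding Cm_def clin_Sum_any[OF clin_scale Cm_finite]
  by (simp add: scale_scale)

lemma Cm_add_left: "Cm w (f + f') g n v = Cm w f g n v + Cm w f' g n v"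
  unfolding Cm_def Sum_any.distrib[OF Cm_finite Cm_finite, symmetric]
  by (simp add: Hm_add_left scale_add_right)

lemma Cm_hconst_left: "Cm w (hconst c * f) g n v = sc c (Cm w f g n v)"
  unfolding Cm_def clin_Sum_any[OF clin_scale Cm_finite]
  by (rule Sum_any.cong) (subst Hm_hconst_mult, simp add: scale_scale mult.commute)

text \<open>The mode of g' that arises has index m + k while the weight was attached to m;
  reindexing produces the shifted weight.\<close>

lemma am_Cm:
  "am k (Cm w f g n v) = Cm w f g n (am k v) + Cm w (hD f) g (n + k) v + Cm (\<lambda>m. w (m - k)) f (hD g) (n + k) v"
proof -
  have 3: "Cm (\<lambda>m. w (m - k)) f (hD g) (n + k) v
      = Sum_any (\<lambda>m. sc (of_int (w m)) (Hm f (n - m) (Hm (hD g) (m + k) v)))"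
    unfolding Cm_def by (subst Sum_any_shift[of _ k, symmetric]) simp
  have fin: "finite {m. sc (of_int (w m)) (Hm f (n - m) (Hm (hD g) (m + k) v)) \<noteq> 0}"
  proof -
    obtain W where W: "wle W v" using wle_ex by blast
    show ?thesis
      by (rule finite_int_interval[of _ "n - W" "W - k"])
         (use Hm_Hm_nonzero[OF W] in \<open>metis scale_0_right diff_le_eq le_diff_eq add.commute\<close>)
  qed
  have fin12: "finite {m. sc (of_int (w m)) (Hm f (n - m) (Hm g m (am k v))) +
      sc (of_int (w m)) (Hm (hD f) (n + k - m) (Hm g m v)) \<noteq> 0}" (is "finite {m. ?A m + ?B m \<noteq> 0}")
    by (rule finite_subset[of _ "{m. ?A m \<noteq> 0} \<union> {m. ?B m \<noteq> 0}"]) (auto simp: Cm_finite)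
  show ?thesis
    unfolding 3 unfolding Cm_def clin_Sum_any[OF clin_am Cm_finite]
      Sum_any.distrib[OF Cm_finite Cm_finite, symmetric]
      Sum_any.distrib[OF fin12 fin, symmetric]
    by (rule Sum_any.cong) (simp add: am_Hm clin_sc[OF clin_am] clin_add[OF clin_Hm] scale_add_right algebra_simps)
qed

lemma homog_Cm: "homog W v \<Longrightarrow> homog (W - n) (Cm w f g n v)"
proof -
  assume "homog W v"
  then have "homog (W - m - (n - m)) (Hm f (n - m) (Hm g m v))" for m
    by (intro homog_Hm)
  then show ?thesis unfolding Cm_def by (intro homog_Sum_any homog_scale) simp
qed

lemma Cm_cvac:
  assumes "0 \<le> n"
  shows "Cm w f g n (cvac F) = (if n = 0 then sc (of_int (w 0)) (cvac (f * g * F)) else 0)"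
proof -
  have "sc (of_int (w m)) (Hm f (n - m) (Hm g m (cvac F))) =
      (if m = 0 then if n = 0 then sc (of_int (w 0)) (cvac (f * g * F)) else 0 else 0)" for m
  proof (cases "m = 0")
    case True
    then show ?thesis using assms Hm_cvac(1)[of n f] by (auto simp: Hm_cvac mult.assoc)
  next
    case False
    then have "n - m > 0 \<or> m > 0" using assms by linarith
    then show ?thesis using False Hm_Hm_nonzero[OF wle_cvac, of f "n - m" g m F] by force
  qed
  then show ?thesis unfolding Cm_def by simp
qed

text \<open>Instead of multiplying Taylor expansions over multisets, both sides are compared by
  \<open>operator_uniqueness\<close>: the commutator with a_k obeys the Leibniz rule on both sides,
  and among the modes n \<ge> 0 only n = 0 is nonzero on the vacuum.\<close>

lemma Hm_mult: "Hm (f * g) n v = Cm (\<lambda>m. 1) f g n v"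
proof -
  have "Cm (\<lambda>m. 1) f g n v - Hm (f * g) n v = 0"
  proof (rule operator_uniqueness[where X = "\<lambda>f g n v. Cm (\<lambda>m. 1) f g n v - Hm (f * g) n v"])
    show "homog (- n) (Cm (\<lambda>m. 1) f g n (cvac F) - Hm (f * g) n (cvac F))" for f g n F
      using homog_Cm[OF homog_cvac] homog_Hm[OF homog_cvac] by (intro homog_diff) fastforce+
  qed (auto intro!: clin_minus clin_Cm clin_Hm simp: Cm_bm Hm_bm clin_diff[OF clin_bm] clin_diff[OF clin_am]
      am_Cm am_Hm hD_mult Hm_add_left algebra_simps Cm_cvac Hm_cvac)
  then show ?thesis by simp
qed

text \<open>The modes of \<open>q(b) \<partial>b\<close>.\<close>

definition Dm :: "hol \<Rightarrow> int \<Rightarrow> cdv \<Rightarrow> cdv" where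
  "Dm q n v = Cm uminus q hvar n v"

lemma Cm_one_right: "Cm w f 1 n v = sc (of_int (w 0)) (Hm f n v)"
proof -
  have "sc (of_int (w m)) (Hm f (n - m) (Hm 1 m v)) = (if m = 0 then sc (of_int (w 0)) (Hm f n v) else 0)" for m
    by (simp add: Hm_1 clin_0[OF clin_Hm])
  then show ?thesis unfolding Cm_def by simp
qed

lemma Cm_one_left: "Cm w 1 f n v = sc (of_int (w n)) (Hm f n v)"
proof -
  have "sc (of_int (w m)) (Hm 1 (n - m) (Hm f m v)) = (if m = n then sc (of_int (w n)) (Hm f n v) else 0)" for m
    by (simp add: Hm_1 clin_0[OF clin_Hm])
  then show ?thesis unfolding Cm_def by simp
qed

lemma Cm_uminus_shift: "Cm (\<lambda>m. k - m) f g n v = Cm uminus f g n v + sc (of_int k) (Hm (f * g) n v)"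
  using Cm_add_weight[of uminus "\<lambda>m. k" f g n v] by (simp add: Cm_const_weight[of k] Hm_mult)

text \<open>The chain rule for the derivative along z. Commuting with a_k shifts the weight by k and
  so adds an unweighted product, the same on both sides.\<close>

lemma Cm_chain: "Cm uminus f g n v = Dm (f * hD g) n v"
proof -
  have "Cm uminus f g n v - Cm uminus (f * hD g) hvar n v = 0"
  proof (rule operator_uniqueness[where X = "\<lambda>f g n v. Cm uminus f g n v - Cm uminus (f * hD g) hvar n v"])
    show "homog (- n) (Cm uminus f g n (cvac F) - Cm uminus (f * hD g) hvar n (cvac F))" for f g n F
      using homog_Cm[OF homog_cvac] by (intro homog_diff) fastforce+
  qed (auto intro!: clin_minus clin_Cm simp: Cm_bm clin_diff[OF clin_bm] clin_diff[OF clin_am]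
      am_Cm hD_mult Cm_add_left algebra_simps Cm_cvac Cm_uminus_shift Cm_one_right)
  then show ?thesis by (simp add: Dm_def)
qed

text \<open>Differentiating g(b(z)) along z multiplies the coefficient of z^-n by -n. For n \<noteq>
  0 this recovers the modes of g(b) from those of g'(b) times the derivative of b.\<close>

lemma Dm_hD: "Dm (hD g) n v = sc (- of_int n) (Hm g n v)"
  using Cm_chain[of 1 g n v] by (simp add: Cm_one_left)

lemma clin_Dm: "clin (Dm q n)"
  unfolding Dm_def by (rule clin_Cm)

lemma Dm_Hm: "Dm q n (Hm f m v) = Hm f m (Dm q n v)"
  unfolding Dm_def by (rule Cm_Hm)

lemma Dm_add_left: "Dm (p + q) n v = Dm p n v + Dm q n v"
  unfolding Dm_def by (rule Cm_add_left)

lemma Dm_hconst_mult: "Dm (hconst c * q) n v = sc c (Dm q n v)"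
  unfolding Dm_def by (rule Cm_hconst_left)

lemma Dm_commute: "Dm q n (Dm r m v) = Dm r m (Dm q n v)"
  unfolding Dm_def[of r] Cm_def
  by (simp add: clin_Sum_any[OF clin_Dm Cm_finite] clin_sc[OF clin_Dm] Dm_Hm)

section \<open>Normally ordered products and their commutators\<close>

definition Amterm :: "hol \<Rightarrow> int \<Rightarrow> int \<Rightarrow> cdv \<Rightarrow> cdv" where
  "Amterm h n k v = (if k < 0 then am k (Hm h (n - k) v) else Hm h (n - k) (am k v))"

text \<open>The modes of the normally ordered product \<open>:a h(b):\<close>.\<close>

definition Am :: "hol \<Rightarrow> int \<Rightarrow> cdv \<Rightarrow> cdv" where
  "Am h n v = Sum_any (\<lambda>k. Amterm h n k v)"

lemma Amterm_nonzero: "wle W v \<Longrightarrow> Amterm h n k v \<noteq> 0 \<Longrightarrow> n - W \<le> k \<and> k \<le> W \<or> n - W \<le> k \<and> k < 0 \<or> 0 \<le> k \<and> k \<le> W"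
  using am_eq_0[of W v k] Hm_eq_0[of W v "n - k" h] clin_0[OF clin_am] clin_0[OF clin_Hm]
  by (force simp: Amterm_def split: if_splits)

lemma Amterm_finite: "finite {k. Amterm h n k v \<noteq> 0}"
proof -
  obtain W where W: "wle W v" using wle_ex by blast
  show ?thesis
    by (rule finite_int_interval[of _ "min 0 (n - W)" "max 0 W"]) (use Amterm_nonzero[OF W] in fastforce)
qed

lemma clin_Amterm: "clin (Amterm h n k)"
  unfolding Amterm_def by (cases "k < 0") (simp_all add: clin_comp clin_am clin_Hm)

lemma clin_Am: "clin (Am h n)"
  unfolding Am_def by (intro clin_Sum_anyI clin_Amterm Amterm_finite)

lemma Am_add_left: "Am (f + g) n v = Am f n v + Am g n v"
  unfolding Am_def Sum_any.distrib[OF Amterm_finite Amterm_finite, symmetric]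
  by (rule Sum_any.cong) (auto simp: Amterm_def Hm_add_left clin_add[OF clin_am])

lemma Am_hconst_mult: "Am (hconst c * f) n v = sc c (Am f n v)"
  unfolding Am_def clin_Sum_any[OF clin_scale Amterm_finite]
  by (rule Sum_any.cong) (auto simp: Amterm_def Hm_hconst_mult clin_sc[OF clin_am])

lemma Am_0_left [simp]: "Am 0 n v = 0"
  using Am_hconst_mult[of 0 0] by simp

lemma Am_uminus_left: "Am (- f) n v = - Am f n v"
  using Am_add_left[of f "- f" n v] by (simp add: eq_neg_iff_add_eq_0 add.commute)

lemma Am_diff_left: "Am (f - g) n v = Am f n v - Am g n v"
  using Am_add_left[of f "- g" n v] by (simp add: Am_uminus_left)

lemma Am_Hm: "Am h n (Hm f m v) = Hm f m (Am h n v) + Hm (h * hD f) (m + n) v"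
proof -
  have fin: "finite {k. Hm h (n - k) (Hm (hD f) (m + k) v) \<noteq> 0}"
  proof -
    obtain W where W: "wle W v" using wle_ex by blast
    show ?thesis
      by (rule finite_int_interval[of _ "n - W" "W - m"]) (use Hm_Hm_nonzero[OF W] in force)
  qed
  have fin': "finite {k. Hm f m (Amterm h n k v) \<noteq> 0}"
    by (rule finite_subset[OF _ Amterm_finite[of h n v]]) (auto simp: clin_0[OF clin_Hm])
  have "Hm (h * hD f) (m + n) v = Sum_any (\<lambda>k. Hm h (n - k) (Hm (hD f) (m + k) v))"
    unfolding Hm_mult Cm_def by (subst Sum_any_shift[of _ m, symmetric]) (simp add: algebra_simps)
  then show ?thesis
    unfolding Am_def clin_Sum_any[OF clin_Hm Amterm_finite]
    by (simp add: Sum_any.distrib[OF fin' fin, symmetric])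
       (rule Sum_any.cong, auto simp: Amterm_def am_Hm Hm_commute clin_add[OF clin_Hm] algebra_simps
         clin_add[OF clin_am])
qed

text \<open>As the a-modes commute among themselves, a_l passes through the normal ordering and only
  differentiates the coefficient function; no anomaly arises.\<close>

lemma am_Am: "am l (Am h n v) = Am h n (am l v) + Am (hD h) (n + l) v"
  unfolding Am_def clin_Sum_any[OF clin_am Amterm_finite] Sum_any.distrib[OF Amterm_finite Amterm_finite, symmetric]
proof (rule Sum_any.cong)
  fix k
  have 1: "am l (am k (Hm h (n - k) v)) = am k (Hm h (n - k) (am l v)) + am k (Hm (hD h) (n + l - k) v)"
    by (subst am_commute) (simp add: am_Hm clin_add[OF clin_am] algebra_simps)
  show "am l (Amterm h n k v) = Amterm h n k (am l v) + Amterm (hD h) (n + l) k v"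
    using 1 by (auto simp: Amterm_def am_Hm am_commute[of l k] algebra_simps)
qed

lemma Sum_any_swap_box:
  assumes "\<And>a b. g a b \<noteq> (0 :: cdv) \<Longrightarrow> a \<in> {-B..B :: int} \<and> b \<in> {-B..B :: int}"
  shows "Sum_any (\<lambda>a. Sum_any (g a)) = Sum_any (\<lambda>b. Sum_any (\<lambda>a. g a b))"
  by (rule Sum_any.swap[of "{-B..B} \<times> {-B..B}"]) (use assms in auto)

lemma Sum_any_finite_box:
  assumes "\<And>a b. g a b \<noteq> (0 :: cdv) \<Longrightarrow> a \<in> {-B..B :: int} \<and> b \<in> {-B..B :: int}"
  shows "finite {b. g a b \<noteq> 0}" "finite {a. Sum_any (g a) \<noteq> 0}"
proof -
  show "finite {b. g a b \<noteq> 0}"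
    by (rule finite_subset[of _ "{-B..B}"]) (use assms in auto)
  show "finite {a. Sum_any (g a) \<noteq> 0}"
  proof (rule finite_subset[of _ "{-B..B}"])
    show "{a. Sum_any (g a) \<noteq> 0} \<subseteq> {-B..B}"
    proof
      fix a assume "a \<in> {a. Sum_any (g a) \<noteq> 0}"
      then obtain b where "g a b \<noteq> 0" using Sum_any.not_neutral_obtains_not_neutral[of "g a"] by auto
      then show "a \<in> {-B..B}" using assms by blast
    qed
  qed simp
qed

text \<open>Each pair \<open>(l, s)\<close> for which the two normal orderings differ contributes one commutator
  \<open>\<plusminus> h\<^sub>M\<^sub>-\<^sub>t p'\<^sub>t\<close> with \<open>t = l + s\<close>, and there are \<open>t - n\<close> (signed) such pairs for each \<open>t\<close>.\<close>

lemma Am_nested: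
  "Sum_any (\<lambda>s. if n < s then Am h (M - s) (Hm p s v) else Hm p s (Am h (M - s) v)) =
   Am (h * p) M v - Dm (h * hD (hD p)) M v - sc (of_int n) (Hm (h * hD p) M v)"
proof -
  obtain W0 where W0: "wle W0 v" using wle_ex by blast
  define W where "W = \<bar>W0\<bar> + \<bar>M\<bar> + \<bar>n\<bar>"
  have W: "wle W v" by (rule wle_mono[OF W0]) (simp add: W_def)
  have Wpos: "\<bar>M\<bar> \<le> W" "0 \<le> W" "\<bar>n\<bar> \<le> W" by (auto simp: W_def)
  \<comment> \<open>A square of half-width \<open>B\<close> contains the supports of
    \<open>U\<close> and \<open>C\<close>, so the double sums are finite and may be exchanged; after
    the substitution t = s + l twice the width is taken.\<close>
  define B where "B = 4 * W"
  define Q where "Q t = Hm h (M - t) (Hm (hD p) t v)" for t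
  \<comment> \<open>\<open>U\<close> is the ordering that belongs to the product h p, with the
    a-mode outside both functions; \<open>C\<close> records the commutators spent in reaching
    it.\<close>
  define U where "U s l = (if l < 0 then am l (Hm h (M - l - s) (Hm p s v)) else Hm h (M - l - s) (Hm p s (am l v)))" for s l
  define C where "C s l = (if 0 \<le> l \<and> n < s then Q (s + l) else if l < 0 \<and> s \<le> n then - Q (s + l) else 0)" for s l
  have Q_nz: "M - W \<le> t \<and> t \<le> W" if "Q t \<noteq> 0" for t
    using Hm_Hm_nonzero[OF W] that unfolding Q_def by force
  have U_nz: "s \<in> {-B..B} \<and> l \<in> {-B..B}" if "U s l \<noteq> 0" for s l
  proof (cases "l < 0")
    case True
    then have "Hm h (M - l - s) (Hm p s v) \<noteq> 0"
      using that clin_0[OF clin_am] by (auto simp: U_def)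
    then have "M - l - s \<le> W" "s \<le> W" using Hm_Hm_nonzero[OF W] by blast+
    then show ?thesis using True Wpos by (auto simp: B_def)
  next
    case False
    then have nz: "Hm h (M - l - s) (Hm p s (am l v)) \<noteq> 0" using that by (simp add: U_def)
    then have "am l v \<noteq> 0" using clin_0[OF clin_Hm] by force
    then have "l \<le> W" using am_eq_0[OF W] by force
    moreover have "M - l - s \<le> W - l" "s \<le> W - l" using Hm_Hm_nonzero[OF wle_am[OF W, of l] nz] by auto
    ultimately show ?thesis using False Wpos by (auto simp: B_def)
  qed
  have C_nz: "s \<in> {-B..B} \<and> l \<in> {-B..B}" if "C s l \<noteq> 0" for s l
    using that Q_nz[of "s + l"] Wpos by (auto simp: C_def B_def split: if_splits)
  have C_nz': "t \<in> {-2*B..2*B} \<and> l \<in> {-2*B..2*B}" if "C (t - l) l \<noteq> 0" for t l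
    using C_nz[OF that] Wpos by (auto simp: B_def)
  have term_s: "(if n < s then Am h (M - s) (Hm p s v) else Hm p s (Am h (M - s) v)) = Sum_any (U s) + Sum_any (C s)" for s
  proof (cases "n < s")
    case True
    have "Am h (M - s) (Hm p s v) = Sum_any (\<lambda>l. U s l + C s l)"
      unfolding Am_def
      by (rule Sum_any.cong)
         (use True in \<open>auto simp: U_def C_def Q_def Amterm_def am_Hm clin_add[OF clin_Hm] algebra_simps\<close>)
    then show ?thesis using True
      by (simp add: Sum_any.distrib[OF Sum_any_finite_box(1)[OF U_nz] Sum_any_finite_box(1)[OF C_nz]])
  next
    case False
    have "Hm p s (am l (Hm h (M - s - l) v)) = am l (Hm h (M - l - s) (Hm p s v)) - Hm h (M - (s + l)) (Hm (hD p) (s + l) v)" for l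
      by (simp add: am_Hm Hm_commute[of h] algebra_simps)
    moreover have "Hm p s (Hm h (M - s - l) (am l v)) = Hm h (M - l - s) (Hm p s (am l v))" for l
      by (simp add: Hm_commute[of h] algebra_simps)
    ultimately have "Hm p s (Am h (M - s) v) = Sum_any (\<lambda>l. U s l + C s l)"
      unfolding Am_def clin_Sum_any[OF clin_Hm Amterm_finite]
      by (intro Sum_any.cong) (use False in \<open>auto simp: U_def C_def Q_def Amterm_def\<close>)
    then show ?thesis using False
      by (simp add: Sum_any.distrib[OF Sum_any_finite_box(1)[OF U_nz] Sum_any_finite_box(1)[OF C_nz]])
  qed
  have sumU: "Sum_any (\<lambda>s. Sum_any (U s)) = Am (h * p) M v"
  proof -
    have "Sum_any (\<lambda>s. U s l) = Amterm (h * p) M l v" for l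
    proof -
      have fin: "finite {s. Hm h (M - l - s) (Hm p s w) \<noteq> 0}" for w
        by (rule Hm_Hm_finite)
      have "Hm (h * p) (M - l) w = Sum_any (\<lambda>s. Hm h (M - l - s) (Hm p s w))" for w
        by (simp add: Hm_mult Cm_def)
      then show ?thesis
        by (auto simp: Amterm_def U_def clin_Sum_any[OF clin_am fin])
    qed
    with Sum_any_swap_box[OF U_nz] show ?thesis unfolding Am_def by simp
  qed
  have sumC: "Sum_any (\<lambda>s. Sum_any (C s)) = Cm (\<lambda>t. t - n) h (hD p) M v"
  proof -
    have "Sum_any (\<lambda>s. Sum_any (C s)) = Sum_any (\<lambda>l. Sum_any (\<lambda>s. C s l))"
      by (rule Sum_any_swap_box[OF C_nz])
    also have "\<dots> = Sum_any (\<lambda>l. Sum_any (\<lambda>t. C (t - l) l))"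
    proof (rule Sum_any.cong)
      fix l show "Sum_any (\<lambda>s. C s l) = Sum_any (\<lambda>t. C (t - l) l)"
        using Sum_any_shift[of "\<lambda>s. C s l" "- l"] by simp
    qed
    also have "\<dots> = Sum_any (\<lambda>t. Sum_any (\<lambda>l. C (t - l) l))"
      by (rule Sum_any_swap_box[of _ "2 * B"]) (use C_nz' in force)
    also have "\<dots> = Sum_any (\<lambda>t. sc (of_int (t - n)) (Q t))"
    proof (rule Sum_any.cong)
      fix t
      have sum_const: "(\<Sum>l\<in>I. w) = sc (of_nat (card I)) w" for I :: "int set" and w
        by (induction I rule: infinite_finite_induct) (auto simp: hconst_add scale_add_left)
      show "Sum_any (\<lambda>l. C (t - l) l) = sc (of_int (t - n)) (Q t)"
      proof (cases "n \<le> t")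
        case True
        have "Sum_any (\<lambda>l. C (t - l) l) = (\<Sum>l\<in>{0..<t - n}. C (t - l) l)"
          by (rule Sum_any.expand_superset) (use True in \<open>auto simp: C_def split: if_splits\<close>)
        also have "\<dots> = (\<Sum>l\<in>{0..<t - n}. Q t)" by (rule sum.cong) (auto simp: C_def)
        finally show ?thesis using True by (simp add: sum_const)
      next
        case False
        have "Sum_any (\<lambda>l. C (t - l) l) = (\<Sum>l\<in>{t - n..<0}. C (t - l) l)"
          by (rule Sum_any.expand_superset) (use False in \<open>auto simp: C_def split: if_splits\<close>)
        also have "\<dots> = (\<Sum>l\<in>{t - n..<0}. - Q t)" by (rule sum.cong) (auto simp: C_def)
        also have "\<dots> = - sc (of_int (n - t)) (Q t)" using False by (simp add: sum_negf sum_const)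
        finally show ?thesis by (simp flip: scale_minus_left hconst_uminus)
      qed
    qed
    finally show ?thesis by (simp add: Cm_def Q_def)
  qed
  have "Sum_any (\<lambda>s. if n < s then Am h (M - s) (Hm p s v) else Hm p s (Am h (M - s) v)) =
    Am (h * p) M v + Cm (\<lambda>t. t - n) h (hD p) M v"
    unfolding term_s
    using Sum_any.distrib[OF Sum_any_finite_box(2)[OF U_nz] Sum_any_finite_box(2)[OF C_nz]] sumU sumC by simp
  also have "Cm (\<lambda>t. t - n) h (hD p) M v = - Cm (\<lambda>t. n - t) h (hD p) M v"
    using Cm_add_weight[of "\<lambda>t. t - n" "\<lambda>t. n - t" h "hD p" M v] Cm_const_weight[of 0 h "hD p" M v]
    by (simp add: eq_neg_iff_add_eq_0)
  finally show ?thesis by (simp add: Cm_uminus_shift Cm_chain)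
qed

lemma Am_nested_left:
  "Sum_any (\<lambda>k. if k < 0 then Am h (m + k) (Hm p (n - k) v) else Hm p (n - k) (Am h (m + k) v)) =
   Am (h * p) (m + n) v - Dm (h * hD (hD p)) (m + n) v - sc (of_int n) (Hm (h * hD p) (m + n) v)"
  unfolding Am_nested[symmetric]
  by (subst Sum_any_reflect[of _ n, symmetric]) (rule Sum_any.cong, auto simp: algebra_simps)

lemma nested_finite:
  "finite {k. (if k < 0 then Am h (m + k) (Hm p (n - k) v) else Hm p (n - k) (Am h (m + k) v)) \<noteq> 0}"
proof -
  obtain W where W: "wle W v" using wle_ex by blast
  have "Am h j v = 0" if "W < j" for j
  proof -
    have "Amterm h j k v = 0" for k
    proof (cases "k < 0")
      case True
      then show ?thesis using that Hm_eq_0[OF W, of "j - k" h] by (simp add: Amterm_def clin_0[OF clin_am])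
    next
      case False
      then have "Hm h (j - k) (am k v) = 0"
        using that by (intro Hm_eq_0[OF wle_am[OF W]]) auto
      then show ?thesis using False by (simp add: Amterm_def)
    qed
    then show ?thesis by (simp add: Am_def)
  qed
  note Am0 = this
  show ?thesis
  proof (rule finite_int_interval[of _ "min 0 (n - W)" "max 0 (W - m)"])
    fix k assume nz: "(if k < 0 then Am h (m + k) (Hm p (n - k) v) else Hm p (n - k) (Am h (m + k) v)) \<noteq> 0"
    show "min 0 (n - W) \<le> k \<and> k \<le> max 0 (W - m)"
    proof (cases "k < 0")
      case True
      then have "Hm p (n - k) v \<noteq> 0" using nz clin_0[OF clin_Am] by auto
      then have "n - k \<le> W" using Hm_eq_0[OF W] by force
      then show ?thesis using True by auto
    next
      case False
      then have "Am h (m + k) v \<noteq> 0" using nz clin_0[OF clin_Hm] by auto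
      then have "m + k \<le> W" using Am0 by force
      then show ?thesis using False by auto
    qed
  qed
qed

text \<open>Moving \<open>Am h m\<close> past the functions in \<open>Am p n\<close> gives h p'
  directly, while moving it past a_k leaves a mode of A[h'] nested inside the ordering for p.
  Reordering this nested sum by \<open>Am_nested_left\<close> is the source of the anomaly.\<close>

lemma Am_Am:
  "Am h m (Am p n v) = Am p n (Am h m v) + Am (h * hD p - hD h * p) (m + n) v
     + Dm (hD h * hD (hD p)) (m + n) v + sc (of_int n) (Hm (hD h * hD p) (m + n) v)"
proof -
  let ?N = "\<lambda>k. if k < 0 then Am (hD h) (m + k) (Hm p (n - k) v) else Hm p (n - k) (Am (hD h) (m + k) v)"
  have am': "Am h m (am k w) = am k (Am h m w) - Am (hD h) (m + k) w" for k w
    by (simp add: am_Am)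
  have "Am h m (Amterm p n k v) = Amterm p n k (Am h m v) + Amterm (h * hD p) (m + n) k v - ?N k" for k
    by (auto simp: Amterm_def am' Am_Hm clin_add[OF clin_am] clin_diff[OF clin_Hm] algebra_simps)
  then have "Am h m (Am p n v) = Sum_any (\<lambda>k. Amterm p n k (Am h m v) + Amterm (h * hD p) (m + n) k v - ?N k)"
    unfolding Am_def[of p] clin_Sum_any[OF clin_Am Amterm_finite] by simp
  also have "\<dots> = Am p n (Am h m v) + Am (h * hD p) (m + n) v - Sum_any ?N"
  proof -
    have "finite {k. Amterm p n k (Am h m v) + Amterm (h * hD p) (m + n) k v \<noteq> 0}"
      by (rule finite_subset[OF _ finite_UnI[OF Amterm_finite[of p n "Am h m v"] Amterm_finite[of "h * hD p" "m + n" v]]]) auto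
    from Sum_any_diff[OF this nested_finite] show ?thesis
      by (simp add: Sum_any.distrib[OF Amterm_finite Amterm_finite] Am_def)
  qed
  finally show ?thesis by (simp add: Am_nested_left Am_diff_left algebra_simps)
qed

text \<open>\<open>Am h m\<close> acts on q(b) through h q' and on b_t by producing the mode m + t
  of h(b). Reindexing turns the weight -t into m - t, which accounts for the term with factor
  m.\<close>

lemma Am_Dm:
  "Am h m (Dm q n v) = Dm q n (Am h m v) + Dm (hD (h * q)) (m + n) v + sc (of_int m) (Hm (h * q) (m + n) v)"
proof -
  let ?T = "\<lambda>t. sc (of_int (- t)) (Hm q (n - t) (Hm h (m + t) v))"
  have "Am h m (sc (of_int (- t)) (Hm q (n - t) (Hm hvar t v))) =
     sc (of_int (- t)) (Hm q (n - t) (Hm hvar t (Am h m v)))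
     + sc (of_int (- t)) (Hm (h * hD q) (m + n - t) (Hm hvar t v)) + ?T t" for t
    by (simp add: clin_sc[OF clin_Am] Am_Hm clin_add[OF clin_Hm] scale_add_right algebra_simps)
  then have "Am h m (Dm q n v) = Sum_any (\<lambda>t. sc (of_int (- t)) (Hm q (n - t) (Hm hvar t (Am h m v)))
     + sc (of_int (- t)) (Hm (h * hD q) (m + n - t) (Hm hvar t v)) + ?T t)"
    unfolding Dm_def Cm_def clin_Sum_any[OF clin_Am Cm_finite] by simp
  also have "\<dots> = Dm q n (Am h m v) + Dm (h * hD q) (m + n) v + Sum_any ?T"
  proof -
    have f1: "finite {t. sc (of_int (- t)) (Hm q (n - t) (Hm hvar t (Am h m v)))
       + sc (of_int (- t)) (Hm (h * hD q) (m + n - t) (Hm hvar t v)) \<noteq> 0}" (is "finite {t. ?A t + ?B t \<noteq> 0}")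
      by (rule finite_subset[of _ "{t. ?A t \<noteq> 0} \<union> {t. ?B t \<noteq> 0}"]) (auto intro!: Cm_finite)
    obtain W where W: "wle W v" using wle_ex by blast
    have f2: "finite {t. ?T t \<noteq> 0}"
    proof (rule finite_int_interval[of _ "n - W" "W - m"])
      fix t assume "?T t \<noteq> 0"
      then have "Hm q (n - t) (Hm h (m + t) v) \<noteq> 0" by auto
      from Hm_Hm_nonzero[OF W this] show "n - W \<le> t \<and> t \<le> W - m" by auto
    qed
    show ?thesis unfolding Sum_any.distrib[OF f1 f2] Sum_any.distrib[OF Cm_finite Cm_finite] Dm_def Cm_def ..
  qed
  also have "Sum_any ?T = Cm (\<lambda>t. m - t) q h (m + n) v"
    unfolding Cm_def by (subst Sum_any_shift[of _ m, symmetric]) (simp add: algebra_simps)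
  finally show ?thesis
    by (simp add: Cm_uminus_shift Cm_chain hD_mult Dm_add_left algebra_simps)
qed

definition Ah :: "hol \<Rightarrow> hol \<Rightarrow> int \<Rightarrow> cdv \<Rightarrow> cdv" where
  "Ah h s n v = Am h n v + Dm s n v"

lemma clin_Ah: "clin (Ah h s n)"
  unfolding Ah_def by (intro clin_plus clin_Am clin_Dm)

lemma Ah_Hm: "Ah h s n (Hm f m v) = Hm f m (Ah h s n v) + Hm (h * hD f) (m + n) v"
  by (simp add: Ah_def Am_Hm Dm_Hm clin_add[OF clin_Hm] algebra_simps)

text \<open>Let Z be the mode m + n of (h s)(b) applied to v. From h'^2 = 2 h s follows h' h'' = (h
  s)', so all anomalies are multiples of Z: the three commutators contribute n - m, -n and m, which
  add up to zero.\<close>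

lemma Ah_commute:
  assumes "2 * h * s = hD h * hD h"
  shows "Ah h s m (Ah h s n v) = Ah h s n (Ah h s m v)"
proof -
  let ?N = "m + n"
  define Z where "Z = Hm (h * s) ?N v"
  have e2: "hD h * hD h = h * s + h * s" using assms by (simp add: algebra_simps)
  have "hD (hD h * hD h) = hD (h * s) + hD (h * s)" unfolding e2 hD_add ..
  then have "2 * (hD h * hD (hD h)) = 2 * hD (h * s)" by (simp add: hD_mult algebra_simps)
  \<comment> \<open>Written with \<open>Suc\<close> so that the factor two can be cancelled in
    \<open>hol\<close>.\<close>
  then have "of_nat (Suc 1) * (hD h * hD (hD h) - hD (h * s)) = 0" by (simp add: algebra_simps)
  from of_nat_Suc_hol_cancel[OF this] have e3: "hD h * hD (hD h) = hD (h * s)" by simp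
  have D: "Dm (hD (h * s)) ?N v = sc (of_int (- m - n)) Z"
    by (simp add: Dm_hD Z_def)
  have H: "Hm (hD h * hD h) ?N v = Z + Z"
    unfolding e2 Hm_add_left Z_def ..
  have "Ah h s m (Ah h s n v) - Ah h s n (Ah h s m v) =
     (Am h m (Am h n v) - Am h n (Am h m v)) + (Am h m (Dm s n v) - Dm s n (Am h m v)) - (Am h n (Dm s m v) - Dm s m (Am h n v))"
    by (simp add: Ah_def clin_add[OF clin_Am] clin_add[OF clin_Dm] Dm_commute[of s n])
  also have "Am h m (Am h n v) - Am h n (Am h m v) = sc (of_int (- m - n)) Z + sc (of_int n) (Z + Z)"
    using Am_Am[of h m h n v] by (simp add: e3 D H mult.commute)
  also have "Am h m (Dm s n v) - Dm s n (Am h m v) = sc (of_int (- m - n)) Z + sc (of_int m) Z"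
    by (simp add: Am_Dm D Z_def)
  also have "Am h n (Dm s m v) - Dm s m (Am h n v) = sc (of_int (- m - n)) Z + sc (of_int n) Z"
    using D by (simp add: Am_Dm Z_def add.commute[of n m])
  also have "sc (of_int (- m - n)) Z + sc (of_int n) (Z + Z) + (sc (of_int (- m - n)) Z + sc (of_int m) Z)
     - (sc (of_int (- m - n)) Z + sc (of_int n) Z) = scale (hconst (of_int (- m - n)) + hconst (of_int m) + hconst (of_int n)) Z"
    by (simp add: scale_add_left scale_add_right algebra_simps)
  also have "hconst (of_int (- m - n)) + hconst (of_int m) + hconst (of_int n) = 0"
    unfolding hconst_add[symmetric] by simp
  finally show ?thesis by simp
qed

subsection \<open>The action of the modular group\<close>

lemma jfac_nonzero: "g \<in> SL2Z \<Longrightarrow> 0 < Im z \<Longrightarrow> jfac g z \<noteq> 0"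
proof -
  obtain a b c d where g: "g = (a, b, c, d)" by (cases g)
  assume "g \<in> SL2Z" and z: "0 < Im z"
  then have det: "a * d - b * c = 1" by (simp add: SL2Z_def g)
  show ?thesis
  proof
    assume "jfac g z = 0"
    then have "of_int c * Im z = 0" "of_int c * Re z + of_int d = 0"
      by (auto simp: jfac_def g complex_eq_iff)
    then have "c = 0" "d = 0" using z by auto
    with det show False by simp
  qed
qed

lemma Im_mob: "g \<in> SL2Z \<Longrightarrow> 0 < Im z \<Longrightarrow> Im (mob g z) = Im z / (cmod (jfac g z))\<^sup>2"
proof -
  obtain a b c d where g: "g = (a, b, c, d)" by (cases g)
  assume *: "g \<in> SL2Z" and z: "0 < Im z"
  then have "of_int (a * d - b * c) = (1::real)" by (simp add: SL2Z_def g)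
  then have det: "real_of_int a * real_of_int d - real_of_int b * real_of_int c = 1" by simp
  have "Im (mob g z) = ((of_int a * Im z) * (of_int c * Re z + of_int d) - (of_int a * Re z + of_int b) * (of_int c * Im z))
      / (cmod (jfac g z))\<^sup>2"
    by (simp add: mob_def jfac_def g Im_divide cmod_power2)
  also have "(of_int a * Im z) * (of_int c * Re z + of_int d) - (of_int a * Re z + of_int b) * (of_int c * Im z)
      = Im z * (of_int a * of_int d - of_int b * of_int c)" by (simp add: algebra_simps)
  finally show ?thesis using det by simp
qed

lemma mob_UHP: "g \<in> SL2Z \<Longrightarrow> 0 < Im z \<Longrightarrow> 0 < Im (mob g z)"
  by (simp add: Im_mob jfac_nonzero)

lemma jfac_derivative: "(jfac g has_field_derivative of_int (lowleft g)) (at z)"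
proof -
  obtain a b c d where g: "g = (a, b, c, d)" by (cases g)
  show ?thesis unfolding jfac_def g lowleft_def by (auto intro!: derivative_eq_intros)
qed

lemma mob_derivative:
  assumes "g \<in> SL2Z" "0 < Im z"
  shows "(mob g has_field_derivative (1 / jfac g z)\<^sup>2) (at z)"
proof -
  obtain a b c d where g: "g = (a, b, c, d)" by (cases g)
  have "of_int (a * d - b * c) = (1::complex)" using assms by (simp add: SL2Z_def g)
  then have det: "of_int a * of_int d - of_int b * of_int c = (1::complex)" by simp
  have nz: "of_int c * z + of_int d \<noteq> 0" using jfac_nonzero[OF assms] by (simp add: jfac_def g)
  have "(mob g has_field_derivative (of_int a * (of_int c * z + of_int d) - (of_int a * z + of_int b) * of_int c)
      / ((of_int c * z + of_int d) * (of_int c * z + of_int d))) (at z)"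
    unfolding mob_def g using nz by (auto intro!: derivative_eq_intros)
  also have "of_int a * (of_int c * z + of_int d) - (of_int a * z + of_int b) * of_int c = (1::complex)"
    using det by (simp add: algebra_simps)
  finally show ?thesis by (simp add: jfac_def g power2_eq_square)
qed

lemma holomorphic_UHPI: "(\<And>z. 0 < Im z \<Longrightarrow> (f has_field_derivative f' z) (at z)) \<Longrightarrow> f holomorphic_on UHP"
  by (auto simp: holomorphic_on_def UHP_def field_differentiable_def intro: has_field_derivative_at_within)

definition hj :: "mat \<Rightarrow> hol" where "hj g = hmask (jfac g)"
definition hji :: "mat \<Rightarrow> hol" where "hji g = hmask (\<lambda>z. 1 / jfac g z)"
definition hcomp :: "mat \<Rightarrow> hol \<Rightarrow> hol" where "hcomp g f = hmask (\<lambda>z. hfun f (mob g z))"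
definition hc :: "mat \<Rightarrow> hol" where "hc g = hconst (of_int (lowleft g))"

lemma hfun_hj: "0 < Im z \<Longrightarrow> hfun (hj g) z = jfac g z"
  unfolding hj_def by (subst hfun_hmask) (auto intro!: holomorphic_UHPI jfac_derivative simp: mask_def)

lemma hD_hj: "hD (hj g) = hc g"
  by (rule hD_eqI, rule has_field_derivative_UHP_cong[of "jfac g"])
     (auto simp: hc_def hfun_hconst hfun_hj jfac_derivative)

lemma clin_foldr: "(\<And>n. clin (T n)) \<Longrightarrow> clin (foldr T xs)"
proof (induction xs)
  case Nil
  then show ?case by (simp add: clin_def)
next
  case (Cons x xs)
  then show ?case by (simp add: clin_def)
qed

lemma clin_eq_on_mono:
  assumes "clin S" "clin T" "\<And>l m F. is_partition l \<Longrightarrow> is_partition m \<Longrightarrow> S (fmono (l, m) F) = T (fmono (l, m) F)"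
  shows "S v = T v"
proof -
  have "S (fmono k (cf v k)) = T (fmono k (cf v k))" for k
    using assms(3)[of "fst k" "snd k"] cf_partition[of v k] clin_0[OF assms(1)] clin_0[OF assms(2)]
    by (cases "cf v k = 0") auto
  then show ?thesis
    by (subst (1 2) cdv_eq_sum_mono[OF finite_supp subset_refl, of v])
       (simp add: clin_sum[OF assms(1)] clin_sum[OF assms(2)])
qed

context
  fixes g :: mat assumes g: "g \<in> SL2Z"
begin

lemma hfun_hji: "0 < Im z \<Longrightarrow> hfun (hji g) z = 1 / jfac g z"
  unfolding hji_def using jfac_nonzero[OF g]
  by (subst hfun_hmask) (auto intro!: holomorphic_UHPI derivative_eq_intros jfac_derivative simp: mask_def)

lemma hcomp_derivative:
  "0 < Im z \<Longrightarrow> ((\<lambda>z. hfun f (mob g z)) has_field_derivative hfun (hD f) (mob g z) * (1 / jfac g z)\<^sup>2) (at z)"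
  by (rule DERIV_chain2[OF hfun_has_derivative[OF mob_UHP[OF g]] mob_derivative[OF g]])

lemma hfun_hcomp: "0 < Im z \<Longrightarrow> hfun (hcomp g f) z = hfun f (mob g z)"
  unfolding hcomp_def
  by (subst hfun_hmask) (auto intro!: holomorphic_UHPI hcomp_derivative simp: mask_def)

lemma hj_hji: "hj g * hji g = 1"
  by (rule hol_eqI) (simp add: hfun_hj hfun_hji hfun_one jfac_nonzero[OF g])

lemma hD_hcomp: "hD (hcomp g f) = hcomp g (hD f) * hji g * hji g"
  by (rule hD_eqI, rule has_field_derivative_UHP_cong[of "\<lambda>z. hfun f (mob g z)"])
     (auto simp: hfun_hcomp hfun_hji hfun_hcomp power2_eq_square mult.assoc intro!: DERIV_cong[OF hcomp_derivative])

lemma hD_hji: "hD (hji g) = - hc g * hji g * hji g"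
  by (rule hD_eqI, rule has_field_derivative_UHP_cong[of "\<lambda>z. 1 / jfac g z"])
     (auto simp: hfun_hji hc_def hfun_hconst jfac_nonzero[OF g] intro!: derivative_eq_intros jfac_derivative)

lemma hcomp_simps:
  "hcomp g (u + v) = hcomp g u + hcomp g v" "hcomp g (u * v) = hcomp g u * hcomp g v"
  "hcomp g (hconst c) = hconst c" "hcomp g 1 = 1" "hcomp g 0 = 0"
  by (rule hol_eqI; simp add: hfun_hcomp hfun_hconst hfun_one mob_UHP[OF g])+

lemma hcomp_power: "hcomp g (u ^ n) = hcomp g u ^ n"
  by (induction n) (simp_all add: hcomp_simps)

definition hh :: hol where "hh = hj g * hj g"
text \<open>The coefficient 2c^2 of b_{-1} in \<pi>(g) a_{-1}, with c the lower left entry. As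
  \<open>hh\<close> has derivative 2c(c\<tau> + d), it is also h'^2 / 2h for h = \<open>hh\<close>,
  the correction under which the modes commute.\<close>

definition hs :: hol where "hs = 2 * hc g * hc g"
definition hmb :: hol where "hmb = hcomp g hvar"

lemma hD_hh: "hD hh = 2 * hc g * hj g"
  by (simp add: hh_def hD_mult hD_hj algebra_simps)

lemma hh_hs: "2 * hh * hs = hD hh * hD hh"
  unfolding hD_hh hs_def by (simp add: hh_def algebra_simps)

lemma hh_hji: "hh * (u * hji g * hji g) = u"
proof -
  have "hh * (u * hji g * hji g) = u * (hj g * hji g) * (hj g * hji g)" by (simp add: hh_def algebra_simps)
  then show ?thesis by (simp add: hj_hji)
qed

lemma hh_hD_hcomp: "hh * hD (hcomp g f) = hcomp g (hD f)"
  by (simp add: hD_hcomp hh_hji)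

lemma hh_hD_hmb: "hh * hD hmb = 1"
  by (simp add: hmb_def hh_hD_hcomp hcomp_simps)

abbreviation Ag :: "int \<Rightarrow> cdv \<Rightarrow> cdv" where "Ag n \<equiv> Ah hh hs n"

lemma Ag_commute: "Ag m (Ag n v) = Ag n (Ag m v)"
  by (rule Ah_commute[OF hh_hs])

lemma Ag_Hm: "Ag n (Hm (hcomp g f) m v) = Hm (hcomp g f) m (Ag n v) + Hm (hcomp g (hD f)) (m + n) v"
  by (simp add: Ah_Hm hh_hD_hcomp)

text \<open>\<open>hh\<close> is the reciprocal of the derivative of the Moebius map, so the images
  of the generators satisfy the Heisenberg relation again.\<close>

lemma Ag_hmb: "Ag n (Hm hmb m v) = Hm hmb m (Ag n v) + (if m + n = 0 then v else 0)"
  by (simp add: Ah_Hm hh_hD_hmb Hm_1)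

definition pm :: "key \<Rightarrow> hol \<Rightarrow> cdv" where
  "pm k f = foldr (\<lambda>n. Ag (- int n)) (sorted_list_of_multiset (fst k))
     (foldr (\<lambda>n. Hm hmb (- int n)) (sorted_list_of_multiset (snd k)) (cvac (hcomp g f)))"

definition pi_op :: "cdv \<Rightarrow> cdv" where
  "pi_op v = (\<Sum>k\<in>supp v. pm k (cf v k))"

lemma pm_add: "pm k (f + f') = pm k f + pm k f'"
  and pm_hconst: "pm k (hconst c * f) = sc c (pm k f)"
proof -
  have 1: "cvac (u + v) = cvac u + cvac v" "cvac (hconst c * u) = sc c (cvac u)" for u v
    by (rule cdv_eqI; simp add: cf_mono)+
  note lin = clin_foldr[OF clin_Ah] clin_foldr[OF clin_Hm]
  show "pm k (f + f') = pm k f + pm k f'"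
    unfolding pm_def hcomp_simps 1 clin_add[OF clin_foldr[OF clin_Hm]] clin_add[OF clin_foldr[OF clin_Ah]] ..
  show "pm k (hconst c * f) = sc c (pm k f)"
    unfolding pm_def hcomp_simps 1 clin_sc[OF clin_foldr[OF clin_Hm]] clin_sc[OF clin_foldr[OF clin_Ah]] ..
qed

lemma pm_0: "pm k 0 = 0"
  using pm_hconst[of k 0 0] by simp

lemma Pi_superset: "finite S \<Longrightarrow> supp v \<subseteq> S \<Longrightarrow> pi_op v = (\<Sum>k\<in>S. pm k (cf v k))"
  unfolding pi_op_def by (rule sum.mono_neutral_left) (auto simp: supp_def pm_0)

lemma clin_Pi: "clin pi_op"
  unfolding clin_def
proof (intro conjI allI)
  fix v w c
  let ?S = "supp v \<union> supp w"
  have "pi_op (v + w) = (\<Sum>k\<in>?S. pm k (cf (v + w) k))"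
    by (rule Pi_superset) (auto simp: finite_supp dest: subsetD[OF supp_add])
  also have "\<dots> = (\<Sum>k\<in>?S. pm k (cf v k)) + (\<Sum>k\<in>?S. pm k (cf w k))"
    by (simp add: pm_add sum.distrib)
  also have "\<dots> = pi_op v + pi_op w"
    by (simp add: Pi_superset[of ?S] finite_supp)
  finally show "pi_op (v + w) = pi_op v + pi_op w" .
  have "pi_op (sc c v) = (\<Sum>k\<in>supp v. pm k (cf (sc c v) k))"
    by (rule Pi_superset[OF finite_supp supp_scale])
  then show "pi_op (sc c v) = sc c (pi_op v)"
    by (simp add: pm_hconst pi_op_def clin_sum[OF clin_scale])
qed

lemma Pi_mono: "is_partition (fst k) \<Longrightarrow> is_partition (snd k) \<Longrightarrow> pi_op (fmono k f) = pm k f"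
  by (subst Pi_superset[of "{k}"]) (auto simp: supp_def cf_mono split: if_splits)

lemma Pi_cvac: "pi_op (cvac F) = cvac (hcomp g F)"
  by (subst Pi_mono) (simp_all add: pm_def)

text \<open>\<open>pm\<close> applies the images in sorted order; inserting one more mode at its
  place instead of in front is harmless because the images commute.\<close>

lemma Pi_am_neg: "0 < n \<Longrightarrow> pi_op (am (- n) v) = Ag (- n) (pi_op v)"
proof (rule clin_eq_on_mono[of "\<lambda>v. pi_op (am (- n) v)"])
  fix l m F assume n: "0 < n" and p: "is_partition l" "is_partition m"
  obtain j where j: "n = int j" using n by (metis less_le nonneg_int_cases)
  have "pm (add_mset j l, m) F = Ag (- int j) (pm (l, m) F)"
    unfolding pm_def fst_conv snd_conv sorted_list_of_multiset_insert
    by (rule foldr_insort_commute[where F = "\<lambda>n. Ag (- int n)"]) (rule Ag_commute)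
  then show "pi_op (am (- n) (fmono (l, m) F)) = Ag (- n) (pi_op (fmono (l, m) F))"
    using p n by (simp add: j mono_add_mset_left[symmetric] Pi_mono)
qed (intro clin_comp[OF clin_Pi clin_am] clin_comp[OF clin_Ah clin_Pi])+

text \<open>The image of the b-mode passes all images of creation a-modes, since the central term
  requires opposite indices and all indices here are negative.\<close>

lemma Pi_bm_neg: "0 < n \<Longrightarrow> pi_op (bm (- n) v) = Hm hmb (- n) (pi_op v)"
proof (rule clin_eq_on_mono[of "\<lambda>v. pi_op (bm (- n) v)"])
  fix l m F assume n: "0 < n" and p: "is_partition l" "is_partition m"
  have *: "is_partition (mset xs) \<Longrightarrow> foldr (\<lambda>n. Ag (- int n)) xs (Hm hmb (- n) w) = Hm hmb (- n) (foldr (\<lambda>n. Ag (- int n)) xs w)" for xs w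
    using n by (induction xs) (auto simp: Ag_hmb)
  have "pm (l, add_mset (nat n) m) F = Hm hmb (- n) (pm (l, m) F)"
    using n p *[of "sorted_list_of_multiset l"] unfolding pm_def
    by (simp add: sorted_list_of_multiset_insert foldr_insort_commute[of "\<lambda>n. Hm hmb (- int n)", OF Hm_commute])
  moreover have "fmono (l, add_mset (nat n) m) F = bm (- n) (fmono (l, m) F)"
    using mono_add_mset_right[of "nat n"] n by simp
  ultimately show "pi_op (bm (- n) (fmono (l, m) F)) = Hm hmb (- n) (pi_op (fmono (l, m) F))"
    using n p Pi_mono[of "(l, m)" F] Pi_mono[of "(l, add_mset (nat n) m)" F] by simp
qed (intro clin_comp[OF clin_Pi clin_bm] clin_comp[OF clin_Hm clin_Pi])+

text \<open>By \<open>Dm_hD\<close>, the mode n of f(b) times -n is a convolution of modes of f'(b)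
  with b-modes. On a vacuum vector only b-modes t < 0 and modes n - t of f' with n < n - t \<le> 0
  survive, so induction on -n applies, and for n < 0 the factor -n can be divided out.\<close>

lemma Pi_Hm_cvac: "pi_op (Hm f n (cvac F)) = Hm (hcomp g f) n (cvac (hcomp g F))"
proof (induction "nat (- n)" arbitrary: f n rule: less_induct)
  case less
  consider "n > 0" | "n = 0" | "n < 0" by linarith
  then show ?case
  proof cases
    case 1
    then show ?thesis by (simp add: Hm_cvac clin_0[OF clin_Pi])
  next
    case 2
    then show ?thesis by (simp add: Hm_cvac Pi_cvac hcomp_simps)
  next
    case 3
    have t: "pi_op (sc (of_int (- t)) (Hm (hD f) (n - t) (Hm hvar t (cvac F)))) =
        sc (of_int (- t)) (Hm (hcomp g (hD f)) (n - t) (Hm hmb t (cvac (hcomp g F))))" for t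
    proof (cases "t < 0 \<and> n - t \<le> 0")
      case True
      have "Hm (hD f) (n - t) (Hm hvar t (cvac F)) = bm (- (- t)) (Hm (hD f) (n - t) (cvac F))"
        by (simp add: Hm_hvar Hm_bm)
      then have "pi_op (Hm (hD f) (n - t) (Hm hvar t (cvac F))) = Hm hmb t (pi_op (Hm (hD f) (n - t) (cvac F)))"
        using True Pi_bm_neg[of "- t" "Hm (hD f) (n - t) (cvac F)"] by simp
      also have "pi_op (Hm (hD f) (n - t) (cvac F)) = Hm (hcomp g (hD f)) (n - t) (cvac (hcomp g F))"
        using True 3 by (intro less) auto
      finally have "pi_op (Hm (hD f) (n - t) (Hm hvar t (cvac F))) = Hm hmb t (Hm (hcomp g (hD f)) (n - t) (cvac (hcomp g F)))" .
      then show ?thesis by (simp add: clin_sc[OF clin_Pi] Hm_commute)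
    next
      case False
      then consider "t = 0" | "t > 0" | "n - t > 0" by linarith
      then show ?thesis
      proof cases
        case 3
        then show ?thesis
          by (subst (1 2) Hm_commute) (simp add: Hm_cvac clin_0[OF clin_Hm] clin_0[OF clin_Pi])
      qed (simp_all add: Hm_cvac clin_0[OF clin_Hm] clin_0[OF clin_Pi])
    qed
    have "sc (- of_int n) (pi_op (Hm f n (cvac F))) = pi_op (Dm (hD f) n (cvac F))"
      by (simp add: Dm_hD clin_sc[OF clin_Pi])
    also have "\<dots> = Cm uminus (hcomp g (hD f)) hmb n (cvac (hcomp g F))"
      unfolding Dm_def Cm_def clin_Sum_any[OF clin_Pi Cm_finite] t ..
    also have "\<dots> = Dm (hD (hcomp g f)) n (cvac (hcomp g F))"
      by (simp add: Cm_chain hD_hcomp hmb_def hcomp_simps mult.assoc)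
    also have "\<dots> = sc (- of_int n) (Hm (hcomp g f) n (cvac (hcomp g F)))"
      by (rule Dm_hD)
    finally have "sc (1 / - of_int n) (sc (- of_int n) (pi_op (Hm f n (cvac F)))) =
        sc (1 / - of_int n) (sc (- of_int n) (Hm (hcomp g f) n (cvac (hcomp g F))))" by simp
    then show ?thesis using 3 unfolding scale_scale hconst_mult[symmetric] by simp
  qed
qed

lemma Pi_Hm: "pi_op (Hm f n v) = Hm (hcomp g f) n (pi_op v)"
proof (induction v arbitrary: f n rule: cdv_induct)
  case (vac F)
  then show ?case by (simp add: Pi_Hm_cvac Pi_cvac)
next
  case (a m v)
  have "pi_op (Hm f n (am (- m) v)) = pi_op (am (- m) (Hm f n v) - Hm (hD f) (n - m) v)"
    by (simp add: am_Hm)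
  also have "\<dots> = Hm (hcomp g f) n (pi_op (am (- m) v))"
    using a by (simp add: clin_diff[OF clin_Pi] Pi_am_neg Ag_Hm)
  finally show ?case .
next
  case (b m v)
  have "pi_op (Hm f n (bm (- m) v)) = pi_op (bm (- m) (Hm f n v))" by (simp add: Hm_bm)
  also have "\<dots> = Hm (hcomp g f) n (pi_op (bm (- m) v))"
    using b by (simp add: Pi_bm_neg Hm_commute)
  finally show ?case .
qed (simp add: clin_add[OF clin_Hm] clin_add[OF clin_Pi])

text \<open>Only images of creation modes enter the definition of the action. For n \<ge> 0 both
  sides agree on vacuum vectors and have equal commutators with the creation modes.\<close>

lemma Pi_am: "pi_op (am n v) = Ag n (pi_op v)"
proof (cases "n < 0")
  case True
  then show ?thesis using Pi_am_neg[of "- n" v] by simp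
next
  case n: False
  show ?thesis
  proof (induction v rule: cdv_induct)
    case (vac F)
    \<comment> \<open>On a vacuum vector only k = 0 survives, and only for n = 0.\<close>
    have "Amterm hh n k (cvac u) = (if k = 0 then if n = 0 then cvac (hh * hD u) else 0 else 0)" for k u
    proof -
      consider "k < 0" | "k = 0" | "k > 0" by linarith
      then show ?thesis
        by cases (use n in \<open>auto simp: Amterm_def am_cvac Hm_cvac clin_0[OF clin_am] clin_0[OF clin_Hm]\<close>)
    qed
    then have "Am hh n (cvac u) = (if n = 0 then cvac (hh * hD u) else 0)" for u
      by (simp add: Am_def)
    moreover have "Dm hs n (cvac u) = 0" for u
      using n by (simp add: Dm_def Cm_cvac)
    ultimately have "Ag n (pi_op (cvac F)) = (if n = 0 then cvac (hcomp g (hD F)) else 0)"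
      by (simp add: Ah_def Pi_cvac hh_hD_hcomp)
    then show ?case using n by (auto simp: am_cvac Pi_cvac clin_0[OF clin_Pi])
  next
    case (a m v)
    then show ?case by (subst am_commute) (simp add: Pi_am_neg Ag_commute)
  next
    case (b m v)
    then show ?case
      by (auto simp: am_bm Pi_bm_neg Ag_hmb clin_add[OF clin_Pi] clin_0[OF clin_Pi])
  qed (simp add: clin_add[OF clin_am] clin_add[OF clin_Pi] clin_add[OF clin_Ah])
qed

text \<open>q(b) times the derivative of b behaves like a one-form, hence the factor (c\<tau> +
  d)^-2.\<close>

lemma Pi_Dm: "pi_op (Dm q n v) = Dm (hcomp g q * hji g * hji g) n (pi_op v)"
proof -
  have "pi_op (Dm q n v) = Cm uminus (hcomp g q) hmb n (pi_op v)"
    unfolding Dm_def Cm_def clin_Sum_any[OF clin_Pi Cm_finite]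
    by (simp add: clin_sc[OF clin_Pi] Pi_Hm hmb_def)
  then show ?thesis by (simp add: Cm_chain hmb_def hD_hcomp hcomp_simps mult.assoc)
qed

text \<open>Replacing a_k by its image gives a nested sum, reordered by
  \<open>Am_nested_left\<close>, and a term from \<open>hs\<close>. With P =
  \<open>hcomp g p\<close>, the reordering yields -D[hh P''] and -n times the mode n of hh P', which
  is D[(hh P')']. The second derivatives cancel and hh' P' is left.\<close>

lemma Pi_Am: "pi_op (Am p n v) = Ah (hh * hcomp g p) (hD hh * hD (hcomp g p) + hs * hcomp g p) n (pi_op v)"
proof -
  let ?p = "hcomp g p" and ?u = "pi_op v"
  let ?N = "\<lambda>k. if k < 0 then Am hh (0 + k) (Hm ?p (n - k) ?u) else Hm ?p (n - k) (Am hh (0 + k) ?u)"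
  let ?c = "2 * of_int (lowleft g) * of_int (lowleft g) :: complex"
  have hs: "hs = hconst ?c * 1" using hconst_add[of 1 1] by (simp add: hs_def hc_def hconst_mult)
  have D: "Dm hs k w = sc ?c (sc (of_int (- k)) (Hm hvar k w))" for k w
    unfolding hs Dm_hconst_mult using Dm_hD[of hvar k w] by simp
  have trm: "pi_op (Amterm p n k v) = ?N k + sc ?c (sc (of_int (- k)) (Hm ?p (n - k) (Hm hvar k ?u)))" for k
    by (auto simp: Amterm_def Pi_am Pi_Hm Ah_def D clin_add[OF clin_Hm] clin_sc[OF clin_Hm] Hm_commute)
  have fin: "finite {k. sc ?c (sc (of_int (- k)) (Hm ?p (n - k) (Hm hvar k ?u))) \<noteq> 0}"
    unfolding scale_scale hconst_mult[symmetric] by (rule Cm_finite)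
  have "pi_op (Am p n v) = Sum_any ?N + Sum_any (\<lambda>k. sc ?c (sc (of_int (- k)) (Hm ?p (n - k) (Hm hvar k ?u))))"
    unfolding Am_def[of p] clin_Sum_any[OF clin_Pi Amterm_finite] trm
    by (rule Sum_any.distrib[OF nested_finite fin])
  also have "Sum_any (\<lambda>k. sc ?c (sc (of_int (- k)) (Hm ?p (n - k) (Hm hvar k ?u)))) = Dm (hs * ?p) n ?u"
  proof -
    have "Dm (hs * ?p) n ?u = sc ?c (Dm ?p n ?u)"
      using Dm_hconst_mult[of ?c ?p n ?u] by (simp add: hs)
    then show ?thesis unfolding Dm_def Cm_def clin_Sum_any[OF clin_scale Cm_finite] by simp
  qed
  also have "Sum_any ?N = Am (hh * ?p) n ?u - Dm (hh * hD (hD ?p)) n ?u + sc (- of_int n) (Hm (hh * hD ?p) n ?u)"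
    unfolding Am_nested_left by (simp add: hconst_uminus scale_minus_left)
  also have "sc (- of_int n) (Hm (hh * hD ?p) n ?u) = Dm (hD (hh * hD ?p)) n ?u"
    by (simp add: Dm_hD)
  finally show ?thesis by (simp add: Ah_def hD_mult Dm_add_left algebra_simps)
qed

lemma Pi_Ah:
  "pi_op (Ah p r n v) = Ah (hh * hcomp g p)
     (hD hh * hD (hcomp g p) + hs * hcomp g p + hcomp g r * hji g * hji g) n (pi_op v)"
  by (simp add: Ah_def[of p] clin_add[OF clin_Pi] Pi_Am Pi_Dm) (simp add: Ah_def Dm_add_left)

end

section \<open>Comparison with the action on \<open>cdo\<close>\<close>

lemma fsum_to_cdo: "fsum (\<lambda>i. to_cdo (F i)) UNIV = to_cdo (Sum_any F)"
  by (simp add: fsum_def Sum_any.expand_set to_cdo_sum)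

lemma Sum_any_int_split:
  assumes fin: "finite {k :: int. G k \<noteq> (0 :: cdv)}"
  shows "Sum_any G = Sum_any (\<lambda>i::nat. G (- 1 - int i)) + Sum_any (\<lambda>j::nat. G (int j))"
proof -
  let ?S = "{k. G k \<noteq> 0}"
  have "Sum_any G = sum G (?S \<inter> {..<0}) + sum G (?S \<inter> {0..})"
    unfolding Sum_any.expand_set using fin
    by (subst sum.union_disjoint[symmetric]) (auto intro!: sum.cong)
  also have "sum G (?S \<inter> {..<0}) = (\<Sum>i\<in>{i::nat. G (- 1 - int i) \<noteq> 0}. G (- 1 - int i))"
    by (rule sum.reindex_bij_witness[of _ "\<lambda>i. - 1 - int i" "\<lambda>k. nat (- 1 - k)"]) auto
  also have "sum G (?S \<inter> {0..}) = (\<Sum>i\<in>{i::nat. G (int i) \<noteq> 0}. G (int i))"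
    by (rule sum.reindex_bij_witness[of _ int nat]) auto
  finally show ?thesis by (simp add: Sum_any.expand_set)
qed

lemma ahmode_to_cdo: "ahmode (hfun h) n (to_cdo v) = to_cdo (Am h n v)"
proof -
  have "amode (-1 - int i) (Hmode (hfun h) (n + int i + 1) (to_cdo v)) = to_cdo (Amterm h n (- 1 - int i) v)" for i
    by (simp add: Hmode_to_cdo amode_to_cdo Amterm_def algebra_simps)
  moreover have "Hmode (hfun h) (n - int j) (amode (int j) (to_cdo v)) = to_cdo (Amterm h n (int j) v)" for j
    by (simp add: Hmode_to_cdo amode_to_cdo Amterm_def)
  ultimately show ?thesis
    unfolding ahmode_def Am_def Sum_any_int_split[OF Amterm_finite] to_cdo_simps
    by (simp add: fsum_to_cdo)
qed

context
  fixes g :: mat assumes g: "g \<in> SL2Z"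
begin

lemma Aop_to_cdo: "Aop g n (to_cdo v) = to_cdo (Ah (hh g) (hs g) (- int n) v)"
proof -
  have 1: "mask (\<lambda>z. (jfac g z)^2) = hfun (hh g)"
    by (auto simp: hh_def[OF g] hfun_hj mask_def fun_eq_iff hfun_off power2_eq_square)
  have "Dm (hs g) (- int n) v = sc (2 * (of_int (lowleft g))^2) (Dm (hD hvar) (- int n) v)"
    unfolding Dm_hconst_mult[symmetric] using hconst_add[of 1 1]
    by (simp add: hs_def[OF g] hc_def hconst_mult power2_eq_square mult.assoc)
  also have "\<dots> = sc (2 * (of_int (lowleft g))^2 * of_nat n) (bm (- int n) v)"
    unfolding Dm_hD Hm_hvar scale_scale hconst_mult by simp
  finally have "to_cdo (Dm (hs g) (- int n) v) = (\<lambda>k z. 2 * (of_int (lowleft g))^2 * of_nat n * bmode (- int n) (to_cdo v) k z)"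
    unfolding bmode_to_cdo by (auto simp: to_cdo_def fun_eq_iff hfun_hconst hfun_off)
  then show ?thesis
    unfolding Aop_def Ah_def to_cdo_simps 1 ahmode_to_cdo by simp
qed

lemma Bop_to_cdo: "Bop g n (to_cdo v) = to_cdo (Hm (hmb g) (- int n) v)"
proof -
  have "mask (mob g) = hfun (hmb g)"
    by (auto simp: hmb_def[OF g] hfun_hcomp[OF g] hfun_hvar mob_UHP[OF g] mask_def fun_eq_iff hfun_off)
  then show ?thesis by (simp add: Bop_def Hmode_to_cdo)
qed

lemma pi_mono_to_cdo: "pi_mono g l m (hfun f) = to_cdo (pm g (l, m) f)"
proof -
  have 1: "vac (\<lambda>z. hfun f (mob g z)) = to_cdo (cvac (hcomp g f))"
    by (auto simp: vac_def to_cdo_def cf_mono fun_eq_iff mask_def hfun_hcomp[OF g] hfun_off)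
  have "foldr (Bop g) xs (to_cdo v) = to_cdo (foldr (\<lambda>n. Hm (hmb g) (- int n)) xs v)" for xs v
    by (induction xs) (auto simp: Bop_to_cdo)
  moreover have "foldr (Aop g) xs (to_cdo v) = to_cdo (foldr (\<lambda>n. Ah (hh g) (hs g) (- int n)) xs v)" for xs v
    by (induction xs) (auto simp: Aop_to_cdo)
  ultimately show ?thesis by (simp add: pi_mono_def pm_def[OF g] 1)
qed

lemma piact_to_cdo: "piact g (to_cdo v) = to_cdo (pi_op g v)"
proof -
  have "{k. to_cdo v k \<noteq> 0} = supp v" by (simp add: supp_def to_cdo_def)
  moreover have "pi_mono g (fst k) (snd k) (to_cdo v k) = to_cdo (pm g k (cf v k))" for k
    using pi_mono_to_cdo[of "fst k" "snd k" "cf v k"] by (simp add: to_cdo_def[of v])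
  ultimately show ?thesis
    by (simp add: piact_def pi_op_def[OF g] to_cdo_sum)
qed

end

subsection \<open>Leading terms\<close>

text \<open>The pairs of largest \<open>l = p(\<lambda>) - p(\<mu>)\<close> dominate the order on partition pairs, so leading terms
  only need to be tracked up to smaller \<open>l\<close>.\<close>

definition lvle :: "int \<Rightarrow> cdv \<Rightarrow> bool" where
  "lvle d v \<longleftrightarrow> (\<forall>k\<in>supp v. lval k \<le> d)"

lemma lvle_mono: "lvle d v \<Longrightarrow> d \<le> e \<Longrightarrow> lvle e v"
  by (force simp: lvle_def)

lemma lvle_0 [simp]: "lvle d 0"
  by (simp add: lvle_def supp_def)

lemma lvle_add: "lvle d v \<Longrightarrow> lvle d w \<Longrightarrow> lvle d (v + w)"
  unfolding lvle_def using supp_add by blast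

lemma lvle_scale: "lvle d v \<Longrightarrow> lvle d (scale f v)"
  unfolding lvle_def using supp_scale by blast

lemma lvle_Sum_any: "(\<And>x. lvle d (F x)) \<Longrightarrow> lvle d (Sum_any F)"
  unfolding lvle_def using supp_Sum_any by blast

lemma lvle_am: "lvle d v \<Longrightarrow> lvle (d + 1) (am n v)"
  unfolding lvle_def by (fastforce dest: supp_am split: if_splits)

lemma lvle_bm: "lvle d v \<Longrightarrow> n \<noteq> 0 \<Longrightarrow> lvle (d - 1) (bm n v)"
  unfolding lvle_def by (fastforce dest: supp_bm split: if_splits)

lemma lvle_Hm: "lvle d v \<Longrightarrow> lvle d (Hm f n v)"
  unfolding lvle_def by (fastforce dest: supp_Hm)

lemma lvle_Hm_nonzero: "lvle d v \<Longrightarrow> n \<noteq> 0 \<Longrightarrow> lvle (d - 1) (Hm f n v)"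
  unfolding lvle_def by (fastforce dest: supp_Hm)

lemma Sum_any_remove:
  assumes "finite {x. F x \<noteq> (0 :: cdv)}"
  shows "Sum_any F = F a + Sum_any (\<lambda>x. if x = a then 0 else F x)"
proof -
  have "finite {x. (if x = a then 0 else F x) \<noteq> 0}"
    by (rule finite_subset[OF _ assms]) auto
  moreover have "finite {x. (if x = a then F x else 0) \<noteq> 0}"
    by (rule finite_subset[of _ "{a}"]) auto
  ultimately have "Sum_any (\<lambda>x. (if x = a then F x else 0) + (if x = a then 0 else F x)) =
      F a + Sum_any (\<lambda>x. if x = a then 0 else F x)"
    by (subst Sum_any.distrib) simp_all
  moreover have "Sum_any F = Sum_any (\<lambda>x. (if x = a then F x else 0) + (if x = a then 0 else F x))"
    by (rule Sum_any.cong) auto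
  ultimately show ?thesis by (rule trans[rotated])
qed

lemma lvle_Hm_0: "lvle d v \<Longrightarrow> lvle (d - 1) (Hm f 0 v - scale f v)"
proof -
  assume v: "lvle d v"
  have "Hterm f 0 {#} v = scale f v" by (simp add: Hterm_def mfact_def)
  moreover have "Hm f 0 v = Hterm f 0 {#} v + Sum_any (\<lambda>R. if R = {#} then 0 else Hterm f 0 R v)"
    unfolding Hm_def by (rule Sum_any_remove[OF Hterm_finite])
  moreover have "lvle (d - 1) (if R = {#} then 0 else Hterm f 0 R v)" for R
  proof (cases "R \<noteq> {#} \<and> 0 \<notin># R \<and> sum_mset R = 0")
    case True
    have "lvle (d - 1) (bpr R v)"
      unfolding lvle_def
    proof
      fix k assume "k \<in> supp (bpr R v)"
      then obtain k' where "k' \<in> supp v" "lval k = lval k' - int (size R)" using supp_bpr True by blast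
      moreover have "size R > 0" using True by (simp add: nonempty_has_size)
      ultimately show "lval k \<le> d - 1" using v by (force simp: lvle_def)
    qed
    then show ?thesis using True by (simp add: Hterm_def lvle_scale)
  qed (auto simp: Hterm_def)
  ultimately show ?thesis by (simp add: lvle_Sum_any)
qed

lemma lvle_Dm: "lvle d v \<Longrightarrow> lvle (d - 1) (Dm q n v)"
  unfolding Dm_def Cm_def
proof (rule lvle_Sum_any)
  fix t assume "lvle d v"
  then show "lvle (d - 1) (sc (of_int (- t)) (Hm q (n - t) (Hm hvar t v)))"
    by (cases "t = 0") (simp_all add: lvle_scale lvle_Hm lvle_bm Hm_hvar)
qed

text \<open>The mode b_n alone lowers \<open>lval\<close> by one. Every other t with nonzero weight
  also involves a nonzero mode of q(b), hence lowers it by at least two.\<close>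

lemma lvle_Dm_lead:
  assumes v: "lvle d v" and n: "n < 0"
  shows "lvle (d - 2) (Dm q n v - sc (of_int (- n)) (scale q (bm n v)))"
proof -
  let ?F = "\<lambda>t. sc (of_int (- t)) (Hm q (n - t) (Hm hvar t v))"
  have "Dm q n v = ?F n + Sum_any (\<lambda>t. if t = n then 0 else ?F t)"
    unfolding Dm_def Cm_def by (rule Sum_any_remove[OF Cm_finite])
  moreover have "lvle (d - 2) (if t = n then 0 else ?F t)" for t
    using lvle_Hm_nonzero[OF lvle_bm[OF v, of t], of "n - t" q]
    by (cases "t = 0") (auto simp: Hm_hvar lvle_scale)
  moreover have "lvle (d - 2) (?F n - sc (of_int (- n)) (scale q (bm n v)))"
    using lvle_Hm_0[OF lvle_bm[OF v], of n q] n
    by (simp add: Hm_hvar lvle_scale flip: scale_diff_right)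
  ultimately show ?thesis
    using lvle_add[of "d - 2" "?F n - sc (of_int (- n)) (scale q (bm n v))" "Sum_any (\<lambda>t. if t = n then 0 else ?F t)"]
    by (simp add: lvle_Sum_any algebra_simps)
qed

lemma lvle_Am_lead:
  assumes v: "lvle d v" and n: "n < 0"
  shows "lvle d (Am p n v - scale p (am n v))"
proof -
  have "Am p n v = Amterm p n n v + Sum_any (\<lambda>k. if k = n then 0 else Amterm p n k v)"
    unfolding Am_def by (rule Sum_any_remove[OF Amterm_finite])
  moreover have "lvle d (if k = n then 0 else Amterm p n k v)" for k
  proof -
    have "lvle d (am k (Hm p (n - k) v))" if "k \<noteq> n"
      using lvle_am[OF lvle_Hm_nonzero[OF v], of "n - k"] that by simp
    moreover have "lvle d (Hm p (n - k) (am k v))" if "k \<noteq> n"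
      using lvle_Hm_nonzero[OF lvle_am[OF v], of "n - k"] that by simp
    ultimately show ?thesis by (simp add: Amterm_def)
  qed
  moreover have "lvle d (Amterm p n n v - scale p (am n v))"
    using lvle_am[OF lvle_Hm_0[OF v], of n p] n
    by (simp add: Amterm_def am_scale clin_diff[OF clin_am])
  ultimately show ?thesis
    using lvle_add[of d "Amterm p n n v - scale p (am n v)" "Sum_any (\<lambda>k. if k = n then 0 else Amterm p n k v)"]
    by (simp add: lvle_Sum_any algebra_simps)
qed

text \<open>A strong form of leading term: besides the monomial \<open>k\<close> nothing of the same
  \<open>lval\<close> may occur, whereas the order on pairs would allow it. In this form the
  property passes through the operators below.\<close>

definition lead :: "key \<Rightarrow> hol \<Rightarrow> cdv \<Rightarrow> bool" where
  "lead k F v \<longleftrightarrow> lvle (lval k - 1) (v - fmono k F)"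

lemma lvle_mono_vec: "lvle (lval k) (fmono k F)"
  by (auto simp: lvle_def supp_def cf_mono split: if_splits)

lemma scale_mono: "scale f (fmono k F) = fmono k (f * F)"
  by (rule cdv_eqI) (simp add: cf_mono)

lemma lead_lvle: "lead k F v \<Longrightarrow> lvle (lval k) v"
  using lvle_add[OF lvle_mono[of "lval k - 1" "v - fmono k F" "lval k"] lvle_mono_vec[of k F]] by (simp add: lead_def)

lemma lead_Ah:
  assumes "lead (l, m) F v" "0 < i"
  shows "lead (add_mset i l, m) (p * F) (Ah p s (- int i) v)"
proof -
  let ?d = "lval (l, m)" and ?n = "- int i"
  have v: "lvle ?d v" using lead_lvle[OF assms(1)] .
  have "lvle ?d (Am p ?n v - scale p (am ?n v))" by (rule lvle_Am_lead[OF v]) (use assms in simp)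
  moreover have "lvle ?d (Dm s ?n v)" using lvle_Dm[OF v] by (rule lvle_mono) simp
  moreover have "lvle ?d (scale p (am ?n (v - fmono (l, m) F)))"
    using lvle_am[OF assms(1)[unfolded lead_def], of ?n] by (simp add: lvle_scale)
  ultimately have "lvle ?d ((Am p ?n v - scale p (am ?n v)) + Dm s ?n v + scale p (am ?n (v - fmono (l, m) F)))"
    by (intro lvle_add)
  also have "(Am p ?n v - scale p (am ?n v)) + Dm s ?n v + scale p (am ?n (v - fmono (l, m) F))
      = Ah p s ?n v - fmono (add_mset i l, m) (p * F)"
    using assms(2) by (simp add: Ah_def clin_diff[OF clin_am] scale_diff_right mono_add_mset_left scale_mono[symmetric] am_scale)
  finally show ?thesis by (simp add: lead_def lval_def)
qed

lemma lead_Dm: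
  assumes "lead (l, m) F v" "0 < j"
  shows "lead (l, add_mset j m) (q * F) (sc (1 / of_nat j) (Dm q (- int j) v))"
proof -
  let ?d = "lval (l, m)" and ?n = "- int j" and ?c = "1 / of_nat j :: complex"
  have v: "lvle ?d v" using lead_lvle[OF assms(1)] .
  have "sc ?c (sc (of_nat j) w) = w" for w using assms(2) by (simp add: scale_scale flip: hconst_mult)
  note c = this
  have "lvle (?d - 2) (Dm q ?n v - sc (of_int (- ?n)) (scale q (bm ?n v)))"
    by (rule lvle_Dm_lead[OF v]) (use assms in simp)
  then have "lvle (?d - 2) (sc ?c (Dm q ?n v - sc (of_nat j) (scale q (bm ?n v))))"
    by (intro lvle_scale) simp
  moreover have "lvle (?d - 2) (scale q (bm ?n (v - fmono (l, m) F)))"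
    using lvle_bm[OF assms(1)[unfolded lead_def], of ?n] assms(2) by (simp add: lvle_scale)
  ultimately have "lvle (?d - 2) (sc ?c (Dm q ?n v - sc (of_nat j) (scale q (bm ?n v))) + scale q (bm ?n (v - fmono (l, m) F)))"
    by (intro lvle_add)
  also have "sc ?c (Dm q ?n v - sc (of_nat j) (scale q (bm ?n v))) + scale q (bm ?n (v - fmono (l, m) F))
      = sc ?c (Dm q ?n v) - fmono (l, add_mset j m) (q * F)"
    using assms(2) by (simp add: scale_diff_right c clin_diff[OF clin_bm] mono_add_mset_right scale_mono[symmetric] bm_scale)
  finally show ?thesis by (simp add: lead_def lval_def)
qed

lemma lead_cvac: "lead ({#}, {#}) F (cvac F)"
  by (simp add: lead_def)

lemma lead_foldr_Dm:
  "0 \<notin> set ys \<Longrightarrow> lead ({#}, mset ys) (q ^ length ys * F)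
     (foldr (\<lambda>j v. sc (1 / of_nat j) (Dm q (- int j) v)) ys (cvac F))"
  by (induction ys) (use lead_Dm in \<open>auto simp: lead_cvac mult.assoc\<close>)

lemma lead_foldr_Ah:
  "0 \<notin> set xs \<Longrightarrow> lead ({#}, m) F v \<Longrightarrow> lead (mset xs, m) (p ^ length xs * F)
     (foldr (\<lambda>i. Ah p s (- int i)) xs v)"
  by (induction xs) (use lead_Ah in \<open>auto simp: mult.assoc\<close>)

lemma lead_cf:
  assumes "lead k F v" "is_partition (fst k)" "is_partition (snd k)"
  shows "cf v k = F" "k' \<in> supp v \<Longrightarrow> k' \<noteq> k \<Longrightarrow> lval k' < lval k"
proof -
  have *: "cf (v - fmono k F) k' = 0 \<or> lval k' \<le> lval k - 1" for k'
    using assms(1) unfolding lead_def lvle_def supp_def by blast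
  show "cf v k = F" using *[of k] assms by (auto simp: cf_mono)
  show "k' \<in> supp v \<Longrightarrow> k' \<noteq> k \<Longrightarrow> lval k' < lval k"
    using *[of k'] by (auto simp: cf_mono supp_def)
qed

lemma pm_lead:
  assumes g: "g \<in> SL2Z" and p: "is_partition l" "is_partition m"
  shows "lead (l, m) (hh g ^ size l * hD (hmb g) ^ size m * hcomp g f) (pm g (l, m) f)"
proof -
  \<comment> \<open>Expressing the modes of \<open>hmb\<close> through its derivative makes the
    images of the b-modes instances of \<open>lead_Dm\<close>.\<close>
  have H: "Hm (hmb g) (- int j) v = sc (1 / of_nat j) (Dm (hD (hmb g)) (- int j) v)" if "0 < j" for j v
    using that by (simp add: Dm_hD scale_scale flip: hconst_mult)
  have "0 \<notin> set ys \<Longrightarrow> foldr (\<lambda>n. Hm (hmb g) (- int n)) ys w =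
      foldr (\<lambda>j v. sc (1 / of_nat j) (Dm (hD (hmb g)) (- int j) v)) ys w" for ys w
    by (induction ys) (auto simp: H)
  then have "pm g (l, m) f = foldr (\<lambda>i. Ah (hh g) (hs g) (- int i)) (sorted_list_of_multiset l)
     (foldr (\<lambda>j v. sc (1 / of_nat j) (Dm (hD (hmb g)) (- int j) v)) (sorted_list_of_multiset m) (cvac (hcomp g f)))"
    using p by (simp add: pm_def[OF g] is_partition_def)
  moreover have "lead (mset (sorted_list_of_multiset l), mset (sorted_list_of_multiset m))
      (hh g ^ length (sorted_list_of_multiset l) * (hD (hmb g) ^ length (sorted_list_of_multiset m) * hcomp g f)) \<dots>"
    using p by (intro lead_foldr_Ah lead_foldr_Dm) (auto simp: is_partition_def)
  ultimately show ?thesis by (simp add: mult.assoc flip: size_mset)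
qed

text \<open>Within one value of \<open>lval\<close> the action is diagonal on monomials, and
  everything else it produces has smaller \<open>lval\<close>. A coefficient of maximal
  \<open>lval\<close> therefore does not mix, even with other pairs of that same
  \<open>lval\<close>.\<close>

lemma Pi_leading_coefficient:
  assumes g: "g \<in> SL2Z" and p: "is_partition l" "is_partition m"
    and v: "\<And>k. k \<in> supp v \<Longrightarrow> lval k \<le> lval (l, m)"
  shows "cf (pi_op g v) (l, m) = hh g ^ size l * hD (hmb g) ^ size m * hcomp g (cf v (l, m))"
proof -
  let ?S = "insert (l, m) (supp v)"
  have "cf (pm g k (cf v k)) (l, m) = 0" if "k \<in> supp v" "k \<noteq> (l, m)" for k
  proof (rule ccontr)
    assume "\<not> ?thesis"
    moreover have "is_partition (fst k)" "is_partition (snd k)"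
      using that(1) cf_partition[of v k] by (auto simp: supp_def)
    ultimately have "lval (l, m) < lval k"
      using lead_cf(2)[OF pm_lead[OF g, of "fst k" "snd k" "cf v k"], of "(l, m)"] that(2)
      by (auto simp: supp_def)
    with v[OF that(1)] show False by simp
  qed
  then have "(\<Sum>k\<in>?S. cf (pm g k (cf v k)) (l, m)) = (\<Sum>k\<in>?S. if k = (l, m) then cf (pm g (l, m) (cf v (l, m))) (l, m) else 0)"
    by (intro sum.cong) auto
  then have "cf (pi_op g v) (l, m) = cf (pm g (l, m) (cf v (l, m))) (l, m)"
    by (subst Pi_superset[OF g, of ?S]) (auto simp: finite_supp cf_sum)
  then show ?thesis using lead_cf(1)[OF pm_lead[OF g p]] p by simp
qed

lemma homog_Am: "homog W v \<Longrightarrow> homog (W - n) (Am p n v)"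
  unfolding Am_def
proof (rule homog_Sum_any)
  fix k assume "homog W v"
  then show "homog (W - n) (Amterm p n k v)"
    using homog_am[OF homog_Hm, of W v "n - k" k p] homog_Hm[OF homog_am, of W v k "n - k" p]
    by (simp add: Amterm_def algebra_simps)
qed

lemma homog_Ah: "homog W v \<Longrightarrow> homog (W - n) (Ah p s n v)"
  unfolding Ah_def Dm_def by (intro homog_add homog_Am homog_Cm)

lemma homog_Dm: "homog W v \<Longrightarrow> homog (W - n) (Dm q n v)"
  unfolding Dm_def by (rule homog_Cm)

subsection \<open>Functions bounded at the cusp\<close>

text \<open>Bounds are demanded on every closed half plane above the real axis, not only near
  infinity: Cauchy's inequality for derivatives gives up part of the height, and this form is stable
  under that loss.\<close>

definition bnd :: "hol \<Rightarrow> bool" where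
  "bnd f \<longleftrightarrow> (\<forall>e>0. \<exists>C. \<forall>z. e \<le> Im z \<longrightarrow> cmod (hfun f z) \<le> C)"

lemma bnd_hconst: "bnd (hconst c)"
  by (auto simp: bnd_def hfun_hconst intro!: exI[of _ "cmod c"])

lemma bnd_0: "bnd 0" and bnd_1: "bnd 1"
  using bnd_hconst[of 0] bnd_hconst[of 1] by simp_all

lemma bnd_add: "bnd f \<Longrightarrow> bnd g \<Longrightarrow> bnd (f + g)"
  unfolding bnd_def by (simp, meson norm_triangle_mono)

lemma bnd_mult: "bnd f \<Longrightarrow> bnd g \<Longrightarrow> bnd (f * g)"
  unfolding bnd_def
proof (intro allI impI)
  fix e :: real
  assume *: "\<forall>e>0. \<exists>C. \<forall>z. e \<le> Im z \<longrightarrow> cmod (hfun f z) \<le> C"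
    "\<forall>e>0. \<exists>C. \<forall>z. e \<le> Im z \<longrightarrow> cmod (hfun g z) \<le> C" and e: "0 < e"
  obtain C D where CD: "\<And>z. e \<le> Im z \<Longrightarrow> cmod (hfun f z) \<le> C" "\<And>z. e \<le> Im z \<Longrightarrow> cmod (hfun g z) \<le> D"
    using * e by metis
  have "cmod (hfun (f * g) z) \<le> C * D" if "e \<le> Im z" for z
    using CD[OF that] by (simp add: norm_mult) (meson mult_mono norm_ge_zero order_trans)
  then show "\<exists>C. \<forall>z. e \<le> Im z \<longrightarrow> cmod (hfun (f * g) z) \<le> C" by blast
qed

lemma bnd_uminus: "bnd f \<Longrightarrow> bnd (- f)"
  unfolding bnd_def by simp

lemma bnd_hD: "bnd f \<Longrightarrow> bnd (hD f)"
  unfolding bnd_def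
proof (intro allI impI)
  fix e :: real
  assume *: "\<forall>e>0. \<exists>C. \<forall>z. e \<le> Im z \<longrightarrow> cmod (hfun f z) \<le> C" and e: "0 < e"
  then obtain C where C: "\<And>z. e / 2 \<le> Im z \<Longrightarrow> cmod (hfun f z) \<le> C"
    by (metis half_gt_zero)
  have "cmod (hfun (hD f) z) \<le> C / (e / 2)" if z: "e \<le> Im z" for z
  proof -
    have ball: "e / 2 \<le> Im w" if "cmod (z - w) \<le> e / 2" for w
      using abs_Im_le_cmod[of "z - w"] that z by auto
    have sub: "cball z (e / 2) \<subseteq> UHP" using ball e by (force simp: UHP_def dist_norm)
    have "cmod ((deriv ^^ 1) (hfun f) z) \<le> fact 1 * C / (e / 2) ^ 1"
    proof (rule Cauchy_inequality)
      show "hfun f holomorphic_on ball z (e / 2)"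
        by (rule holomorphic_on_subset[OF hfun_holomorphic]) (use sub ball_subset_cball in blast)
      show "continuous_on (cball z (e / 2)) (hfun f)"
        by (rule continuous_on_subset[OF holomorphic_on_imp_continuous_on[OF hfun_holomorphic] sub])
    qed (use e C ball in auto)
    then show ?thesis using z e by (simp add: hfun_hD)
  qed
  then show "\<exists>C. \<forall>z. e \<le> Im z \<longrightarrow> cmod (hfun (hD f) z) \<le> C" by blast
qed

text \<open>For a nowhere vanishing \<open>P\<close> with bounded logarithmic derivative, the multiples of \<open>P\<close> by
  functions bounded at the cusp are stable under differentiation.\<close>

definition cls :: "hol \<Rightarrow> hol \<Rightarrow> bool" where
  "cls P f \<longleftrightarrow> (\<exists>m. bnd m \<and> f = P * m)"

definition good :: "hol \<Rightarrow> bool" where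
  "good P \<longleftrightarrow> (\<exists>\<mu>. bnd \<mu> \<and> hD P = \<mu> * P)"

lemma good_1: "good 1"
  unfolding good_def by (rule exI[of _ 0]) (simp add: bnd_0)

lemma good_mult: "good P \<Longrightarrow> good Q \<Longrightarrow> good (P * Q)"
proof -
  assume "good P" "good Q"
  then obtain m n where "bnd m" "bnd n" "hD P = m * P" "hD Q = n * Q" by (auto simp: good_def)
  then show ?thesis unfolding good_def
    by (intro exI[of _ "m + n"]) (simp add: bnd_add hD_mult algebra_simps)
qed

lemma good_power: "good P \<Longrightarrow> good (P ^ n)"
  by (induction n) (auto simp: good_1 good_mult)

lemma cls_0: "cls P 0"
  unfolding cls_def by (rule exI[of _ 0]) (simp add: bnd_0)

lemma cls_add: "cls P f \<Longrightarrow> cls P g \<Longrightarrow> cls P (f + g)"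
  unfolding cls_def by (metis bnd_add distrib_left)

lemma cls_mult: "cls P f \<Longrightarrow> cls Q g \<Longrightarrow> cls (P * Q) (f * g)"
proof -
  assume "cls P f" "cls Q g"
  then obtain m n where "bnd m" "bnd n" "f = P * m" "g = Q * n" by (auto simp: cls_def)
  then show ?thesis unfolding cls_def
    by (intro exI[of _ "m * n"]) (simp add: bnd_mult algebra_simps)
qed

lemma cls_bnd_mult: "bnd m \<Longrightarrow> cls P f \<Longrightarrow> cls P (m * f)"
  using cls_mult[of 1 m P f] by (simp add: cls_def)

lemma cls_hD: "good P \<Longrightarrow> cls P f \<Longrightarrow> cls P (hD f)"
proof -
  assume "good P" "cls P f"
  then obtain m n where "bnd m" "bnd n" "hD P = m * P" "f = P * n" by (auto simp: good_def cls_def)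
  then show ?thesis unfolding cls_def
    by (intro exI[of _ "m * n + hD n"]) (simp add: bnd_mult bnd_add bnd_hD hD_mult algebra_simps)
qed

lemma cls_hD_funpow: "good P \<Longrightarrow> cls P f \<Longrightarrow> cls P ((hD ^^ n) f)"
  by (induction n) (auto intro: cls_hD)

lemma bnd_of_nat: "bnd (of_nat n)"
  unfolding hconst_of_nat[symmetric] by (rule bnd_hconst)

definition vcls :: "hol \<Rightarrow> cdv \<Rightarrow> bool" where
  "vcls P v \<longleftrightarrow> (\<forall>k. cls P (cf v k))"

lemma vcls_0: "vcls P 0"
  by (simp add: vcls_def cls_0)

lemma vcls_add: "vcls P v \<Longrightarrow> vcls P w \<Longrightarrow> vcls P (v + w)"
  by (simp add: vcls_def cls_add)

lemma vcls_sum: "(\<And>x. x \<in> A \<Longrightarrow> vcls P (F x)) \<Longrightarrow> vcls P (sum F A)"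
  by (induction A rule: infinite_finite_induct) (auto simp: vcls_0 vcls_add)

lemma vcls_Sum_any: "(\<And>x. vcls P (F x)) \<Longrightarrow> vcls P (Sum_any F)"
  unfolding Sum_any.expand_set by (rule vcls_sum)

lemma vcls_scale: "cls Q f \<Longrightarrow> vcls P v \<Longrightarrow> vcls (Q * P) (scale f v)"
  by (simp add: vcls_def cls_mult)

lemma vcls_sc: "vcls P v \<Longrightarrow> vcls P (sc c v)"
  by (simp add: vcls_def cls_bnd_mult bnd_hconst)

lemma vcls_am: "good P \<Longrightarrow> vcls P v \<Longrightarrow> vcls P (am n v)"
  unfolding vcls_def
  by (auto simp: cf_am cls_0 cls_hD intro!: cls_bnd_mult bnd_add bnd_1 bnd_of_nat)

text \<open>Index zero is excluded because \<open>bm 0\<close> multiplies by \<tau>, which is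
  unbounded.\<close>

lemma vcls_bm: "n \<noteq> 0 \<Longrightarrow> vcls P v \<Longrightarrow> vcls P (bm n v)"
proof -
  assume *: "n \<noteq> 0" "vcls P v"
  have "bnd (- 1 - of_nat j)" for j
    using bnd_uminus[OF bnd_of_nat[of "Suc j"]] by (simp add: algebra_simps)
  with * show ?thesis unfolding vcls_def
    by (auto simp: cf_bm cls_0 intro!: cls_bnd_mult)
qed

lemma vcls_bpr: "0 \<notin># R \<Longrightarrow> vcls P v \<Longrightarrow> vcls P (bpr R v)"
  by (induction R) (auto simp: bpr_add_mset vcls_bm)

lemma vcls_Hm:
  assumes "good Q" "cls Q f" "vcls P v"
  shows "vcls (Q * P) (Hm f n v)"
  unfolding Hm_def
proof (rule vcls_Sum_any)
  fix R show "vcls (Q * P) (Hterm f n R v)"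
    using assms by (auto simp: Hterm_def vcls_0 intro!: vcls_scale vcls_bpr cls_bnd_mult bnd_hconst cls_hD_funpow)
qed

text \<open>The mode b_0 occurs in \<open>Dm\<close> with weight 0, so no factor \<tau> enters and
  \<open>vcls_bm\<close> covers the remaining terms.\<close>

lemma vcls_Dm:
  assumes "good Q" "cls Q f" "vcls P v"
  shows "vcls (Q * P) (Dm f n v)"
  unfolding Dm_def Cm_def
proof (rule vcls_Sum_any)
  fix t show "vcls (Q * P) (sc (of_int (- t)) (Hm f (n - t) (Hm hvar t v)))"
    using assms by (cases "t = 0") (auto simp: Hm_hvar vcls_0 intro!: vcls_sc vcls_Hm vcls_bm)
qed

lemma vcls_Ah:
  assumes "good Q" "good P" "cls Q p" "cls Q s" "vcls P v"
  shows "vcls (Q * P) (Ah p s n v)"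
  unfolding Ah_def Am_def
proof (intro vcls_add vcls_Sum_any vcls_Dm assms)
  fix k show "vcls (Q * P) (Amterm p n k v)"
    unfolding Amterm_def using assms by (auto intro!: vcls_am vcls_Hm good_mult)
qed

subsection \<open>Lifting modular forms\<close>

context
  fixes p q \<psi> :: hol
  assumes pq: "p * q = 1" and hDp: "hD p = \<psi> * p"
begin

text \<open>This is p'^2 / 2p, rewritten by p' = \<psi> p; with it the field \<open>Ah p prr\<close>
  is multiplied by a constant under the group.\<close>

definition prr :: hol where "prr = hconst (1/2) * \<psi> * \<psi> * p"

text \<open>Each \<open>Ah p prr\<close> multiplies the leading coefficient by p and each
  \<open>Dm q\<close> by q = 1/p. The powers in the vacuum coefficient compensate this, so that the
  leading coefficient is \<open>f\<close>. The factor 1/j removes the mode number brought in by the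
  derivative of b.\<close>

definition lift_form :: "nat list \<Rightarrow> nat list \<Rightarrow> hol \<Rightarrow> cdv" where
  "lift_form xs ys f = foldr (\<lambda>i. Ah p prr (- int i)) xs
     (foldr (\<lambda>j v. sc (1 / of_nat j) (Dm q (- int j) v)) ys (cvac (f * (p ^ length ys * q ^ length xs))))"

lemma pq_power: "p ^ n * (q ^ n * u) = u"
  using arg_cong[OF pq, of "\<lambda>x. x ^ n * u"] by (simp add: power_mult_distrib mult.assoc)

lemma lift_lead:
  assumes "0 \<notin> set xs" "0 \<notin> set ys"
  shows "lead (mset xs, mset ys) f (lift_form xs ys f)"
proof -
  have "p ^ length xs * (q ^ length ys * (f * (p ^ length ys * q ^ length xs)))
      = p ^ length xs * (q ^ length xs * (p ^ length ys * (q ^ length ys * f)))"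
    by (simp add: ac_simps)
  also have "\<dots> = f" by (simp only: pq_power)
  finally show ?thesis
    using lead_foldr_Ah[OF assms(1) lead_foldr_Dm[OF assms(2), of q "f * (p ^ length ys * q ^ length xs)"], of p prr]
    by (simp add: lift_form_def)
qed

lemma lift_homog: "homog (int (weight (mset xs, mset ys))) (lift_form xs ys f)"
proof -
  have 1: "homog (int (sum_list ys)) (foldr (\<lambda>j v. sc (1 / of_nat j) (Dm q (- int j) v)) ys (cvac F))" for F
  proof (induction ys)
    case (Cons j ys)
    then show ?case using homog_Dm[OF Cons, of "- int j" q] by (auto intro!: homog_scale simp: algebra_simps)
  qed (simp add: homog_cvac)
  have "homog (int (sum_list xs) + W) (foldr (\<lambda>i. Ah p prr (- int i)) xs w)" if "homog W w" for w W
  proof (induction xs)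
    case (Cons j ys)
    then show ?case using homog_Ah[OF Cons, of "- int j" p prr] by (auto simp: algebra_simps)
  qed (simp add: that)
  from this[OF 1] show ?thesis by (simp add: lift_form_def weight_def sum_mset_sum_list)
qed

lemma hDq: "hD q = - \<psi> * q"
proof -
  have "0 = hD (p * q) * q" by (simp add: pq)
  also have "\<dots> = (p * q) * (\<psi> * q + hD q)" by (simp add: hD_mult hDp algebra_simps)
  finally show ?thesis by (simp add: pq eq_neg_iff_add_eq_0 add.commute)
qed

text \<open>Each operator multiplies the growth class by the same p or q that it contributes to the
  leading term. The total monomial in p and q is 1, so every coefficient is bounded although p
  itself need not be.\<close>

lemma lift_bnd:
  assumes \<psi>: "bnd \<psi>" and f: "bnd f"
  shows "bnd (cf (lift_form xs ys f) k)"
proof -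
  have gp: "good p" and gq: "good q"
    using hDp hDq \<psi> bnd_uminus[OF \<psi>] by (auto simp: good_def)
  have cp: "cls p p" "cls q q" by (auto simp: cls_def intro: exI[of _ 1] bnd_1)
  have cr: "cls p prr"
    unfolding prr_def by (intro cls_bnd_mult bnd_mult \<psi> bnd_hconst cp)
  let ?P = "p ^ length ys * q ^ length xs"
  have "cls ?P (f * ?P)" by (auto simp: cls_def mult.commute intro!: exI[of _ f] f)
  then have "vcls ?P (cvac (f * ?P))" by (auto simp: vcls_def cf_mono cls_0)
  then have "vcls (q ^ n * ?P) (foldr (\<lambda>j v. sc (1 / of_nat j) (Dm q (- int j) v)) zs (cvac (f * ?P)))"
    if "n = length zs" for zs n unfolding that
  proof (induction zs)
    case (Cons z zs)
    then show ?case using vcls_Dm[OF gq cp(2)] by (auto intro!: vcls_sc simp: mult.assoc)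
  qed simp
  note 1 = this[of _ ys, OF refl]
  have gP: "good (q ^ length ys * ?P)" by (intro good_mult good_power gp gq)
  have "vcls (p ^ length zs * (q ^ length ys * ?P)) (foldr (\<lambda>i. Ah p prr (- int i)) zs
     (foldr (\<lambda>j v. sc (1 / of_nat j) (Dm q (- int j) v)) ys (cvac (f * ?P))))" for zs
  proof (induction zs)
    case (Cons z zs)
    have "good (p ^ length zs * (q ^ length ys * ?P))" by (intro good_mult good_power gp gP)
    from vcls_Ah[OF gp this cp(1) cr Cons] show ?case by (simp add: mult.assoc)
  qed (use 1 in simp)
  then have "vcls (p ^ length xs * (q ^ length ys * ?P)) (lift_form xs ys f)" by (simp add: lift_form_def)
  moreover have "p ^ length xs * (q ^ length ys * ?P) = p ^ length xs * (q ^ length xs * (p ^ length ys * (q ^ length ys * 1)))"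
    by (simp add: ac_simps)
  ultimately have "vcls 1 (lift_form xs ys f)" by (simp only: pq_power)
  then have "cls 1 (cf (lift_form xs ys f) k)" unfolding vcls_def by blast
  then show ?thesis by (auto simp: cls_def)
qed

lemma lift_hconst: "lift_form xs ys (hconst c * f) = sc c (lift_form xs ys f)"
proof -
  have "cvac (hconst c * f * u) = sc c (cvac (f * u))" for u
    by (rule cdv_eqI) (simp add: cf_mono mult.assoc)
  then show ?thesis unfolding lift_form_def
    by (simp add: clin_sc[OF clin_foldr[OF clin_comp[OF clin_scale clin_Dm]]] clin_sc[OF clin_foldr[OF clin_Ah]])
qed

text \<open>With a and b the lengths of \<open>xs\<close> and \<open>ys\<close>, the fields built
  from p and q contribute \<kappa>^(a-b), and the powers of p and q in the vacuum coefficient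
  contribute \<kappa>^(b-a). What survives is the slash action on \<open>f\<close>.\<close>

lemma Pi_lift:
  assumes g: "g \<in> SL2Z" and T1: "hcomp g \<psi> = hj g * hj g * \<psi> - 2 * hc g * hj g"
    and T2: "hh g * hcomp g p = hconst \<kappa> * p" and \<kappa>: "\<kappa> \<noteq> 0"
  shows "pi_op g (lift_form xs ys f) = lift_form xs ys (hcomp g f * hh g ^ length xs * (hji g * hji g) ^ length ys)"
proof -
  let ?J = "hj g" and ?I = "hji g"
  have hh: "hh g = ?J * ?J" by (rule hh_def[OF g])
  have JI: "?J * ?I = 1" by (rule hj_hji[OF g])
  have ph: "hcomp g p = hconst \<kappa> * p * (?I * ?I)"
  proof -
    have "hcomp g p = (?J * ?I) * (?J * ?I) * hcomp g p" by (simp add: JI)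
    also have "\<dots> = (hh g * hcomp g p) * (?I * ?I)" by (simp add: hh ac_simps)
    finally show ?thesis by (simp add: T2)
  qed
  have \<kappa>1: "hconst (1 / \<kappa>) * hconst \<kappa> = 1" using \<kappa> by (simp flip: hconst_mult)
  have qh: "hcomp g q = hconst (1 / \<kappa>) * q * hh g"
  proof -
    have 1: "hcomp g p * hcomp g q = 1" using pq hcomp_simps(2,4)[OF g] by metis
    have "hcomp g q = (hconst (1 / \<kappa>) * hconst \<kappa>) * (p * q) * (?J * ?I) * (?J * ?I) * hcomp g q"
      by (simp add: \<kappa>1 pq JI)
    also have "\<dots> = (hconst (1 / \<kappa>) * q * hh g) * (hconst \<kappa> * p * (?I * ?I) * hcomp g q)"
      by (simp add: hh ac_simps)
    finally show ?thesis by (simp add: 1 flip: ph)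
  qed
  have dph: "hD (hcomp g p) = hconst \<kappa> * (\<psi> * p * ?I * ?I - 2 * hc g * p * ?I * ?I * ?I)"
    unfolding ph by (simp add: hD_mult hDp hD_hji[OF g] algebra_simps)
  \<comment> \<open>The factor 1/2 in \<open>prr\<close> is made for this: after inserting T1 the
    terms linear in \<psi> cancel, the multiples of c^2 cancel as -4 + 2 + 2, and \<psi>^2 / 2 is
    left.\<close>
  have s: "hD (hh g) * hD (hcomp g p) + hs g * hcomp g p + hcomp g prr * ?I * ?I = hconst \<kappa> * prr"
  proof (rule hol_eqI)
    fix z :: complex assume z: "0 < Im z"
    have two: "hfun 2 z = 2" using hfun_of_nat[of 2 z] z by simp
    have four: "hfun 4 z = 4" using hfun_of_nat[of 4 z] z by simp
    note nz = jfac_nonzero[OF g z]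
    show "hfun (hD (hh g) * hD (hcomp g p) + hs g * hcomp g p + hcomp g prr * ?I * ?I) z = hfun (hconst \<kappa> * prr) z"
      unfolding prr_def hcomp_simps[OF g] T1 dph hD_hh[OF g] hs_def[OF g]
      using nz z unfolding ph
      by (simp add: hfun_hconst two four hfun_hj hfun_hji[OF g] hc_def field_simps)
  qed
  have A: "pi_op g (Ah p prr n v) = sc \<kappa> (Ah p prr n (pi_op g v))" for n v
    unfolding Pi_Ah[OF g] s T2 by (simp add: Ah_def Am_hconst_mult Dm_hconst_mult scale_add_right)
  have D: "pi_op g (sc c (Dm q n v)) = sc (1 / \<kappa>) (sc c (Dm q n (pi_op g v)))" for c n v
  proof -
    have "hcomp g q * ?I * ?I = hconst (1 / \<kappa>) * q * ((?J * ?I) * (?J * ?I))"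
      unfolding qh hh by (simp add: ac_simps)
    then have e: "hcomp g q * ?I * ?I = hconst (1 / \<kappa>) * q" by (simp add: JI)
    show ?thesis
      by (simp only: clin_sc[OF clin_Pi[OF g]] Pi_Dm[OF g] e Dm_hconst_mult scale_scale mult.commute[of "hconst c"])
  qed
  have fA: "pi_op g (foldr (\<lambda>i. Ah p prr (- int i)) xs w) = sc (\<kappa> ^ length xs) (foldr (\<lambda>i. Ah p prr (- int i)) xs (pi_op g w))" for w
    by (induction xs) (simp_all add: A clin_sc[OF clin_Ah] scale_scale hconst_mult)
  have fD: "pi_op g (foldr (\<lambda>j v. sc (1 / of_nat j) (Dm q (- int j) v)) ys w) =
      sc ((1 / \<kappa>) ^ length ys) (foldr (\<lambda>j v. sc (1 / of_nat j) (Dm q (- int j) v)) ys (pi_op g w))" for w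
    by (induction ys) (simp_all add: D clin_sc[OF clin_Dm] scale_scale mult_ac flip: hconst_mult)
  let ?a = "length xs" and ?b = "length ys"
  have hp: "hconst (c ^ n) = hconst c ^ n" for c n by (induction n) (simp_all add: hconst_mult)
  have "hcomp g (f * (p ^ ?b * q ^ ?a)) = hconst (\<kappa> ^ ?b * (1 / \<kappa>) ^ ?a) *
      (hcomp g f * hh g ^ ?a * (?I * ?I) ^ ?b) * (p ^ ?b * q ^ ?a)"
    unfolding hcomp_simps[OF g] hcomp_power[OF g] ph qh hconst_mult hp
    by (simp only: power_mult_distrib ac_simps)
  then have "pi_op g (lift_form xs ys f) = sc (\<kappa> ^ ?a) (sc ((1 / \<kappa>) ^ ?b)
      (lift_form xs ys (hconst (\<kappa> ^ ?b * (1 / \<kappa>) ^ ?a) * (hcomp g f * hh g ^ ?a * (?I * ?I) ^ ?b))))"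
    unfolding lift_form_def fA fD Pi_cvac[OF g] clin_sc[OF clin_foldr[OF clin_Ah]] by simp
  also have "\<dots> = sc (\<kappa> ^ ?a * (1 / \<kappa>) ^ ?b * (\<kappa> ^ ?b * (1 / \<kappa>) ^ ?a))
      (lift_form xs ys (hcomp g f * hh g ^ ?a * (?I * ?I) ^ ?b))"
    by (subst lift_hconst) (simp only: scale_scale hconst_mult mult.assoc)
  also have "\<kappa> ^ ?a * (1 / \<kappa>) ^ ?b * (\<kappa> ^ ?b * (1 / \<kappa>) ^ ?a) = 1"
    using \<kappa> by (simp add: power_divide)
  finally show ?thesis by simp
qed

end

subsection \<open>Fourier coefficients\<close>

definition period_int :: "real \<Rightarrow> real \<Rightarrow> (complex \<Rightarrow> complex) \<Rightarrow> complex" where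
  "period_int N y F = integral {0..N} (\<lambda>x. F (Complex x y))"

definition line_cont :: "real \<Rightarrow> (complex \<Rightarrow> complex) \<Rightarrow> bool" where
  "line_cont y F \<longleftrightarrow> continuous_on {w. Im w = y} F"

lemma cl_line: "line_cont y F \<Longrightarrow> continuous_on {0..N} (\<lambda>x. F (Complex x y))"
  unfolding line_cont_def
  by (rule continuous_on_compose2[where f = "\<lambda>x. Complex x y"])
     (auto simp: Complex_eq intro!: continuous_intros)

lemma cl_holomorphic: "F holomorphic_on UHP \<Longrightarrow> 0 < y \<Longrightarrow> line_cont y F"
  unfolding line_cont_def by (rule continuous_on_subset[OF holomorphic_on_imp_continuous_on]) (auto simp: UHP_def)

lemma cl_arith:
  "line_cont y F \<Longrightarrow> line_cont y G \<Longrightarrow> line_cont y (\<lambda>w. F w + G w)" "line_cont y F \<Longrightarrow> line_cont y G \<Longrightarrow> line_cont y (\<lambda>w. F w - G w)"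
  "line_cont y F \<Longrightarrow> line_cont y G \<Longrightarrow> line_cont y (\<lambda>w. F w * G w)" "line_cont y (\<lambda>w. c)"
  "line_cont y F \<Longrightarrow> line_cont y (\<lambda>w. F w ^ n)" "line_cont y F \<Longrightarrow> line_cont y (\<lambda>w. - F w)"
  unfolding line_cont_def by (auto intro: continuous_intros)

lemma cl_divide: "line_cont y F \<Longrightarrow> line_cont y G \<Longrightarrow> (\<And>w. Im w = y \<Longrightarrow> G w \<noteq> 0) \<Longrightarrow> line_cont y (\<lambda>w. F w / G w)"
  unfolding line_cont_def by (auto intro: continuous_intros)

lemma PI_diff: "line_cont y F \<Longrightarrow> line_cont y G \<Longrightarrow> period_int N y (\<lambda>w. F w - G w) = period_int N y F - period_int N y G"
  unfolding period_int_def by (intro integral_diff integrable_continuous_real cl_line)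

lemma PI_cmult: "period_int N y (\<lambda>w. c * F w) = c * period_int N y F"
  unfolding period_int_def by simp

lemma PI_cong: "(\<And>w. Im w = y \<Longrightarrow> F w = G w) \<Longrightarrow> period_int N y F = period_int N y G"
  unfolding period_int_def by simp

lemma PI_bound:
  assumes "0 \<le> N" "line_cont y F" "\<And>w. Im w = y \<Longrightarrow> 0 \<le> Re w \<Longrightarrow> Re w \<le> N \<Longrightarrow> cmod (F w) \<le> B"
  shows "cmod (period_int N y F) \<le> B * N"
  using integral_bound[of 0 N "\<lambda>x. F (Complex x y)" B] cl_line[OF assms(2)] assms
  unfolding period_int_def by simp

lemma PI_primitive:
  assumes "0 \<le> N" "\<And>w. Im w = y \<Longrightarrow> (\<Phi> has_field_derivative F w) (at w)"
  shows "period_int N y F = \<Phi> (Complex N y) - \<Phi> (Complex 0 y)"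
proof -
  have "((\<lambda>x. F (Complex x y)) has_integral (\<Phi> (Complex N y) - \<Phi> (Complex 0 y))) {0..N}"
  proof (rule fundamental_theorem_of_calculus[OF assms(1)])
    fix x
    have c: "Complex x y = of_real x + \<i> * of_real y" for x by (simp add: complex_eq_iff)
    have "(\<Phi> has_field_derivative F (Complex x y)) (at (of_real x + \<i> * of_real y))"
      using assms(2)[of "Complex x y"] by (simp add: c)
    then have "((\<lambda>w. \<Phi> (w + \<i> * of_real y)) has_field_derivative F (Complex x y)) (at (of_real x))"
      by (simp add: DERIV_shift)
    from has_vector_derivative_real_field[OF this]
    show "((\<lambda>x. \<Phi> (Complex x y)) has_vector_derivative F (Complex x y)) (at x within {0..N})"
      by (simp add: c)
  qed
  then show ?thesis unfolding period_int_def by (rule integral_unique)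
qed

text \<open>A primitive \<Phi> on the half plane has an increment \<Phi>(w + N) - \<Phi>(w) of zero
  derivative, by periodicity. The integral is this increment, hence the same constant at every
  height.\<close>

lemma PI_height:
  assumes F: "F holomorphic_on UHP" and N: "0 < N" and per: "\<And>w. 0 < Im w \<Longrightarrow> F (w + of_real N) = F w"
    and y: "0 < y" "0 < y'"
  shows "period_int N y F = period_int N y' F"
proof -
  obtain \<Phi> where "\<And>w. w \<in> UHP \<Longrightarrow> (\<Phi> has_field_derivative F w) (at w within UHP)"
    using holomorphic_convex_primitive'[OF convex_UHP open_UHP F] by blast
  then have \<Phi>: "(\<Phi> has_field_derivative F w) (at w)" if "0 < Im w" for w
    using that at_within_open[OF _ open_UHP] by (metis UHP_def mem_Collect_eq)
  have "\<exists>c. \<forall>w\<in>UHP. \<Phi> (w + of_real N) - \<Phi> w = c"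
  proof (rule has_field_derivative_zero_constant[OF convex_UHP])
    fix w assume "w \<in> UHP"
    then have w: "0 < Im w" by (simp add: UHP_def)
    have "((\<lambda>w. \<Phi> (w + of_real N)) has_field_derivative F (w + of_real N)) (at w)"
      using \<Phi>[of "w + of_real N"] w by (simp add: DERIV_shift)
    then have "((\<lambda>w. \<Phi> (w + of_real N) - \<Phi> w) has_field_derivative F (w + of_real N) - F w) (at w)"
      using \<Phi>[OF w] by (rule DERIV_diff)
    then show "((\<lambda>w. \<Phi> (w + of_real N) - \<Phi> w) has_field_derivative 0) (at w within UHP)"
      using per[OF w] by (simp add: has_field_derivative_at_within)
  qed
  then obtain c where c: "\<And>w. w \<in> UHP \<Longrightarrow> \<Phi> (w + of_real N) - \<Phi> w = c" by blast
  have "period_int N y F = c" if "0 < y" for y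
  proof -
    have "period_int N y F = \<Phi> (Complex N y) - \<Phi> (Complex 0 y)"
      by (rule PI_primitive) (use N \<Phi> that in auto)
    moreover have "Complex N y = Complex 0 y + of_real N" by (simp add: complex_eq_iff)
    ultimately show ?thesis using c[of "Complex 0 y"] that by (simp add: UHP_def)
  qed
  with y show ?thesis by simp
qed

text \<open>The factor that extracts the m-th Fourier coefficient; index -1 gives the local
  coordinate e^{2 pi i w / N} at the cusp.\<close>

definition fexp :: "real \<Rightarrow> int \<Rightarrow> complex \<Rightarrow> complex" where
  "fexp N m w = exp (- 2 * of_real pi * \<i> * of_int m * w / of_real N)"

lemma fexp_holomorphic: "fexp N m holomorphic_on S"
  unfolding fexp_def by (intro holomorphic_intros) auto

lemma fexp_periodic: "0 < N \<Longrightarrow> fexp N m (w + of_real N) = fexp N m w"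
proof -
  assume "0 < N"
  then have "- 2 * of_real pi * \<i> * of_int m * (w + of_real N) / of_real N =
      - 2 * of_real pi * \<i> * of_int m * w / of_real N + (of_int (2 * - m) * of_real pi) * \<i>"
    by (simp add: field_simps)
  moreover have "exp ((of_int (2 * - m) * of_real pi) * \<i>) = (1 :: complex)"
    by (auto simp: exp_eq_1 intro!: exI[of _ "- m"])
  ultimately show ?thesis unfolding fexp_def by (simp only: exp_add mult_1_right)
qed

lemma norm_fexp: "0 < N \<Longrightarrow> cmod (fexp N m w) = exp (2 * pi * of_int m * Im w / N)"
  unfolding fexp_def by (simp add: norm_exp_eq_Re)

lemma fourier_coeff_PI: "fourier_coeff N f m = period_int (real N) 1 (\<lambda>w. f w * fexp (real N) m w) / of_nat N"
  unfolding fourier_coeff_def period_int_def fexp_def by simp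

text \<open>The Fourier integral may be taken at any height y. For m < 0 the bound on
  \<open>f\<close> then gives C N exp(2 pi m y / N), which tends to 0.\<close>

lemma hol_at_inftyI:
  assumes f: "f holomorphic_on UHP" and bound: "\<And>z. 1 \<le> Im z \<Longrightarrow> cmod (f z) \<le> C"
  shows "hol_at_infty f"
  unfolding hol_at_infty_def
proof (intro allI impI)
  fix N :: nat and m :: int
  assume N: "0 < N" and per: "\<forall>z. 0 < Im z \<longrightarrow> f (z + of_nat N) = f z" and m: "m < 0"
  let ?F = "\<lambda>w. f w * fexp (real N) m w"
  have hol: "?F holomorphic_on UHP" by (intro holomorphic_intros f fexp_holomorphic)
  have le: "cmod (period_int (real N) 1 ?F) \<le> C * real N * exp (2 * pi * of_int m * y / real N)" if "1 \<le> y" for y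
  proof -
    have "period_int (real N) 1 ?F = period_int (real N) y ?F"
      by (rule PI_height[OF hol]) (use N per that fexp_periodic[of "real N"] in auto)
    also have "cmod \<dots> \<le> (C * exp (2 * pi * of_int m * y / real N)) * real N"
      by (rule PI_bound) (use N that bound cl_holomorphic[OF hol, of y] in \<open>auto simp: norm_mult norm_fexp mult_right_mono\<close>)
    finally show ?thesis by (simp add: mult_ac)
  qed
  have "((\<lambda>y. exp (2 * pi * of_int m * y / real N)) \<longlongrightarrow> 0) at_top"
  proof -
    have "filterlim (\<lambda>y. (2 * pi * of_int m / real N) * y) at_bot at_top"
      using m N by (intro filterlim_tendsto_neg_mult_at_bot[OF tendsto_const]) (auto simp: filterlim_ident divide_neg_pos mult_pos_neg)
    then show ?thesis by (intro filterlim_compose[OF exp_at_bot]) simp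
  qed
  then have "((\<lambda>y. C * real N * exp (2 * pi * of_int m * y / real N)) \<longlongrightarrow> C * real N * 0) at_top"
    by (intro tendsto_intros)
  moreover have "\<forall>\<^sub>F y in at_top. cmod (period_int (real N) 1 ?F) \<le> C * real N * exp (2 * pi * of_int m * y / real N)"
    by (rule eventually_mono[OF eventually_ge_at_top[of 1]]) (rule le)
  ultimately have "cmod (period_int (real N) 1 ?F) \<le> C * real N * 0"
    by (rule tendsto_lowerbound) simp
  then show "fourier_coeff N f m = 0" by (simp add: fourier_coeff_PI)
qed


text \<open>The difference quotient of \<open>f\<close> at \<open>z\<close>, taken in the coordinate
  e^{2 pi i w / N} up to a constant. Its singularities at the translates of \<open>z\<close> by
  multiples of N are removable, which makes it an integrand to which \<open>PI_height\<close>
  applies across the line through \<open>z\<close>.\<close>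

lemma periodic_difference_quotient:
  fixes f :: "complex \<Rightarrow> complex"
  assumes f: "f holomorphic_on UHP" and N: "0 < N" and per: "\<And>w. 0 < Im w \<Longrightarrow> f (w + of_real N) = f w"
    and z: "0 < Im z"
  obtains Q where "Q holomorphic_on UHP" "\<And>w. 0 < Im w \<Longrightarrow> Q (w + of_real N) = Q w"
    "\<And>w. 0 < Im w \<Longrightarrow> Im w \<noteq> Im z \<Longrightarrow> Q w = (f w - f z) / (fexp N (-1) (w - z) - 1)"
proof -
  define E where "E w = fexp N (-1) (w - z)" for w
  define Q where "Q w = (if E w = 1 then deriv f z / (2 * of_real pi * \<i> / of_real N) else (f w - f z) / (E w - 1))" for w
  have E_per: "E (w + of_real N) = E w" for w
    using fexp_periodic[OF N, of "-1" "w - z"] by (simp add: E_def algebra_simps)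
  have Q_per: "Q (w + of_real N) = Q w" if "0 < Im w" for w
    using per[OF that] by (simp add: Q_def E_per)
  have Q_per': "Q (w + of_int k * of_real N) = Q w" if "0 < Im w" for w k
  proof (induction k rule: int_induct[where k = 0])
    case (step1 i)
    then show ?case using Q_per[of "w + of_int i * of_real N"] that by (simp add: algebra_simps)
  next
    case (step2 i)
    then show ?case using Q_per[of "w + of_int (i - 1) * of_real N"] that by (simp add: algebra_simps)
  qed simp
  have E1: "E w = 1 \<longleftrightarrow> (\<exists>k. w = z + of_int k * of_real N)" for w
  proof -
    have "E w = exp (2 * of_real pi * \<i> * (w - z) / of_real N)" by (simp add: E_def fexp_def)
    also have "\<dots> = 1 \<longleftrightarrow> (\<exists>k::int. 2 * of_real pi * \<i> * (w - z) / of_real N = of_int (2 * k) * of_real pi * \<i>)"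
      using exp_eq[of "2 * of_real pi * \<i> * (w - z) / of_real N" 0] by simp
    also have "\<dots> \<longleftrightarrow> (\<exists>k. w = z + of_int k * of_real N)"
    proof (rule ex_cong1)
      fix k :: int
      have "2 * of_real pi * \<i> * (w - z) / of_real N - of_int (2 * k) * of_real pi * \<i>
          = (2 * of_real pi * \<i> / of_real N) * (w - (z + of_int k * of_real N))"
        using N by (simp add: field_simps)
      then show "2 * of_real pi * \<i> * (w - z) / of_real N = of_int (2 * k) * of_real pi * \<i> \<longleftrightarrow>
          w = z + of_int k * of_real N"
        using N by (subst eq_iff_diff_eq_0) simp
    qed
    finally show ?thesis .
  qed
  have Ehol: "E holomorphic_on S" for S
    unfolding E_def fexp_def by (intro holomorphic_intros) (use N in auto)
  have Ez: "E z = 1" by (simp add: E1 exI[of _ 0])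
  have dE: "(E has_field_derivative 2 * of_real pi * \<i> / of_real N) (at z)"
    unfolding E_def fexp_def using N by (auto intro!: derivative_eq_intros)
  have df: "(f has_field_derivative deriv f z) (at z)"
    using holomorphic_derivI[OF f open_UHP, of z] z by (simp add: UHP_def)
  \<comment> \<open>Radius below N keeps other translates of \<open>z\<close> out of the ball,
    radius below Im z keeps the ball in the half plane.\<close>
  define r where "r = min (N / 2) (Im z / 2)"
  have r: "0 < r" "r < N" "r < Im z" using N z by (auto simp: r_def)
  have ball_UHP: "ball z r \<subseteq> UHP"
  proof
    fix w assume "w \<in> ball z r"
    then have "\<bar>Im (z - w)\<bar> < r" using abs_Im_le_cmod[of "z - w"] by (simp add: dist_norm)
    then show "w \<in> UHP" using r by (auto simp: UHP_def)
  qed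
  have E_ball: "w = z" if w: "w \<in> ball z r" "E w = 1" for w
  proof -
    obtain k :: int where k: "w = z + of_int k * of_real N" using w E1 by blast
    then have "\<bar>of_int k\<bar> * N < r" using w N by (simp add: dist_norm norm_mult)
    also have "\<dots> < N" by (rule r)
    finally have "\<bar>k\<bar> < 1" using N by simp
    then show ?thesis using k by simp
  qed
  have Q0: "Q holomorphic_on ball z r - {z}"
  proof (rule holomorphic_transform[of "\<lambda>w. (f w - f z) / (E w - 1)"])
    show "(\<lambda>w. (f w - f z) / (E w - 1)) holomorphic_on ball z r - {z}"
      using E_ball by (intro holomorphic_intros holomorphic_on_subset[OF f] Ehol) (use ball_UHP in auto)
    show "(f w - f z) / (E w - 1) = Q w" if "w \<in> ball z r - {z}" for w
      using that E_ball by (auto simp: Q_def)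
  qed
  have lim: "((\<lambda>w. (f w - f z) / (E w - 1)) \<longlongrightarrow> deriv f z / (2 * of_real pi * \<i> / of_real N)) (at z)"
  proof -
    have "((\<lambda>w. ((f w - f z) / (w - z)) / ((E w - E z) / (w - z))) \<longlongrightarrow> deriv f z / (2 * of_real pi * \<i> / of_real N)) (at z)"
      using df dE N by (intro tendsto_divide[where b = "2 * of_real pi * \<i> / of_real N"]) (simp_all add: has_field_derivative_iff)
    then show ?thesis
      by (rule Lim_transform_eventually) (auto simp: eventually_at Ez intro!: exI[of _ 1])
  qed
  have "isCont Q z"
    unfolding isCont_def
  proof (rule Lim_transform_eventually)
    show "((\<lambda>w. (f w - f z) / (E w - 1)) \<longlongrightarrow> Q z) (at z)" using lim by (simp add: Q_def Ez)
    show "\<forall>\<^sub>F w in at z. (f w - f z) / (E w - 1) = Q w"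
      using r(1) E_ball by (auto simp: eventually_at Q_def dist_commute intro!: exI[of _ r])
  qed
  then have "continuous_on (ball z r) Q"
    using holomorphic_on_imp_continuous_on[OF Q0]
    by (metis Diff_iff continuous_on_eq_continuous_at finite.emptyI finite_insert finite_imp_closed open_Diff open_ball singletonD singletonI)
  then have Qz: "Q holomorphic_on ball z r"
    using no_isolated_singularity[of "ball z r" Q "{z}"] Q0 by auto
  have "Q field_differentiable at w" if w: "0 < Im w" for w
  proof (cases "E w = 1")
    case False
    have op: "open (UHP - E -` {1})"
    proof -
      have "closedin (top_of_set UHP) (UHP \<inter> E -` {1})"
        by (rule continuous_closedin_preimage[OF holomorphic_on_imp_continuous_on[OF Ehol]]) simp
      then show ?thesis
        by (metis Diff_Int2 Diff_Int_distrib2 Diff_cancel closedin_def open_UHP openin_open_eq Diff_Int Un_empty_left topspace_euclidean_subtopology)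
    qed
    have "Q holomorphic_on UHP - E -` {1}"
    proof (rule holomorphic_transform[of "\<lambda>w. (f w - f z) / (E w - 1)"])
      show "(\<lambda>w. (f w - f z) / (E w - 1)) holomorphic_on UHP - E -` {1}"
        by (intro holomorphic_intros holomorphic_on_subset[OF f] Ehol) auto
    qed (auto simp: Q_def)
    then show ?thesis
      using op False w by (auto simp: holomorphic_on_open UHP_def field_differentiable_def)
  next
    case True
    \<comment> \<open>Any other singular point is carried to \<open>z\<close> by
      periodicity.\<close>
    then obtain k :: int where k: "w = z + of_int k * of_real N" using E1 by blast
    obtain D where "(Q has_field_derivative D) (at z)"
      using Qz r(1) by (metis centre_in_ball holomorphic_on_open open_ball)
    then have "((\<lambda>u. Q (u + - (of_int k * of_real N))) has_field_derivative D) (at w)"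
      by (subst DERIV_shift[symmetric]) (simp add: k)
    then have "(Q has_field_derivative D) (at w)"
    proof (rule has_field_derivative_transform_within_open[OF _ open_UHP])
      show "Q (u + - (of_int k * of_real N)) = Q u" if "u \<in> UHP" for u
        using Q_per'[of u "- k"] that by (simp add: UHP_def)
    qed (use w in \<open>simp add: UHP_def\<close>)
    then show ?thesis by (auto simp: field_differentiable_def)
  qed
  then have "Q holomorphic_on UHP"
    by (auto simp: holomorphic_on_def UHP_def intro: field_differentiable_at_within)
  moreover have "Q w = (f w - f z) / (E w - 1)" if "Im w \<noteq> Im z" for w
    using that E1[of w] by (auto simp: Q_def)
  ultimately show ?thesis using that[of Q] Q_per by (auto simp: E_def)
qed


text \<open>Cauchy's formula in the coordinate \<open>E w\<close>, written as integrals over one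
  period at heights \<open>y1\<close> < Im z < \<open>y2\<close>. At \<open>y2\<close> the kernel
  1/(E - 1) is expanded in powers of E, and vanishing Fourier coefficients remove the positive
  powers. What remains expresses N f(z) through f on a single segment at height \<open>y1\<close>,
  with a kernel bounded independently of z.\<close>

lemma periodic_bounded:
  fixes f :: "complex \<Rightarrow> complex" and N :: nat
  assumes f: "f holomorphic_on UHP" and N: "0 < N" and per: "\<And>w. 0 < Im w \<Longrightarrow> f (w + of_nat N) = f w"
    and inf: "hol_at_infty f" and e: "0 < e"
  shows "\<exists>C. \<forall>z. e \<le> Im z \<longrightarrow> cmod (f z) \<le> C"
proof -
  let ?N = "real N"
  have N': "0 < ?N" using N by simp
  have per': "f (w + of_real ?N) = f w" if "0 < Im w" for w using per[OF that] by simp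
  \<comment> \<open>Half of \<open>e\<close> keeps a fixed distance from every z with Im z \<ge>
    \<open>e\<close>; hence |E| is at least \<open>B\<close> > 1 on this line, uniformly in
    z.\<close>
  define y1 where "y1 = e / 2"
  have y1: "0 < y1" "y1 < e" using e by (auto simp: y1_def)
  have clf: "line_cont y f" if "0 < y" for y using cl_holomorphic[OF f that] .
  have bound_line: "\<exists>M\<ge>0. \<forall>w. Im w = y \<longrightarrow> 0 \<le> Re w \<longrightarrow> Re w \<le> ?N \<longrightarrow> cmod (f w) \<le> M" if "0 < y" for y
  proof -
    have "compact ((\<lambda>x. f (Complex x y)) ` {0..?N})"
      by (rule compact_continuous_image[OF cl_line[OF clf[OF that]]]) simp
    then obtain M where M: "\<And>x. x \<in> {0..?N} \<Longrightarrow> cmod (f (Complex x y)) \<le> M"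
      by (metis bounded_iff compact_imp_bounded imageI)
    have "cmod (f w) \<le> \<bar>M\<bar>" if "Im w = y" "0 \<le> Re w" "Re w \<le> ?N" for w
      using M[of "Re w"] that by (auto simp: complex_surj)
    then show ?thesis by (intro exI[of _ "\<bar>M\<bar>"]) auto
  qed
  obtain M where M: "0 \<le> M" "\<And>w. Im w = y1 \<Longrightarrow> 0 \<le> Re w \<Longrightarrow> Re w \<le> ?N \<Longrightarrow> cmod (f w) \<le> M"
    using bound_line[OF y1(1)] by blast
  define B where "B = exp (2 * pi * (e - y1) / ?N)"
  have B: "1 < B" using y1 N' by (simp add: B_def)
  have "cmod (f z) \<le> M + M / (B - 1)" if z: "e \<le> Im z" for z
  proof -
    have z0: "0 < Im z" "y1 < Im z" using z e y1 by auto
    obtain Q where Q: "Q holomorphic_on UHP" "\<And>w. 0 < Im w \<Longrightarrow> Q (w + of_real ?N) = Q w"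
      "\<And>w. 0 < Im w \<Longrightarrow> Im w \<noteq> Im z \<Longrightarrow> Q w = (f w - f z) / (fexp ?N (-1) (w - z) - 1)"
      using periodic_difference_quotient[OF f N' per' z0(1)] by blast
    define E where "E w = fexp ?N (-1) (w - z)" for w
    \<comment> \<open>A line above z, where |E| is a constant smaller than one.\<close>
    define y2 where "y2 = Im z + 1"
    have y2: "0 < y2" "Im z < y2" using z0 by (auto simp: y2_def)
    have Eper: "E (w + of_real ?N) = E w" for w
      using fexp_periodic[OF N', of "-1" "w - z"] by (simp add: E_def algebra_simps)
    have clE: "line_cont y E" for y
      unfolding line_cont_def E_def fexp_def using N by (intro continuous_intros) auto
    have nE: "cmod (E w) = exp (2 * pi * (Im z - Im w) / ?N)" for w
      using N' by (simp add: E_def norm_fexp algebra_simps)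
    have E1: "E w \<noteq> 1" if "Im w \<noteq> Im z" for w
      using nE[of w] that N' by auto
    have E0: "E w \<noteq> 0" for w by (simp add: E_def fexp_def)
    define c where "c = 2 * of_real pi * \<i> / complex_of_real ?N"
    have dE: "(E has_field_derivative c * E w) (at w)" for w
      unfolding E_def fexp_def c_def using N by (auto intro!: derivative_eq_intros)
    have clQ: "line_cont y (\<lambda>w. g w / (E w - 1))" if "line_cont y g" "y \<noteq> Im z" for y g
      using that E1 by (intro cl_divide cl_arith clE) auto
    have split: "period_int ?N y Q = period_int ?N y (\<lambda>w. f w / (E w - 1)) - f z * period_int ?N y (\<lambda>w. 1 / (E w - 1))"
      if "0 < y" "y \<noteq> Im z" for y
    proof -
      have "period_int ?N y Q = period_int ?N y (\<lambda>w. f w / (E w - 1) - f z * (1 / (E w - 1)))"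
        using that Q(3) by (intro PI_cong) (auto simp: E_def diff_divide_distrib)
      also have "\<dots> = period_int ?N y (\<lambda>w. f w / (E w - 1)) - period_int ?N y (\<lambda>w. f z * (1 / (E w - 1)))"
        using that by (intro PI_diff clQ clf cl_arith(3,4)) auto
      finally show ?thesis by (simp only: PI_cmult)
    qed
    have c0: "c \<noteq> 0" using N by (simp add: c_def)
    \<comment> \<open>Below z one has |1/E| < 1, so the logarithm of 1 - 1/E gives a periodic
      primitive and the integral vanishes.\<close>
    have low: "period_int ?N y1 (\<lambda>w. 1 / (E w - 1)) = 0"
    proof -
      have lt: "cmod (1 / E w) < 1" if "Im w = y1" for w
        using that z0 N' by (simp add: norm_divide nE)
      have "((\<lambda>w. Ln (1 - 1 / E w) / c) has_field_derivative 1 / (E w - 1)) (at w)" if w: "Im w = y1" for w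
      proof -
        have nz: "1 - 1 / E w \<notin> \<real>\<^sub>\<le>\<^sub>0"
          using lt[OF w] complex_Re_le_cmod[of "1 / E w"] by (auto simp: complex_nonpos_Reals_iff)
        have d1: "((\<lambda>w. 1 - 1 / E w) has_field_derivative c / E w) (at w)"
          using E0 by (auto intro!: derivative_eq_intros dE simp: field_simps)
        have "((\<lambda>w. Ln (1 - 1 / E w) / c) has_field_derivative (inverse (1 - 1 / E w) * (c / E w)) / c) (at w)"
          by (rule DERIV_cdivide[OF DERIV_chain2[OF has_field_derivative_Ln[OF nz] d1]])
        also have "(inverse (1 - 1 / E w) * (c / E w)) / c = 1 / (E w - 1)"
        proof -
          have "inverse (1 - 1 / E w) * (c / E w) / c = 1 / ((1 - 1 / E w) * E w)"
            using c0 by (simp add: divide_simps)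
          also have "(1 - 1 / E w) * E w = E w - 1" using E0[of w] by (simp add: field_simps)
          finally show ?thesis .
        qed
        finally show ?thesis .
      qed
      from PI_primitive[OF _ this] have "period_int ?N y1 (\<lambda>w. 1 / (E w - 1)) =
          Ln (1 - 1 / E (Complex ?N y1)) / c - Ln (1 - 1 / E (Complex 0 y1)) / c" by simp
      moreover have "Complex ?N y1 = Complex 0 y1 + of_real ?N" by (simp add: complex_eq_iff)
      ultimately show ?thesis using Eper by simp
    qed
    have nE2: "cmod (E w) = exp (- (2 * pi / ?N))" if "Im w = y2" for w
      using that by (simp add: nE y2_def)
    then have lt2: "cmod (E w) < 1" if "Im w = y2" for w
      using that N' by simp
    \<comment> \<open>Above z one has |E| < 1; the part -w of the primitive is not periodic and
      alone gives -N.\<close>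
    have high: "period_int ?N y2 (\<lambda>w. 1 / (E w - 1)) = - of_real ?N"
    proof -
      have "((\<lambda>w. Ln (1 - E w) / c - w) has_field_derivative 1 / (E w - 1)) (at w)" if w: "Im w = y2" for w
      proof -
        have nz: "1 - E w \<notin> \<real>\<^sub>\<le>\<^sub>0"
          using lt2[OF w] complex_Re_le_cmod[of "E w"] by (auto simp: complex_nonpos_Reals_iff)
        have d1: "((\<lambda>w. 1 - E w) has_field_derivative - (c * E w)) (at w)"
          by (auto intro!: derivative_eq_intros dE)
        have "((\<lambda>w. Ln (1 - E w) / c - w) has_field_derivative (inverse (1 - E w) * - (c * E w)) / c - 1) (at w)"
          by (rule DERIV_diff[OF DERIV_cdivide[OF DERIV_chain2[OF has_field_derivative_Ln[OF nz] d1]] DERIV_ident])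
        also have "(inverse (1 - E w) * - (c * E w)) / c - 1 = 1 / (E w - 1)"
        proof -
          have "1 - E w \<noteq> 0" "E w - 1 \<noteq> 0" using E1[of w] w y2 by auto
          then show ?thesis using c0 by (simp add: field_simps)
        qed
        finally show ?thesis .
      qed
      from PI_primitive[OF _ this] have "period_int ?N y2 (\<lambda>w. 1 / (E w - 1)) =
          (Ln (1 - E (Complex ?N y2)) / c - Complex ?N y2) - (Ln (1 - E (Complex 0 y2)) / c - Complex 0 y2)" by simp
      moreover have "Complex ?N y2 = Complex 0 y2 + of_real ?N" by (simp add: complex_eq_iff)
      ultimately show ?thesis using Eper by simp
    qed
    \<comment> \<open>The condition at infinity enters here: E^k is a multiple of
      \<open>fexp\<close> with the negative index -k.\<close>
    have powers: "period_int ?N y2 (\<lambda>w. f w * E w ^ k) = 0" if k: "0 < k" for k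
    proof -
      have *: "E w ^ k = fexp ?N (- int k) (- z) * fexp ?N (- int k) w" for w
        using N unfolding E_def fexp_def exp_of_nat_mult[symmetric] exp_add[symmetric]
        by (simp add: field_simps)
      have "fourier_coeff N f (- int k) = 0"
        using inf N per k unfolding hol_at_infty_def by auto
      then have "period_int ?N 1 (\<lambda>w. f w * fexp ?N (- int k) w) = 0"
        using N by (simp add: fourier_coeff_PI)
      moreover have "period_int ?N 1 (\<lambda>w. f w * fexp ?N (- int k) w) = period_int ?N y2 (\<lambda>w. f w * fexp ?N (- int k) w)"
        by (rule PI_height) (use N' y2 per' fexp_periodic[OF N'] in \<open>auto intro!: holomorphic_intros f fexp_holomorphic\<close>)
      moreover have "period_int ?N y2 (\<lambda>w. f w * E w ^ k) = fexp ?N (- int k) (- z) * period_int ?N y2 (\<lambda>w. f w * fexp ?N (- int k) w)"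
        unfolding PI_cmult[symmetric] * by (rule PI_cong) simp
      ultimately show ?thesis by simp
    qed
    obtain M2 where M2: "0 \<le> M2" "\<And>w. Im w = y2 \<Longrightarrow> 0 \<le> Re w \<Longrightarrow> Re w \<le> ?N \<Longrightarrow> cmod (f w) \<le> M2"
      using bound_line[OF y2(1)] by blast
    have geo: "period_int ?N y2 (\<lambda>w. f w / (E w - 1)) = - period_int ?N y2 f + period_int ?N y2 (\<lambda>w. f w * E w ^ Suc k / (E w - 1))" for k
    proof (induction k)
      case 0
      have "period_int ?N y2 (\<lambda>w. f w / (E w - 1)) = period_int ?N y2 (\<lambda>w. f w * E w ^ Suc 0 / (E w - 1) - f w)"
        using E1 y2 by (intro PI_cong) (auto simp: field_simps)
      then show ?case
        using y2 by (subst (asm) PI_diff) (auto intro!: clQ clf cl_arith(3) clE)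
    next
      case (Suc k)
      have "period_int ?N y2 (\<lambda>w. f w * E w ^ Suc k / (E w - 1)) = period_int ?N y2 (\<lambda>w. f w * E w ^ Suc (Suc k) / (E w - 1) - f w * E w ^ Suc k)"
        using E1 y2 by (intro PI_cong) (auto simp: field_simps)
      also have "\<dots> = period_int ?N y2 (\<lambda>w. f w * E w ^ Suc (Suc k) / (E w - 1)) - period_int ?N y2 (\<lambda>w. f w * E w ^ Suc k)"
        using y2 by (intro PI_diff clQ clf cl_arith(3,5) clE) auto
      finally show ?case using Suc powers[of "Suc k"] by simp
    qed
    let ?t = "exp (- (2 * pi / ?N))"
    have t: "0 < ?t" "?t < 1" using N' by auto
    have tail: "cmod (period_int ?N y2 (\<lambda>w. f w / (E w - 1)) + period_int ?N y2 f) \<le> (M2 * ?N / (1 - ?t)) * ?t ^ Suc k" for k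
    proof -
      have "cmod (period_int ?N y2 (\<lambda>w. f w * E w ^ Suc k / (E w - 1))) \<le> (M2 * ?t ^ Suc k / (1 - ?t)) * ?N"
      proof (rule PI_bound)
        show "line_cont y2 (\<lambda>w. f w * E w ^ Suc k / (E w - 1))"
          using y2 by (intro clQ cl_arith(3,5) clf clE) auto
        fix w assume w: "Im w = y2" "0 \<le> Re w" "Re w \<le> ?N"
        have "1 - ?t \<le> cmod (E w - 1)"
          using norm_triangle_ineq2[of 1 "E w"] nE2[OF w(1)] by (simp add: norm_minus_commute)
        then have "cmod (f w) * ?t ^ Suc k / cmod (E w - 1) \<le> M2 * ?t ^ Suc k / (1 - ?t)"
          using M2(2)[OF w] M2(1) t by (intro frac_le mult_mono mult_nonneg_nonneg) auto
        then show "cmod (f w * E w ^ Suc k / (E w - 1)) \<le> M2 * ?t ^ Suc k / (1 - ?t)"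
          by (simp add: norm_divide norm_mult norm_power nE2[OF w(1)] del: power_Suc)
      qed simp
      then show ?thesis using geo[of k] by (simp add: mult_ac del: power_Suc)
    qed
    have "(\<lambda>k. (M2 * ?N / (1 - ?t)) * ?t ^ Suc k) \<longlonglongrightarrow> (M2 * ?N / (1 - ?t)) * 0"
      using t by (intro tendsto_mult tendsto_const LIMSEQ_Suc[OF LIMSEQ_realpow_zero]) auto
    then have "cmod (period_int ?N y2 (\<lambda>w. f w / (E w - 1)) + period_int ?N y2 f) \<le> (M2 * ?N / (1 - ?t)) * 0"
      by (rule LIMSEQ_le_const) (use tail in blast)
    then have top: "period_int ?N y2 (\<lambda>w. f w / (E w - 1)) = - period_int ?N y2 f"
      by (simp add: eq_neg_iff_add_eq_0)
    have "period_int ?N y1 Q = period_int ?N y2 Q"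
      by (rule PI_height[OF Q(1)]) (use N' Q(2) y1 y2 in auto)
    then have "period_int ?N y1 (\<lambda>w. f w / (E w - 1)) = - period_int ?N y2 f + f z * of_real ?N"
      using split[of y1] split[of y2] y1 y2 z0 low high top by simp
    moreover have "period_int ?N y2 f = period_int ?N y1 f"
      by (rule PI_height[OF f]) (use N' per' y1 y2 in auto)
    ultimately have "f z * of_real ?N = period_int ?N y1 f + period_int ?N y1 (\<lambda>w. f w / (E w - 1))" by simp
    then have "cmod (f z) * ?N \<le> cmod (period_int ?N y1 f) + cmod (period_int ?N y1 (\<lambda>w. f w / (E w - 1)))"
      by (metis norm_mult norm_of_nat norm_triangle_ineq of_real_of_nat_eq)
    also have "cmod (period_int ?N y1 f) \<le> M * ?N"
      by (rule PI_bound) (use M clf[OF y1(1)] in auto)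
    also have "cmod (period_int ?N y1 (\<lambda>w. f w / (E w - 1))) \<le> (M / (B - 1)) * ?N"
    proof (rule PI_bound)
      show "line_cont y1 (\<lambda>w. f w / (E w - 1))" using y1 z0 by (intro clQ clf) auto
      fix w assume w: "Im w = y1" "0 \<le> Re w" "Re w \<le> ?N"
      have "B \<le> cmod (E w)" using w(1) z N' by (simp add: B_def nE divide_right_mono)
      then have "B - 1 \<le> cmod (E w - 1)" using norm_triangle_ineq2[of "E w" 1] by simp
      then show "cmod (f w / (E w - 1)) \<le> M / (B - 1)"
        using M(2)[OF w] M(1) B by (simp add: norm_divide frac_le)
    qed simp
    finally have "cmod (f z) * ?N \<le> (M + M / (B - 1)) * ?N" by (simp add: algebra_simps)
    then show ?thesis using N' by simp
  qed
  then show ?thesis by blast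
qed

subsection \<open>The Eisenstein series of weight two\<close>

lemma not_Ints_Im: "Im z \<noteq> 0 \<Longrightarrow> z \<notin> \<int>\<^sub>\<le>\<^sub>0" "Im z \<noteq> 0 \<Longrightarrow> z \<noteq> 0"
  by (auto elim!: nonpos_Ints_cases)

lemma sinh_ge_arg: "0 \<le> y \<Longrightarrow> 2 * y \<le> exp y - exp (- (y::real))"
proof -
  assume y: "0 \<le> y"
  \<comment> \<open>The second Taylor polynomial is enough, because A^2 - 1 - 2 y A is exactly y^4 /
    4 and x - 1/x increases with x > 0.\<close>
  define A where "A = 1 + y + y\<^sup>2 / 2"
  have A: "1 \<le> A" "A \<le> exp y" using y exp_lower_Taylor_quadratic[OF y] by (auto simp: A_def)
  have "A * A - 1 - 2 * y * A = y ^ 4 / 4" by (simp add: A_def power2_eq_square power4_eq_xxxx field_simps)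
  then have "2 * y * A \<le> A * A - 1" by (smt (verit) zero_le_power_eq_numeral even_numeral divide_nonneg_nonneg zero_le_even_power)
  then have "2 * y \<le> A - 1 / A" using A(1) by (simp add: field_simps)
  also have "\<dots> \<le> exp y - 1 / exp y" using A by (intro diff_mono divide_left_mono) auto
  finally show ?thesis by (simp add: exp_minus inverse_eq_divide)
qed

text \<open>A linear bound is all that is used: it turns \<open>Aser\<close> into a multiple of
  1/m^2, uniformly for Im t bounded below, and shows that sine has no zeros off the real
  line.\<close>

lemma norm_sin_ge: "\<bar>Im z\<bar> \<le> cmod (sin z)"
proof -
  have "cmod (sin z) = cmod (exp (\<i> * z) - exp (- (\<i> * z))) / 2"
    by (simp add: sin_exp_eq norm_divide norm_mult)
  moreover have "\<bar>exp (Im z) - exp (- Im z)\<bar> \<le> cmod (exp (\<i> * z) - exp (- (\<i> * z)))"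
    using norm_triangle_ineq3[of "exp (\<i> * z)" "exp (- (\<i> * z))"] by (simp add: norm_exp_eq_Re abs_minus_commute)
  moreover have "2 * \<bar>Im z\<bar> \<le> \<bar>exp (Im z) - exp (- Im z)\<bar>"
    using sinh_ge_arg[of "Im z"] sinh_ge_arg[of "- Im z"] by (cases "0 \<le> Im z") auto
  ultimately show ?thesis by simp
qed

lemma sin_pi_nonzero: "Im z \<noteq> 0 \<Longrightarrow> sin (of_real pi * z) \<noteq> 0"
  using norm_sin_ge[of "of_real pi * z"] by auto

text \<open>Logarithmic derivative of the reflection formula for the reciprocal Gamma
  function.\<close>

lemma Digamma_reflection:
  assumes "Im z \<noteq> 0"
  shows "Digamma (1 - z) - Digamma z = of_real pi * cos (of_real pi * z) / sin (of_real pi * z)"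
proof -
  have 1: "1 - z \<notin> \<int>\<^sub>\<le>\<^sub>0" using not_Ints_Im(1)[of "1 - z"] assms by simp
  have a: "((\<lambda>z. rGamma (1 - z)) has_field_derivative (- rGamma (1 - z) * Digamma (1 - z)) * (0 - 1)) (at z)"
    by (rule DERIV_chain2[where f = rGamma and g = "\<lambda>z. 1 - z" and x = z, OF has_field_derivative_rGamma_no_nonpos_int[OF 1]])
       (auto intro!: derivative_eq_intros)
  have b: "(rGamma has_field_derivative - rGamma z * Digamma z) (at z)"
    by (rule has_field_derivative_rGamma_no_nonpos_int[OF not_Ints_Im(1)[OF assms]])
  have "((\<lambda>z. rGamma z * rGamma (1 - z)) has_field_derivative
      (- rGamma z * Digamma z) * rGamma (1 - z) + (- rGamma (1 - z) * Digamma (1 - z)) * (0 - 1) * rGamma z) (at z)"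
    by (rule DERIV_mult[OF b a])
  moreover have "((\<lambda>z. rGamma z * rGamma (1 - z)) has_field_derivative cos (of_real pi * z)) (at z)"
    unfolding rGamma_reflection_complex by (auto intro!: derivative_eq_intros)
  ultimately have "cos (of_real pi * z) = (rGamma z * rGamma (1 - z)) * (Digamma (1 - z) - Digamma z)"
    using DERIV_unique by (fastforce simp: algebra_simps)
  then show ?thesis
    using sin_pi_nonzero[OF assms] by (simp add: rGamma_reflection_complex field_simps)
qed

lemma Polygamma_reflection:
  assumes "Im z \<noteq> 0"
  shows "Polygamma 1 z + Polygamma 1 (1 - z) = (of_real pi / sin (of_real pi * z))\<^sup>2"
proof -
  have op: "open {w. Im w \<noteq> 0}" by (intro open_Collect_neq continuous_intros)
  have 1: "1 - z \<notin> \<int>\<^sub>\<le>\<^sub>0" using not_Ints_Im(1)[of "1 - z"] assms by simp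
  have "((\<lambda>z. Digamma (1 - z)) has_field_derivative Polygamma (Suc 0) (1 - z) * (0 - 1)) (at z)"
    by (rule DERIV_chain2[where f = Digamma and g = "\<lambda>z. 1 - z" and x = z, OF has_field_derivative_Polygamma[OF 1]]) (auto intro!: derivative_eq_intros)
  moreover have "(Digamma has_field_derivative Polygamma (Suc 0) z) (at z)"
    by (rule has_field_derivative_Polygamma[OF not_Ints_Im(1)[OF assms]])
  ultimately have "((\<lambda>z. Digamma (1 - z) - Digamma z) has_field_derivative
      Polygamma (Suc 0) (1 - z) * (0 - 1) - Polygamma (Suc 0) z) (at z)"
    by (rule DERIV_diff)
  moreover have "((\<lambda>z. Digamma (1 - z) - Digamma z) has_field_derivative
      - (of_real pi / sin (of_real pi * z))\<^sup>2) (at z)"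
  proof (rule has_field_derivative_transform_within_open[OF _ op])
    let ?s = "sin (of_real pi * z)" and ?c = "cos (of_real pi * z)" and ?p = "of_real pi :: complex"
    have "((\<lambda>z. of_real pi * cos (of_real pi * z) / sin (of_real pi * z)) has_field_derivative
       ((?p * (- ?s * ?p)) * ?s - (?p * ?c) * (?c * ?p)) / (?s * ?s)) (at z)"
      using sin_pi_nonzero[OF assms] by (auto intro!: derivative_eq_intros)
    also have "(?p * (- ?s * ?p)) * ?s - (?p * ?c) * (?c * ?p) = - (?p * ?p) * (?s\<^sup>2 + ?c\<^sup>2)"
      by (simp add: power2_eq_square algebra_simps del: sin_cos_squared_add sin_cos_squared_add2 sin_cos_squared_add3)
    also have "?s\<^sup>2 + ?c\<^sup>2 = 1" by (rule sin_cos_squared_add)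
    finally show "((\<lambda>z. of_real pi * cos (of_real pi * z) / sin (of_real pi * z)) has_field_derivative
       - (of_real pi / sin (of_real pi * z))\<^sup>2) (at z)"
      by (simp add: power_divide power2_eq_square)
  qed (use assms Digamma_reflection in auto)
  ultimately show ?thesis using DERIV_unique by (fastforce simp: algebra_simps)
qed

section \<open>Unordered sums over the lattice\<close>

lemma summable_on_int_powr:
  assumes "1 < s"
  shows "(\<lambda>n::int. (1 + \<bar>real_of_int n\<bar>) powr (- s)) summable_on UNIV"
proof -
  have "summable (\<lambda>n. real n powr (- s))" using assms by (simp add: summable_real_powr_iff)
  then have "summable (\<lambda>n. real (Suc n) powr (- s))" by (subst summable_Suc_iff)
  then have *: "(\<lambda>n::nat. (1 + real n) powr (- s)) summable_on UNIV"
    by (subst summable_on_UNIV_nonneg_real_iff) auto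
  have "(\<lambda>n::int. (1 + \<bar>real_of_int n\<bar>) powr (- s)) summable_on (range int \<union> range (\<lambda>n. - int n))"
    by (intro summable_on_union; subst summable_on_reindex) (use * in \<open>auto simp: o_def inj_on_def\<close>)
  also have "range int \<union> range (\<lambda>n. - int n) = UNIV"
    by (auto simp: image_iff) (metis int_cases2)
  finally show ?thesis .
qed

lemma lattice_lower_bound:
  assumes "0 < Im t"
  obtains d where "0 < d" "\<And>m n :: int. m \<noteq> 0 \<Longrightarrow> d * (1 + \<bar>real_of_int m\<bar>) \<le> cmod (of_int m * t + of_int n)"
    "\<And>m n :: int. m \<noteq> 0 \<Longrightarrow> d * (1 + \<bar>real_of_int n\<bar>) \<le> cmod (of_int m * t + of_int n)"
proof -
  define y where "y = Im t"
  have y: "0 < y" using assms by (simp add: y_def)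
  \<comment> \<open>With x = |m t + n| and |m| \<le> x/y, the summands bound 1, the x from the
    triangle inequality, and |m| |t|, each by a multiple of x.\<close>
  define B where "B = 1 / y + 1 + cmod t / y"
  have B: "0 < B" using y by (auto simp: B_def intro!: add_pos_nonneg)
  have 1: "y / 2 * (1 + \<bar>real_of_int m\<bar>) \<le> cmod (of_int m * t + of_int n)" if "m \<noteq> 0" for m n :: int
  proof -
    have "\<bar>real_of_int m\<bar> * y \<le> cmod (of_int m * t + of_int n)"
      using abs_Im_le_cmod[of "of_int m * t + of_int n"] y by (simp add: y_def abs_mult)
    moreover have "1 \<le> \<bar>real_of_int m\<bar>" using that by simp
    then have "y / 2 * (1 + \<bar>real_of_int m\<bar>) \<le> y / 2 * (2 * \<bar>real_of_int m\<bar>)"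
      using y by (intro mult_left_mono) auto
    ultimately show ?thesis by (simp add: algebra_simps)
  qed
  have 2: "1 / B * (1 + \<bar>real_of_int n\<bar>) \<le> cmod (of_int m * t + of_int n)" if "m \<noteq> 0" for m n :: int
  proof -
    let ?x = "cmod (of_int m * t + of_int n)"
    have my: "\<bar>real_of_int m\<bar> * y \<le> ?x"
      using abs_Im_le_cmod[of "of_int m * t + of_int n"] y by (simp add: y_def abs_mult)
    then have m: "\<bar>real_of_int m\<bar> \<le> ?x / y" using y by (simp add: field_simps)
    have "1 \<le> \<bar>real_of_int m\<bar>" using that by simp
    with m have "1 \<le> ?x / y" by linarith
    moreover have "\<bar>real_of_int n\<bar> \<le> ?x + \<bar>real_of_int m\<bar> * cmod t"
      using norm_triangle_ineq4[of "of_int m * t + of_int n" "of_int m * t"] by (simp add: norm_mult)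
    moreover have "\<bar>real_of_int m\<bar> * cmod t \<le> ?x / y * cmod t"
      using m by (intro mult_right_mono) auto
    ultimately have "1 + \<bar>real_of_int n\<bar> \<le> ?x * B" by (simp add: B_def algebra_simps)
    then show ?thesis using B by (simp add: field_simps)
  qed
  show ?thesis
  proof (rule that[of "min (y / 2) (1 / B)"])
    show "0 < min (y / 2) (1 / B)" using y B by simp
    show "min (y / 2) (1 / B) * (1 + \<bar>real_of_int m\<bar>) \<le> cmod (of_int m * t + of_int n)" if "m \<noteq> 0" for m n :: int
      by (rule order_trans[OF mult_right_mono 1[OF that]]) auto
    show "min (y / 2) (1 / B) * (1 + \<bar>real_of_int n\<bar>) \<le> cmod (of_int m * t + of_int n)" if "m \<noteq> 0" for m n :: int
      by (rule order_trans[OF mult_right_mono 2[OF that]]) auto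
  qed
qed

text \<open>The index range is half open so that telescoping sums become symmetric: the sum of
  \<open>TT t m\<close> over it has the end terms belonging to m t - N and m t + N.\<close>

lemma infsum_int_limit:
  fixes f :: "int \<Rightarrow> complex"
  assumes "f summable_on UNIV"
  shows "(\<lambda>N. \<Sum>n\<in>{- int N..<int N}. f n) \<longlonglongrightarrow> infsum f UNIV"
proof -
  have "filterlim (\<lambda>N. {- int N..<int N}) (finite_subsets_at_top UNIV) sequentially"
  proof (subst filterlim_finite_subsets_at_top, intro allI impI)
    fix X :: "int set" assume X: "finite X \<and> X \<subseteq> UNIV"
    then obtain M where M: "\<And>x. x \<in> X \<Longrightarrow> \<bar>x\<bar> \<le> M"
      by (metis finite_imageI finite_int_iff_bounded_le imageI atMost_iff subsetD abs_le_D1 abs_le_iff bdd_above.E bdd_above_finite)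
    show "\<forall>\<^sub>F N in sequentially. finite {- int N..<int N} \<and> X \<subseteq> {- int N..<int N} \<and> {- int N..<int N} \<subseteq> UNIV"
      using eventually_gt_at_top[of "nat \<bar>M\<bar>"]
    proof eventually_elim
      case (elim N)
      then show ?case using M by (fastforce simp: abs_le_iff)
    qed
  qed
  moreover have "(sum f \<longlongrightarrow> infsum f UNIV) (finite_subsets_at_top UNIV)"
    using assms by (simp add: has_sum_infsum flip: has_sum_def)
  ultimately show ?thesis by (rule filterlim_compose[rotated])
qed

lemma sum_int_symmetric_Suc:
  "(\<Sum>n\<in>{- int (Suc N)..<int (Suc N)}. f n) = f (- int (Suc N)) + (\<Sum>n\<in>{- int N..<int N}. f n) + (f (int N) :: complex)"
proof -
  have "{- int (Suc N)..<int (Suc N)} = insert (- int (Suc N)) (insert (int N) {- int N..<int N})" by auto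
  then show ?thesis by simp
qed

lemma summable_on_cmod_comparison:
  fixes f :: "'a \<Rightarrow> complex"
  assumes "g summable_on A" "\<And>x. x \<in> A \<Longrightarrow> cmod (f x) \<le> g x"
  shows "f summable_on A"
  using Infinite_Sum.abs_summable_on_comparison_test'[OF assms] by (rule abs_summable_summable)

lemma infsum_even:
  fixes f :: "int \<Rightarrow> complex"
  assumes "f summable_on (- {0})" "\<And>m. f (- m) = f m"
  shows "infsum f (- {0}) = 2 * suminf (\<lambda>k. f (int (Suc k)))" "summable (\<lambda>k. f (int (Suc k)))"
proof -
  have s1: "f summable_on {0<..}" and s2: "f summable_on {..<0}"
    by (rule summable_on_subset_banach[OF assms(1)]; auto)+
  have "(f has_sum infsum f {0<..}) {0<..}" using s1 by (rule has_sum_infsum)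
  moreover have b: "bij_betw (\<lambda>k. int (Suc k)) UNIV {0<..}"
    by (rule bij_betwI[where g = "\<lambda>n. nat n - 1"]) auto
  ultimately have 1: "((\<lambda>k. f (int (Suc k))) has_sum infsum f {0<..}) UNIV"
    using has_sum_reindex_bij_betw[OF b, of f] by blast
  then have sums: "(\<lambda>k. f (int (Suc k))) sums infsum f {0<..}" by (rule has_sum_imp_sums)
  have "bij_betw uminus {0<..} {..<0::int}"
    by (rule bij_betwI[where g = uminus]) auto
  from infsum_reindex_bij_betw[OF this, of f] have "infsum f {..<0} = infsum f {0<..}"
    by (simp add: assms(2))
  moreover have "infsum f ({0<..} \<union> {..<0}) = infsum f {0<..} + infsum f {..<0}"
    by (rule infsum_Un_disjoint[OF s1 s2]) auto
  moreover have "{0<..} \<union> {..<0} = - {0::int}" by auto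
  ultimately show "infsum f (- {0}) = 2 * suminf (\<lambda>k. f (int (Suc k)))"
    using sums by (simp add: sums_iff)
  show "summable (\<lambda>k. f (int (Suc k)))" using sums by (rule sums_summable)
qed

text \<open>The terms n \<ge> 0 and n < 0 form the series of \<open>Polygamma 1\<close> at z and at
  1 - z.\<close>

lemma inverse_square_sum:
  assumes z: "Im z \<noteq> 0" and sum: "(\<lambda>n::int. 1 / (z + of_int n)\<^sup>2) summable_on UNIV"
  shows "infsum (\<lambda>n::int. 1 / (z + of_int n)\<^sup>2) UNIV = (of_real pi / sin (of_real pi * z))\<^sup>2"
proof -
  let ?f = "\<lambda>n::int. 1 / (z + of_int n)\<^sup>2"
  have s1: "?f summable_on {0..}" and s2: "?f summable_on {..<0}"
    by (rule summable_on_subset_banach[OF sum]; simp)+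
  have b1: "bij_betw int UNIV {0..}" by (rule bij_betwI[where g = nat]) auto
  have b2: "bij_betw (\<lambda>k. - 1 - int k) UNIV {..<0}" by (rule bij_betwI[where g = "\<lambda>n. nat (- 1 - n)"]) auto
  have 1: "(\<lambda>k. ?f (int k)) sums infsum ?f {0..}"
    using has_sum_infsum[OF s1] has_sum_reindex_bij_betw[OF b1, of ?f] by (blast intro: has_sum_imp_sums)
  have 2: "(\<lambda>k. ?f (- 1 - int k)) sums infsum ?f {..<0}"
    using has_sum_infsum[OF s2] has_sum_reindex_bij_betw[OF b2, of ?f] by (blast intro: has_sum_imp_sums)
  have "infsum ?f ({0..} \<union> {..<0}) = infsum ?f {0..} + infsum ?f {..<0}"
    by (rule infsum_Un_disjoint[OF s1 s2]) auto
  moreover have "{0..} \<union> {..<0} = (UNIV :: int set)" by auto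
  moreover have "infsum ?f {0..} = Polygamma 1 z"
    using 1 by (simp add: Polygamma_def sums_iff inverse_eq_divide power2_eq_square)
  moreover have "infsum ?f {..<0} = Polygamma 1 (1 - z)"
  proof -
    have "(z + of_int (- 1 - int k))\<^sup>2 = (1 - z + of_nat k)\<^sup>2" for k
      by (simp add: power2_eq_square algebra_simps)
    with 2 show ?thesis by (simp add: Polygamma_def sums_iff inverse_eq_divide power2_eq_square)
  qed
  ultimately show ?thesis using Polygamma_reflection[OF z] by simp
qed


context
  fixes t :: complex assumes t: "0 < Im t"
begin

lemma lattice_bounds:
  obtains d where "0 < d"
    "\<And>m n :: int. m \<noteq> 0 \<Longrightarrow> d * (1 + \<bar>real_of_int m\<bar>) \<le> cmod (of_int m * t + of_int n)"
    "\<And>m n :: int. m \<noteq> 0 \<Longrightarrow> d * (1 + \<bar>real_of_int n\<bar>) \<le> cmod (of_int m * t + of_int n)"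
    "\<And>m n :: int. m \<noteq> 0 \<Longrightarrow> d * (1 + \<bar>real_of_int m\<bar>) \<le> cmod (of_int m * t + of_int n + 1)"
    "\<And>m n :: int. m \<noteq> 0 \<Longrightarrow> d * (1 + \<bar>real_of_int n\<bar>) \<le> cmod (of_int m * t + of_int n + 1)"
proof -
  obtain d where d: "0 < d" "\<And>m n :: int. m \<noteq> 0 \<Longrightarrow> d * (1 + \<bar>real_of_int m\<bar>) \<le> cmod (of_int m * t + of_int n)"
    "\<And>m n :: int. m \<noteq> 0 \<Longrightarrow> d * (1 + \<bar>real_of_int n\<bar>) \<le> cmod (of_int m * t + of_int n)"
    using lattice_lower_bound[OF t] by blast
  have half: "d / 2 * x \<le> d * x" if "0 \<le> x" for x using d(1) that by simp
  show ?thesis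
  proof (rule that[of "d / 2"])
    fix m n :: int assume m: "m \<noteq> 0"
    show "d / 2 * (1 + \<bar>real_of_int m\<bar>) \<le> cmod (of_int m * t + of_int n)"
      using half[of "1 + \<bar>real_of_int m\<bar>"] d(2)[OF m, of n] by linarith
    show "d / 2 * (1 + \<bar>real_of_int n\<bar>) \<le> cmod (of_int m * t + of_int n)"
      using half[of "1 + \<bar>real_of_int n\<bar>"] d(3)[OF m, of n] by linarith
    show "d / 2 * (1 + \<bar>real_of_int m\<bar>) \<le> cmod (of_int m * t + of_int n + 1)"
      using half[of "1 + \<bar>real_of_int m\<bar>"] d(2)[OF m, of "n + 1"] by (simp add: add.assoc)
    have "d / 2 * (1 + \<bar>real_of_int n\<bar>) \<le> d * (1 + \<bar>real_of_int (n + 1)\<bar>)"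
    proof -
      have "(1 + \<bar>real_of_int n\<bar>) / 2 \<le> 1 + \<bar>real_of_int (n + 1)\<bar>" by (auto simp: abs_if)
      from mult_left_mono[OF this, of d] d(1) show ?thesis by simp
    qed
    then show "d / 2 * (1 + \<bar>real_of_int n\<bar>) \<le> cmod (of_int m * t + of_int n + 1)"
      using d(3)[OF m, of "n + 1"] by (simp add: add.assoc)
  qed (use d in auto)
qed

lemma lattice_nonzero: "m \<noteq> 0 \<Longrightarrow> of_int m * t + of_int n \<noteq> 0"
  using t by (auto simp: complex_eq_iff)

lemma lattice_nonzero1: "m \<noteq> 0 \<Longrightarrow> of_int m * t + of_int n + 1 \<noteq> 0"
  using t by (auto simp: complex_eq_iff)

text \<open>\<open>KK\<close> is the inverse square minus the telescoping term \<open>TT\<close>; it decays cubically, so its double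
  series may be summed in either order.\<close>

definition KK :: "int \<Rightarrow> int \<Rightarrow> complex" where
  "KK m n = 1 / ((of_int m * t + of_int n)\<^sup>2 * (of_int m * t + of_int n + 1))"

definition TT :: "int \<Rightarrow> int \<Rightarrow> complex" where
  "TT m n = 1 / (of_int m * t + of_int n) - 1 / (of_int m * t + of_int n + 1)"

lemma KK_eq: "m \<noteq> 0 \<Longrightarrow> 1 / (of_int m * t + of_int n)\<^sup>2 = KK m n + TT m n"
  using lattice_nonzero[of m n] lattice_nonzero1[of m n]
  unfolding KK_def TT_def by (simp add: divide_simps power2_eq_square)

lemma summable_sq_n: "m \<noteq> 0 \<Longrightarrow> (\<lambda>n. 1 / (of_int m * t + of_int n)\<^sup>2) summable_on UNIV"
  and summable_sq_m: "(\<lambda>m. 1 / (of_int m * t + of_int n)\<^sup>2) summable_on (- {0})"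
  and summable_TT_n: "m \<noteq> 0 \<Longrightarrow> TT m summable_on UNIV"
  and summable_TT_m: "(\<lambda>m. TT m n) summable_on (- {0})"
  and summable_KK: "(\<lambda>(m, n). KK m n) summable_on ((- {0}) \<times> UNIV)"
proof -
  obtain d where d: "0 < d"
    "\<And>m n :: int. m \<noteq> 0 \<Longrightarrow> d * (1 + \<bar>real_of_int m\<bar>) \<le> cmod (of_int m * t + of_int n)"
    "\<And>m n :: int. m \<noteq> 0 \<Longrightarrow> d * (1 + \<bar>real_of_int n\<bar>) \<le> cmod (of_int m * t + of_int n)"
    "\<And>m n :: int. m \<noteq> 0 \<Longrightarrow> d * (1 + \<bar>real_of_int m\<bar>) \<le> cmod (of_int m * t + of_int n + 1)"
    "\<And>m n :: int. m \<noteq> 0 \<Longrightarrow> d * (1 + \<bar>real_of_int n\<bar>) \<le> cmod (of_int m * t + of_int n + 1)"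
    using lattice_bounds by blast
  have prod: "cmod (1 / (x * x')) \<le> (1 / d\<^sup>2) * (1 + \<bar>real_of_int k\<bar>) powr (- 2)"
    if "d * (1 + \<bar>real_of_int k\<bar>) \<le> cmod x" "d * (1 + \<bar>real_of_int k\<bar>) \<le> cmod x'" for x x' and k :: int
  proof -
    let ?u = "1 + \<bar>real_of_int k\<bar>"
    have "(d * ?u) * (d * ?u) \<le> cmod x * cmod x'"
      using that d(1) by (intro mult_mono) auto
    then have "1 / (cmod x * cmod x') \<le> 1 / ((d * ?u) * (d * ?u))"
      using d(1) by (intro divide_left_mono) (auto intro!: mult_pos_pos order.strict_trans2[OF _ that(1)] order.strict_trans2[OF _ that(2)])
    also have "\<dots> = (1 / d\<^sup>2) * ?u powr (- 2)"
      by (simp add: powr_minus powr_numeral power2_eq_square field_simps)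
    finally show ?thesis by (simp add: norm_divide norm_mult)
  qed
  have P: "(\<lambda>k::int. (1 / d\<^sup>2) * (1 + \<bar>real_of_int k\<bar>) powr (- 2)) summable_on A" for A
    using summable_on_int_powr[of 2] by (intro summable_on_cmult_right summable_on_subset_banach[of _ UNIV A]) auto
  have TT: "TT m n = 1 / ((of_int m * t + of_int n) * (of_int m * t + of_int n + 1))" if "m \<noteq> 0" for m n
    using lattice_nonzero[OF that, of n] lattice_nonzero1[OF that, of n] by (simp add: TT_def divide_simps)
  show "(\<lambda>n. 1 / (of_int m * t + of_int n)\<^sup>2) summable_on UNIV" if "m \<noteq> 0" for m
    by (rule summable_on_cmod_comparison[OF P]) (unfold power2_eq_square[of "_ + _"], rule prod, auto intro: d(3)[OF that])
  show "(\<lambda>m. 1 / (of_int m * t + of_int n)\<^sup>2) summable_on (- {0})" for n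
    by (rule summable_on_cmod_comparison[OF P]) (unfold power2_eq_square[of "_ + _"], rule prod, auto intro: d(2))
  show "TT m summable_on UNIV" if "m \<noteq> 0" for m
    by (rule summable_on_cmod_comparison[OF P]) (unfold TT[OF that], rule prod, auto intro: d(3,5)[OF that])
  show "(\<lambda>m. TT m n) summable_on (- {0})" for n
    by (rule summable_on_cmod_comparison[OF P]) (subst TT, simp, rule prod, auto intro: d(2,4))
  have K: "cmod (KK m n) \<le> (1 / d ^ 3) * ((1 + \<bar>real_of_int m\<bar>) powr (- (3/2)) * (1 + \<bar>real_of_int n\<bar>) powr (- (3/2)))"
    if m: "m \<noteq> 0" for m n
  proof -
    let ?x = "cmod (of_int m * t + of_int n)" and ?x' = "cmod (of_int m * t + of_int n + 1)"
    let ?u = "1 + \<bar>real_of_int m\<bar>" and ?v = "1 + \<bar>real_of_int n\<bar>"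
    \<comment> \<open>The geometric mean of the two linear lower bounds: the cubic denominator then
      decays with exponent 3/2 > 1 in each index separately, so the majorant is a product of two
      summable families.\<close>
    define w where "w = sqrt (?u * ?v)"
    have w: "0 < w" by (simp add: w_def)
    have ge: "d * w \<le> x" if "d * ?u \<le> x" "d * ?v \<le> x" for x
    proof -
      have x: "0 \<le> x" using that(1) d(1) by (smt (verit) mult_nonneg_nonneg abs_ge_zero)
      have "(d * ?u) * (d * ?v) \<le> x * x" using that d(1) x by (intro mult_mono) auto
      then have "(d * w)\<^sup>2 \<le> x\<^sup>2" by (simp add: w_def power_mult_distrib power2_eq_square[of x] algebra_simps) (simp add: power2_eq_square algebra_simps)
      then show ?thesis using x by (rule power2_le_imp_le)
    qed
    have "(d * w)\<^sup>2 * (d * w) \<le> ?x\<^sup>2 * ?x'"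
      using ge[of ?x] ge[of ?x'] d(2-5)[OF m, of n] d(1) w by (intro mult_mono power_mono) auto
    then have "1 / (?x\<^sup>2 * ?x') \<le> 1 / ((d * w)\<^sup>2 * (d * w))"
      using d(1) w lattice_nonzero[OF m, of n] lattice_nonzero1[OF m, of n] by (intro divide_left_mono) auto
    also have "\<dots> = (1 / d ^ 3) * (1 / w ^ 3)"
      by (simp add: power2_eq_square power3_eq_cube)
    also have "1 / w ^ 3 = (?u * ?v) powr (- (3/2))"
    proof -
      have "0 \<le> ?u * ?v" by (intro mult_nonneg_nonneg) auto
      then have "(?u * ?v) powr (1/2) = w" unfolding w_def by (rule powr_half_sqrt)
      then have "w ^ 3 = ((?u * ?v) powr (1/2)) ^ 3" by (simp only:)
      also have "\<dots> = (?u * ?v) powr (3/2)" by (subst powr_power) auto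
      finally show ?thesis by (simp add: powr_minus inverse_eq_divide)
    qed
    also have "(?u * ?v) powr (- (3/2)) = ?u powr (- (3/2)) * ?v powr (- (3/2))"
      by (rule powr_mult)
    finally show ?thesis by (simp add: KK_def norm_divide norm_mult norm_power)
  qed
  have S: "(\<lambda>(m::int, n::int). (1 / d ^ 3) * ((1 + \<bar>real_of_int m\<bar>) powr (- (3/2)) * (1 + \<bar>real_of_int n\<bar>) powr (- (3/2)))) summable_on ((- {0}) \<times> UNIV)"
    (is "?F summable_on _")
  proof -
    have s: "(\<lambda>n::int. (1 + \<bar>real_of_int n\<bar>) powr (- (3/2))) summable_on A" for A
      by (rule summable_on_subset_banach[OF summable_on_int_powr]) auto
    define u where "u = (\<lambda>n::int. (1 + \<bar>real_of_int n\<bar>) powr (- (3/2)))"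
    have u: "u summable_on A" "0 \<le> u n" for A n using s by (auto simp: u_def)
    have n: "norm (?F (m, n)) = (1 / d ^ 3 * u m) * u n" for m n using d(1) by (simp add: u_def abs_mult)
    have "(\<lambda>x. norm (?F x)) summable_on ((- {0}) \<times> UNIV)"
      unfolding Infinite_Sum.abs_summable_on_Sigma_iff n
    proof (intro conjI ballI)
      show "(\<lambda>n. 1 / d ^ 3 * u m * u n) summable_on UNIV" for m
        by (intro summable_on_cmult_right u)
      have "norm (infsum (\<lambda>n. 1 / d ^ 3 * u m * u n) UNIV) = (1 / d ^ 3 * infsum u UNIV) * u m" for m
        unfolding infsum_cmult_right' using d(1) u(2) by (simp add: abs_mult infsum_nonneg)
      then show "(\<lambda>m. norm (infsum (\<lambda>n. 1 / d ^ 3 * u m * u n) UNIV)) summable_on (- {0})"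
        by (simp only:) (intro summable_on_cmult_right u)
    qed
    then show ?thesis by (rule abs_summable_summable)
  qed
  show "(\<lambda>(m, n). KK m n) summable_on ((- {0}) \<times> UNIV)"
    by (rule summable_on_cmod_comparison[OF S]) (use K in auto)
qed

text \<open>Telescoping leaves two end terms, both tending to zero. Row sums of inverse squares thus
  equal row sums of \<open>KK\<close>.\<close>

lemma infsum_TT_n:
  assumes m: "m \<noteq> 0" shows "infsum (TT m) UNIV = 0"
proof -
  let ?w = "of_int m * t"
  have tel: "(\<Sum>n\<in>{- int N..<int N}. TT m n) = 1 / (?w - of_nat N) - 1 / (?w + of_nat N)" for N
  proof (induction N)
    case (Suc N)
    then show ?case by (subst sum_int_symmetric_Suc) (simp add: TT_def algebra_simps)
  qed simp
  have "(\<lambda>N. 1 / (?w - of_nat N) - 1 / (?w + of_nat N)) \<longlonglongrightarrow> 0 - 0"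
  proof (intro tendsto_diff)
    have inf: "filterlim (\<lambda>N. of_nat N :: complex) at_infinity sequentially" by (rule tendsto_of_nat)
    have 1: "filterlim (\<lambda>N. ?w + of_nat N) at_infinity sequentially"
      by (rule tendsto_add_filterlim_at_infinity[OF tendsto_const inf])
    have 2: "filterlim (\<lambda>N. ?w + - of_nat N) at_infinity sequentially"
      by (rule tendsto_add_filterlim_at_infinity[OF tendsto_const]) (use inf in \<open>simp add: filterlim_at_infinity_conv_norm_at_top\<close>)
    show "(\<lambda>N. 1 / (?w + of_nat N)) \<longlonglongrightarrow> 0"
      using tendsto_divide_0[OF tendsto_const 1] .
    show "(\<lambda>N. 1 / (?w - of_nat N)) \<longlonglongrightarrow> 0"
      using tendsto_divide_0[OF tendsto_const 2] by simp
  qed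
  with infsum_int_limit[OF summable_TT_n[OF m]] show ?thesis
    unfolding tel using LIMSEQ_unique by fastforce
qed

end

section \<open>The weight two series and its inversion formula\<close>

lemma has_sum_diff_complex:
  fixes f g :: "'a \<Rightarrow> complex"
  assumes "(f has_sum a) A" "(g has_sum b) A"
  shows "((\<lambda>x. f x - g x) has_sum (a - b)) A"
  using has_sum_add[OF assms(1) has_sum_cmult_right[OF assms(2), of "- 1"]] by simp

lemma summable_on_diff_complex:
  fixes f g :: "'a \<Rightarrow> complex"
  shows "f summable_on A \<Longrightarrow> g summable_on A \<Longrightarrow> (\<lambda>x. f x - g x) summable_on A"
  unfolding summable_on_def using has_sum_diff_complex by blast

text \<open>The row m = 0 of the lattice sum, that is 2 zeta(2).\<close>

definition E2c :: complex where "E2c = infsum (\<lambda>m::int. 1 / (of_int m)\<^sup>2) (- {0})"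

definition Aser :: "complex \<Rightarrow> int \<Rightarrow> complex" where
  "Aser t m = (of_real pi / sin (of_real pi * (of_int m * t)))\<^sup>2"

text \<open>\<open>Aser t m = \<Sum>\<^sub>n (m t + n)\<^sup>-\<^sup>2\<close>, so \<open>G2\<close> is the weight two Eisenstein series summed over \<open>n\<close> first.\<close>

definition G2 :: "complex \<Rightarrow> complex" where
  "G2 t = E2c + infsum (Aser t) (- {0})"

lemma Aser_eq: "0 < Im t \<Longrightarrow> m \<noteq> 0 \<Longrightarrow> infsum (\<lambda>n. 1 / (of_int m * t + of_int n)\<^sup>2) UNIV = Aser t m"
  unfolding Aser_def by (rule inverse_square_sum) (auto intro: summable_sq_n)

lemma inverse_square_summable: "(\<lambda>m::int. 1 / (real_of_int m)\<^sup>2) summable_on (- {0})"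
proof (rule summable_on_comparison_test)
  show "(\<lambda>m::int. 4 * (1 + \<bar>real_of_int m\<bar>) powr (- 2)) summable_on (- {0})"
    by (intro summable_on_cmult_right summable_on_subset_banach[OF summable_on_int_powr]) auto
  fix m :: int assume "m \<in> - {0}"
  then have "1 + \<bar>real_of_int m\<bar> \<le> 2 * \<bar>real_of_int m\<bar>" "m \<noteq> 0" by auto
  then have "(1 + \<bar>real_of_int m\<bar>)\<^sup>2 \<le> (2 * \<bar>real_of_int m\<bar>)\<^sup>2" by (intro power_mono) auto
  then have "1 / (4 * (real_of_int m)\<^sup>2) \<le> 1 / (1 + \<bar>real_of_int m\<bar>)\<^sup>2"
    using \<open>m \<noteq> 0\<close> by (intro divide_left_mono) (auto simp: power_mult_distrib intro!: mult_pos_pos zero_less_power)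
  then show "1 / (real_of_int m)\<^sup>2 \<le> 4 * (1 + \<bar>real_of_int m\<bar>) powr (- 2)"
    by (simp add: powr_minus powr_numeral divide_simps split: if_splits)
qed auto

lemma Aser_bound:
  assumes "0 < e" "e \<le> Im t" "m \<noteq> 0"
  shows "cmod (Aser t m) \<le> (1 / e\<^sup>2) * (1 / (real_of_int m)\<^sup>2)"
proof -
  have "\<bar>pi * (of_int m * Im t)\<bar> \<le> cmod (sin (of_real pi * (of_int m * t)))"
    using norm_sin_ge[of "of_real pi * (of_int m * t)"] by simp
  moreover have "pi * (\<bar>of_int m\<bar> * e) \<le> \<bar>pi * (of_int m * Im t)\<bar>"
    using assms by (simp add: abs_mult mult_left_mono)
  ultimately have "pi * (\<bar>of_int m\<bar> * e) \<le> cmod (sin (of_real pi * (of_int m * t)))" by simp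
  moreover have "0 < pi * (\<bar>of_int m\<bar> * e)" using assms by simp
  ultimately have "pi / cmod (sin (of_real pi * (of_int m * t))) \<le> pi / (pi * (\<bar>of_int m\<bar> * e))"
    by (intro frac_le) auto
  then have "(pi / cmod (sin (of_real pi * (of_int m * t))))\<^sup>2 \<le> (1 / (\<bar>of_int m\<bar> * e))\<^sup>2"
    by (intro power_mono) auto
  then show ?thesis
    by (simp add: Aser_def norm_divide norm_power power_divide power_mult_distrib mult.commute)
qed

lemma Aser_summable: "0 < Im t \<Longrightarrow> Aser t summable_on (- {0})"
  by (rule summable_on_cmod_comparison[OF summable_on_cmult_right[OF inverse_square_summable]])
     (rule Aser_bound[of "Im t"], auto)

lemma E2c_summable: "(\<lambda>m::int. 1 / (of_int m)\<^sup>2 :: complex) summable_on (- {0})"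
  by (rule summable_on_cmod_comparison[OF inverse_square_summable]) (simp add: norm_divide norm_power)

lemma Aser_minus: "Aser t (- m) = Aser t m"
  by (simp add: Aser_def power_divide)

lemma G2_suminf: "0 < Im t \<Longrightarrow> G2 t = E2c + 2 * suminf (\<lambda>k. Aser t (int (Suc k)))"
  unfolding G2_def using infsum_even(1)[OF Aser_summable Aser_minus] by simp

lemma G2_translate: "0 < Im t \<Longrightarrow> G2 (t + 1) = G2 t"
proof -
  assume t: "0 < Im t"
  have "Aser (t + 1) m = Aser t m" if "m \<noteq> 0" for m
  proof -
    have "Aser (t + 1) m = infsum (\<lambda>n. 1 / (of_int m * (t + 1) + of_int n)\<^sup>2) UNIV"
      using that t by (intro Aser_eq[symmetric]) auto
    also have "\<dots> = infsum (\<lambda>n. 1 / (of_int m * t + of_int n)\<^sup>2) UNIV"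
      by (rule infsum_reindex_bij_witness[of _ "\<lambda>n. n - m" "\<lambda>n. n + m"]) (auto simp: algebra_simps)
    finally show ?thesis using that t by (simp add: Aser_eq)
  qed
  then have "infsum (Aser (t + 1)) (- {0}) = infsum (Aser t) (- {0})" by (intro infsum_cong) auto
  then show ?thesis unfolding G2_def by simp
qed

text \<open>cot z = i (1 + e^{-2iz}) / (1 - e^{-2iz}), and at z = pi N / t the exponential is r^N
  with |r| = exp(2 pi Im(1/t)) < 1.\<close>

lemma cot_limit:
  assumes t: "0 < Im t"
  shows "(\<lambda>N. cos (of_real pi * (of_nat N / t)) / sin (of_real pi * (of_nat N / t))) \<longlonglongrightarrow> \<i>"
proof -
  define r where "r = exp (- (2 * \<i> * of_real pi / t))"
  have "Im (1 / t) < 0" using t by (simp add: Im_divide divide_neg_pos sum_power2_gt_zero_iff)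
  then have "cmod r < 1"
    by (simp add: r_def norm_exp_eq_Re Im_divide Re_divide mult_pos_neg) (use t in \<open>auto simp: divide_simps sum_power2_gt_zero_iff\<close>)
  then have lim: "(\<lambda>N. r ^ N) \<longlonglongrightarrow> 0" by (rule LIMSEQ_power_zero)
  have "(\<lambda>N. \<i> * (1 + r ^ N) / (1 - r ^ N)) \<longlonglongrightarrow> \<i> * (1 + 0) / (1 - 0)"
    by (intro tendsto_intros lim) simp
  moreover have "cos (of_real pi * (of_nat N / t)) / sin (of_real pi * (of_nat N / t)) = \<i> * (1 + r ^ N) / (1 - r ^ N)" for N
  proof -
    let ?z = "of_real pi * (of_nat N / t)"
    define E where "E = exp (\<i> * ?z)"
    have E: "E \<noteq> 0" "exp (- (\<i> * ?z)) = 1 / E" by (auto simp: E_def exp_minus inverse_eq_divide)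
    have "r ^ N = exp (- (\<i> * ?z) + - (\<i> * ?z))"
      unfolding r_def exp_of_nat_mult[symmetric] by (simp add: algebra_simps)
    then have r: "r ^ N = 1 / E * (1 / E)" unfolding exp_add E(2) .
    have "cos ?z / sin ?z = ((E + 1 / E) / 2) / ((E - 1 / E) / (2 * \<i>))"
      unfolding cos_exp_eq sin_exp_eq E(2) by (simp add: E_def)
    also have "\<dots> = \<i> * ((E + 1 / E) / (E - 1 / E))"
    proof -
      have "(a / 2) / (b / (2 * \<i>)) = \<i> * (a / b)" for a b :: complex
        by (cases "b = 0") (auto simp: field_simps)
      then show ?thesis .
    qed
    also have "(E + 1 / E) / (E - 1 / E) = ((E + 1 / E) * (1 / E)) / ((E - 1 / E) * (1 / E))"
      using E by (intro mult_divide_mult_cancel_right[symmetric]) simp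
    also have "(E + 1 / E) * (1 / E) = 1 + r ^ N"
      using E by (simp add: r field_simps)
    also have "(E - 1 / E) * (1 / E) = 1 - r ^ N"
      using E by (simp add: r field_simps)
    finally show ?thesis by simp
  qed
  ultimately show ?thesis by simp
qed

context
  fixes t :: complex assumes t: "0 < Im t"
begin

text \<open>For m \<noteq> 0 this is the telescoped sum of \<open>TT t m n\<close> over -N \<le> n <
  N.\<close>

definition tt :: "nat \<Rightarrow> int \<Rightarrow> complex" where
  "tt N m = 1 / (of_int m * t - of_nat N) - 1 / (of_int m * t + of_nat N)"

definition LL :: "int \<Rightarrow> complex" where "LL n = infsum (\<lambda>m. TT t m n) (- {0})"

lemma LL_partial_sum:
  "tt N summable_on (- {0}) \<and> (\<Sum>n\<in>{- int N..<int N}. LL n) = infsum (tt N) (- {0})"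
proof (induction N)
  case 0
  have "tt 0 = (\<lambda>m. 0)" by (simp add: tt_def fun_eq_iff)
  then show ?case by simp
next
  case (Suc N)
  have s: "(\<lambda>m. TT t m n) summable_on (- {0})" for n by (rule summable_TT_m[OF t])
  have eq: "tt (Suc N) m = TT t m (- int (Suc N)) + (tt N m + TT t m (int N))" for m
    by (simp add: tt_def TT_def[OF t] algebra_simps)
  have s1: "(\<lambda>m. tt N m + TT t m (int N)) summable_on (- {0})"
    using Suc s by (intro summable_on_add) auto
  have "tt (Suc N) summable_on (- {0})"
    unfolding eq[abs_def] by (intro summable_on_add s s1)
  moreover have "infsum (tt (Suc N)) (- {0}) = LL (- int (Suc N)) + (infsum (tt N) (- {0}) + LL (int N))"
    unfolding eq[abs_def] LL_def using Suc s s1 by (simp add: infsum_add)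
  ultimately show ?case using Suc by (subst sum_int_symmetric_Suc) simp
qed

text \<open>The terms m and -m agree. For m > 0, with w = N/t, they form a difference of Digamma
  series at 1 + w and 1 - w, each made convergent by the terms 1/(k+1); reflection turns this
  difference into a cotangent.\<close>

lemma infsum_tt:
  assumes N: "0 < N"
  shows "infsum (tt N) (- {0}) = (2 / t) * (t / of_nat N - of_real pi * (cos (of_real pi * (of_nat N / t)) / sin (of_real pi * (of_nat N / t))))"
proof -
  define w where "w = of_nat N / t"
  have t0: "t \<noteq> 0" using t by auto
  have imw: "Im w \<noteq> 0" using t N by (simp add: w_def Im_divide)
  have w0: "w \<noteq> 0" "1 + w \<noteq> 0" "1 - w \<noteq> 0" using imw by (auto simp: complex_eq_iff)
  have nz: "1 + w + of_nat k \<noteq> 0" "1 - w + of_nat k \<noteq> 0" for k using imw by (auto simp: complex_eq_iff)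
  let ?D = "\<lambda>z k. inverse (of_nat (Suc k)) - inverse (z + of_nat k) :: complex"
  have s: "summable (?D (1 + w))" "summable (?D (1 - w))" using w0 by (blast intro: summable_Digamma)+
  have "tt N (int (Suc k)) = (1 / t) * (?D (1 + w) k - ?D (1 - w) k)" for k
  proof -
    have 1: "of_int (int (Suc k)) * t - of_nat N = t * (1 - w + of_nat k)" "of_int (int (Suc k)) * t + of_nat N = t * (1 + w + of_nat k)"
      using t0 by (simp_all add: w_def algebra_simps)
    show ?thesis unfolding tt_def 1 by (simp add: inverse_eq_divide algebra_simps)
  qed
  then have "suminf (\<lambda>k. tt N (int (Suc k))) = suminf (\<lambda>k. (1 / t) * (?D (1 + w) k - ?D (1 - w) k))"
    by (simp only:)
  also have "\<dots> = (1 / t) * suminf (\<lambda>k. ?D (1 + w) k - ?D (1 - w) k)"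
    by (rule suminf_mult[OF summable_diff[OF s]])
  also have "suminf (\<lambda>k. ?D (1 + w) k - ?D (1 - w) k) = Digamma (1 + w) - Digamma (1 - w)"
    using suminf_diff[OF s] by (simp add: Polygamma_def)
  also have "Digamma (1 + w) = Digamma w + 1 / w" using Digamma_plus1[OF w0(1)] by (simp add: add.commute)
  also have "Digamma w + 1 / w - Digamma (1 - w) = 1 / w - of_real pi * cos (of_real pi * w) / sin (of_real pi * w)"
    using Digamma_reflection[OF imw] by (simp add: algebra_simps)
  finally have *: "suminf (\<lambda>k. tt N (int (Suc k))) = (1 / t) * (1 / w - of_real pi * cos (of_real pi * w) / sin (of_real pi * w))" .
  have even: "tt N (- m) = tt N m" for m
  proof -
    have "of_int (- m) * t - of_nat N = - (of_int m * t + of_nat N)" "of_int (- m) * t + of_nat N = - (of_int m * t - of_nat N)"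
      by simp_all
    then show ?thesis unfolding tt_def by (simp only: divide_minus_right) simp
  qed
  have "infsum (tt N) (- {0}) = 2 * ((1 / t) * (1 / w - of_real pi * cos (of_real pi * w) / sin (of_real pi * w)))"
    using infsum_even(1)[of "tt N"] LL_partial_sum[of N] even * by simp
  then show ?thesis by (simp add: w_def)
qed

text \<open>Rows of \<open>TT\<close> sum to zero, but the columns add up to -2 pi i / t. This
  failure of exchange is the whole inhomogeneous term in the inversion of \<open>G2\<close>.\<close>

lemma LL_limit: "(\<lambda>N. \<Sum>n\<in>{- int N..<int N}. LL n) \<longlonglongrightarrow> - (2 * of_real pi * \<i> / t)"
proof (rule Lim_transform_eventually)
  have "(\<lambda>N. t / of_nat N) \<longlonglongrightarrow> 0"
    by (rule tendsto_divide_0[OF tendsto_const tendsto_of_nat])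
  then have "(\<lambda>N. (2 / t) * (t / of_nat N - of_real pi * (cos (of_real pi * (of_nat N / t)) / sin (of_real pi * (of_nat N / t)))))
      \<longlonglongrightarrow> (2 / t) * (0 - of_real pi * \<i>)"
    by (intro tendsto_intros cot_limit[OF t])
  then show "(\<lambda>N. (2 / t) * (t / of_nat N - of_real pi * (cos (of_real pi * (of_nat N / t)) / sin (of_real pi * (of_nat N / t)))))
      \<longlonglongrightarrow> - (2 * of_real pi * \<i> / t)" by (simp add: mult.assoc)
  show "\<forall>\<^sub>F N in sequentially. (2 / t) * (t / of_nat N - of_real pi * (cos (of_real pi * (of_nat N / t)) / sin (of_real pi * (of_nat N / t))))
      = (\<Sum>n\<in>{- int N..<int N}. LL n)"
    using eventually_gt_at_top[of 0] by eventually_elim (use LL_partial_sum infsum_tt in auto)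
qed

definition PP :: "int \<Rightarrow> complex" where "PP n = infsum (\<lambda>m. 1 / (of_int m * t + of_int n)\<^sup>2) (- {0})"

text \<open>With s = -1/t one has m t + n = -t (n s - m), so a full column n \<noteq> 0 at t is t^-2
  times row n at s. Columns omit m = 0, which costs 1/n^2 for n \<noteq> 0 and \<open>E2c\<close> in
  total; column n = 0 supplies the constant \<open>E2c\<close> of \<open>G2\<close> at s, times
  t^-2.\<close>

lemma PP_has_sum: "(PP has_sum ((1 / t\<^sup>2) * G2 (- 1 / t) - E2c)) UNIV"
proof -
  let ?s = "- 1 / t"
  have t0: "t \<noteq> 0" using t by auto
  have s: "0 < Im ?s" using t by (simp add: Im_divide divide_simps sum_power2_gt_zero_iff)
  have P0: "PP 0 = (1 / t\<^sup>2) * E2c"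
    unfolding PP_def E2c_def by (subst infsum_cmult_right'[symmetric]) (simp add: power_mult_distrib mult.commute)
  have Pn: "PP n = (1 / t\<^sup>2) * Aser ?s n - 1 / (of_int n)\<^sup>2" if n: "n \<noteq> 0" for n
  proof -
    have e: "1 / (of_int m * t + of_int n)\<^sup>2 = (1 / t\<^sup>2) * (1 / (of_int n * ?s + of_int (- m))\<^sup>2)" for m
    proof -
      have "of_int m * t + of_int n = - t * (of_int n * ?s + of_int (- m))" using t0 by (simp add: field_simps)
      then show ?thesis by (simp add: power_mult_distrib)
    qed
    have "infsum (\<lambda>m. 1 / (of_int m * t + of_int n)\<^sup>2) UNIV = (1 / t\<^sup>2) * infsum (\<lambda>m. 1 / (of_int n * ?s + of_int (- m))\<^sup>2) UNIV"
      unfolding e by (rule infsum_cmult_right')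
    also have "infsum (\<lambda>m. 1 / (of_int n * ?s + of_int (- m))\<^sup>2) UNIV = infsum (\<lambda>m. 1 / (of_int n * ?s + of_int m)\<^sup>2) UNIV"
      by (rule infsum_reindex_bij_witness[of _ uminus uminus]) auto
    also have "\<dots> = Aser ?s n" by (rule Aser_eq[OF s n])
    finally have 1: "infsum (\<lambda>m. 1 / (of_int m * t + of_int n)\<^sup>2) UNIV = (1 / t\<^sup>2) * Aser ?s n" .
    have "infsum (\<lambda>m. 1 / (of_int m * t + of_int n)\<^sup>2) (insert 0 (- {0})) = 1 / (of_int 0 * t + of_int n)\<^sup>2 + PP n"
      unfolding PP_def by (rule infsum_insert) (use summable_sq_m[OF t] in auto)
    moreover have "insert 0 (- {0}) = (UNIV :: int set)" by auto
    ultimately show ?thesis using 1 by simp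
  qed
  have "((\<lambda>n. (1 / t\<^sup>2) * Aser ?s n - 1 / (of_int n)\<^sup>2) has_sum ((1 / t\<^sup>2) * infsum (Aser ?s) (- {0}) - E2c)) (- {0})"
    unfolding E2c_def
    by (intro has_sum_diff_complex has_sum_cmult_right has_sum_infsum Aser_summable[OF s] E2c_summable)
  then have "(PP has_sum ((1 / t\<^sup>2) * infsum (Aser ?s) (- {0}) - E2c)) (- {0})"
    by (rule has_sum_cong[THEN iffD1, rotated]) (simp add: Pn)
  then have "(PP has_sum (PP 0 + ((1 / t\<^sup>2) * infsum (Aser ?s) (- {0}) - E2c))) (insert 0 (- {0}))"
    by (intro has_sum_insert) auto
  moreover have "insert 0 (- {0}) = (UNIV :: int set)" by auto
  moreover have "PP 0 + ((1 / t\<^sup>2) * infsum (Aser ?s) (- {0}) - E2c) = (1 / t\<^sup>2) * G2 ?s - E2c"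
    by (simp add: P0 G2_def algebra_simps)
  ultimately show ?thesis by metis
qed

text \<open>Rows of inverse squares reduce to rows of \<open>KK\<close>, columns to columns of
  \<open>KK\<close> plus \<open>LL\<close>. The double series of \<open>KK\<close> may be exchanged,
  so the two orders of summation differ by the sum of \<open>LL\<close>.\<close>

lemma G2_inversion: "G2 (- 1 / t) = t\<^sup>2 * G2 t - 2 * of_real pi * \<i> * t"
proof -
  have t0: "t \<noteq> 0" using t by auto
  have sKm: "(\<lambda>m. KK t m n) summable_on (- {0})" and PL: "PP n = infsum (\<lambda>m. KK t m n) (- {0}) + LL n" for n
  proof -
    have "(\<lambda>m. 1 / (of_int m * t + of_int n)\<^sup>2 - TT t m n) summable_on (- {0})"
      by (intro summable_on_diff_complex summable_sq_m[OF t] summable_TT_m[OF t])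
    then show *: "(\<lambda>m. KK t m n) summable_on (- {0})"
      by (rule summable_on_cong[THEN iffD1, rotated]) (use KK_eq[OF t] in auto)
    have "PP n = infsum (\<lambda>m. KK t m n + TT t m n) (- {0})"
      unfolding PP_def by (rule infsum_cong) (use KK_eq[OF t] in auto)
    then show "PP n = infsum (\<lambda>m. KK t m n) (- {0}) + LL n"
      unfolding LL_def using * summable_TT_m[OF t] by (simp add: infsum_add)
  qed
  have A: "Aser t m = infsum (KK t m) UNIV" if m: "m \<noteq> 0" for m
  proof -
    have "(\<lambda>n. 1 / (of_int m * t + of_int n)\<^sup>2 - TT t m n) summable_on UNIV"
      by (intro summable_on_diff_complex summable_sq_n[OF t m] summable_TT_n[OF t m])
    then have s: "KK t m summable_on UNIV"
      by (rule summable_on_cong[THEN iffD1, rotated]) (use KK_eq[OF t m] in auto)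
    have "Aser t m = infsum (\<lambda>n. KK t m n + TT t m n) UNIV"
      unfolding Aser_eq[OF t m, symmetric] by (rule infsum_cong) (use KK_eq[OF t m] in auto)
    also have "\<dots> = infsum (KK t m) UNIV + infsum (TT t m) UNIV"
      by (rule infsum_add[OF s summable_TT_n[OF t m]])
    finally show ?thesis by (simp add: infsum_TT_n[OF t m])
  qed
  have "infsum (Aser t) (- {0}) = infsum (\<lambda>m. infsum (KK t m) UNIV) (- {0})"
    by (rule infsum_cong) (use A in auto)
  also have "\<dots> = infsum (\<lambda>n. infsum (\<lambda>m. KK t m n) (- {0})) UNIV"
    by (rule infsum_swap_banach[OF summable_KK[OF t]])
  finally have swap: "infsum (Aser t) (- {0}) = infsum (\<lambda>n. infsum (\<lambda>m. KK t m n) (- {0})) UNIV" .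
  have "(\<lambda>(n, m). KK t m n) summable_on (UNIV \<times> (- {0}))"
    using summable_KK[OF t] summable_on_swap[of "\<lambda>(m, n). KK t m n" "- {0}" UNIV] by (simp add: case_prod_unfold)
  then have sK: "(\<lambda>n. infsum (\<lambda>m. KK t m n) (- {0})) summable_on UNIV"
    by (rule summable_on_Sigma_banach)
  have "((\<lambda>n. PP n - infsum (\<lambda>m. KK t m n) (- {0})) has_sum
      ((1 / t\<^sup>2) * G2 (- 1 / t) - E2c - infsum (Aser t) (- {0}))) UNIV"
    unfolding swap by (intro has_sum_diff_complex PP_has_sum has_sum_infsum sK)
  moreover have "(\<lambda>n. PP n - infsum (\<lambda>m. KK t m n) (- {0})) = LL" by (simp add: PL fun_eq_iff)
  ultimately have L: "(LL has_sum ((1 / t\<^sup>2) * G2 (- 1 / t) - G2 t)) UNIV" by (simp add: G2_def algebra_simps)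
  then have "LL summable_on UNIV" "infsum LL UNIV = (1 / t\<^sup>2) * G2 (- 1 / t) - G2 t"
    by (auto simp: has_sum_imp_summable infsumI)
  with infsum_int_limit[of LL] have "(\<lambda>N. \<Sum>n\<in>{- int N..<int N}. LL n) \<longlonglongrightarrow> (1 / t\<^sup>2) * G2 (- 1 / t) - G2 t" by simp
  with LL_limit have "(1 / t\<^sup>2) * G2 (- 1 / t) - G2 t = - (2 * of_real pi * \<i> / t)"
    using LIMSEQ_unique by blast
  then have eq: "(1 / t\<^sup>2) * G2 (- 1 / t) = G2 t - 2 * of_real pi * \<i> / t" by (simp add: algebra_simps)
  have "G2 (- 1 / t) = t\<^sup>2 * ((1 / t\<^sup>2) * G2 (- 1 / t))" using t0 by simp
  also have "\<dots> = t\<^sup>2 * G2 t - 2 * of_real pi * \<i> * t"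
    unfolding eq using t0 by (simp add: algebra_simps power2_eq_square)
  finally show ?thesis .
qed

end

lemma G2_term_bound: "0 < e \<Longrightarrow> e \<le> Im t \<Longrightarrow> cmod (Aser t (int (Suc k))) \<le> (1 / e\<^sup>2) * (1 / (real (Suc k))\<^sup>2)"
  using Aser_bound[of e t "int (Suc k)"] by simp

lemma G2_majorant_summable: "summable (\<lambda>k. (1 / e\<^sup>2) * (1 / (real (Suc k))\<^sup>2))"
  using inverse_squares_sums by (intro summable_mult) (auto simp: sums_iff add.commute)

lemma G2_holomorphic: "G2 holomorphic_on UHP"
proof -
  let ?f = "\<lambda>n t. \<Sum>k<n. Aser t (int (Suc k))" and ?g = "\<lambda>t. suminf (\<lambda>k. Aser t (int (Suc k)))"
  have "?g holomorphic_on UHP"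
  proof (rule holomorphic_uniform_sequence[OF open_UHP])
    show "?f n holomorphic_on UHP" for n
      unfolding Aser_def by (intro holomorphic_intros) (auto simp: UHP_def intro!: sin_pi_nonzero)
    fix x assume "x \<in> UHP"
    then have x: "0 < Im x" by (simp add: UHP_def)
    have im: "Im x / 2 \<le> Im w" if "w \<in> cball x (Im x / 2)" for w
      using that abs_Im_le_cmod[of "x - w"] by (auto simp: dist_norm)
    show "\<exists>d. 0 < d \<and> cball x d \<subseteq> UHP \<and> uniform_limit (cball x d) ?f ?g sequentially"
    proof (intro exI[of _ "Im x / 2"] conjI)
      show "cball x (Im x / 2) \<subseteq> UHP" using im x by (force simp: UHP_def)
      show "uniform_limit (cball x (Im x / 2)) ?f ?g sequentially"
        by (rule Weierstrass_m_test[OF G2_term_bound[of "Im x / 2"] G2_majorant_summable]) (use x im in auto)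
    qed (use x in simp)
  qed
  then have "(\<lambda>t. E2c + 2 * ?g t) holomorphic_on UHP" by (intro holomorphic_intros)
  then show ?thesis
    by (rule holomorphic_transform) (simp add: G2_suminf UHP_def)
qed

text \<open>Division by pi i turns the term -2 pi i t of \<open>G2_inversion\<close> into -2t, the
  normalisation under which a solution of p' = \<psi> p has weight exactly -2.\<close>

definition hpsi :: hol where "hpsi = hmask (\<lambda>t. G2 t / (of_real pi * \<i>))"

lemma hfun_hpsi: "0 < Im t \<Longrightarrow> hfun hpsi t = G2 t / (of_real pi * \<i>)"
  unfolding hpsi_def
  by (subst hfun_hmask) (auto intro!: holomorphic_intros G2_holomorphic simp: mask_def)

lemma hpsi_bnd: "bnd hpsi"
  unfolding bnd_def
proof (intro allI impI)
  fix e :: real assume e: "0 < e"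
  let ?M = "\<lambda>k. (1 / e\<^sup>2) * (1 / (real (Suc k))\<^sup>2)"
  have "cmod (hfun hpsi t) \<le> (cmod E2c + 2 * suminf ?M) / pi" if "e \<le> Im t" for t
  proof -
    have "cmod (suminf (\<lambda>k. Aser t (int (Suc k)))) \<le> suminf ?M"
      by (rule norm_suminf_le[OF G2_term_bound[OF e that] G2_majorant_summable])
    then have "cmod (G2 t) \<le> cmod E2c + 2 * suminf ?M"
      using norm_triangle_ineq[of E2c "2 * suminf (\<lambda>k. Aser t (int (Suc k)))"] e that
      by (simp add: G2_suminf norm_mult)
    then show ?thesis using e that by (simp add: hfun_hpsi norm_divide norm_mult divide_right_mono)
  qed
  then show "\<exists>C. \<forall>z. e \<le> Im z \<longrightarrow> cmod (hfun hpsi z) \<le> C" by blast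
qed

lemma hpsi_translate: "0 < Im z \<Longrightarrow> hfun hpsi (z + of_int n) = hfun hpsi z"
proof (induction n rule: int_induct[where k = 0])
  case (step1 i)
  then show ?case using G2_translate[of "z + of_int i"] by (simp add: hfun_hpsi add.assoc)
next
  case (step2 i)
  then show ?case using G2_translate[of "z + of_int (i - 1)"] by (simp add: hfun_hpsi add.assoc)
qed simp

lemma Im_minus_inverse: "0 < Im z \<Longrightarrow> 0 < Im (- 1 / z)"
  by (simp add: Im_divide divide_simps sum_power2_gt_zero_iff)

lemma hpsi_inversion: "0 < Im z \<Longrightarrow> hfun hpsi (- 1 / z) = z\<^sup>2 * hfun hpsi z - 2 * z"
proof -
  assume z: "0 < Im z"
  show ?thesis
    unfolding hfun_hpsi[OF Im_minus_inverse[OF z]] hfun_hpsi[OF z] G2_inversion[OF z] by (simp add: diff_divide_distrib)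
qed

text \<open>Induction on \<open>|c|\<close>: division with remainder \<open>a = q c + r\<close> gives \<open>g z = q - 1 / g' z\<close> where
  \<open>g'\<close> has lower left entry \<open>r\<close>.\<close>

lemma hpsi_transform:
  "g \<in> SL2Z \<Longrightarrow> 0 < Im z \<Longrightarrow> hfun hpsi (mob g z) = (jfac g z)\<^sup>2 * hfun hpsi z - 2 * of_int (lowleft g) * jfac g z"
proof (induction "nat \<bar>lowleft g\<bar>" arbitrary: g rule: less_induct)
  case less
  obtain a b c d where g: "g = (a, b, c, d)" by (cases g)
  have det: "a * d - b * c = 1" using less.prems by (simp add: SL2Z_def g)
  show ?case
  proof (cases "c = 0")
    case True
    then have "a * d = 1" using det by simp
    then have ad: "a = d" "d = 1 \<or> d = - 1" by (auto simp: zmult_eq_1_iff)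
    then have "mob g z = z + of_int (b * d)" "(jfac g z)\<^sup>2 = 1" "lowleft g = 0"
      using True by (auto simp: g mob_def jfac_def lowleft_def)
    then show ?thesis using hpsi_translate[OF less.prems(2), of "b * d"] by simp
  next
    case False
    define q r where "q = a div c" and "r = a mod c"
    define b' where "b' = b - q * d"
    have a: "a = q * c + r" by (simp add: q_def r_def)
    have r: "\<bar>r\<bar> < \<bar>c\<bar>" using False by (simp add: r_def abs_mod_less)
    have det': "r * d - b' * c = 1" using det by (simp add: a b'_def algebra_simps)
    define g' where "g' = (- c, - d, r, b')"
    have g': "g' \<in> SL2Z" using det' by (simp add: SL2Z_def g'_def algebra_simps)
    define j j' w where "j = jfac g z" and "j' = jfac g' z" and "w = mob g' z"
    have nz: "j \<noteq> 0" "j' \<noteq> 0" using jfac_nonzero[OF less.prems] jfac_nonzero[OF g' less.prems(2)] by (auto simp: j_def j'_def)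
    have jj: "j = of_int c * z + of_int d" "j' = of_int r * z + of_int b'"
      by (auto simp: j_def j'_def jfac_def g g'_def)
    have w: "w = - j / j'"
      by (simp add: w_def mob_def g'_def jj minus_divide_left)
    have imw: "0 < Im w" using mob_UHP[OF g' less.prems(2)] by (simp add: w_def)
    have c1: "of_int r * j - 1 = of_int c * j'"
    proof -
      have "of_int (r * d - b' * c) = (1 :: complex)" using det' by simp
      then show ?thesis unfolding jj by (simp add: algebra_simps)
    qed
    have "mob g z = - 1 / w + of_int q"
    proof -
      have "of_int a * z + of_int b = j' + of_int q * j" by (simp add: jj a b'_def algebra_simps)
      then have "mob g z = (j' + of_int q * j) / j" by (simp add: mob_def g jj)
      also have "\<dots> = - 1 / w + of_int q" using nz by (simp add: w field_simps)
      finally show ?thesis .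
    qed
    then have "hfun hpsi (mob g z) = w\<^sup>2 * hfun hpsi w - 2 * w"
      using hpsi_translate[OF Im_minus_inverse[OF imw], of q] hpsi_inversion[OF imw] by simp
    also have "hfun hpsi w = j'\<^sup>2 * hfun hpsi z - 2 * of_int r * j'"
      using less.hyps[OF _ g' less.prems(2)] r by (simp add: w_def j'_def g lowleft_def g'_def)
    also have "w\<^sup>2 * (j'\<^sup>2 * hfun hpsi z - 2 * of_int r * j') - 2 * w = (w * j')\<^sup>2 * hfun hpsi z - 2 * w * (of_int r * (w * j') + 1)"
      by (simp add: power2_eq_square algebra_simps)
    also have "w * j' = - j" using nz by (simp add: w)
    also have "(- j)\<^sup>2 * hfun hpsi z - 2 * w * (of_int r * - j + 1) = j\<^sup>2 * hfun hpsi z + 2 * w * (of_int r * j - 1)"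
      by (simp add: algebra_simps)
    also have "2 * w * (of_int r * j - 1) = - 2 * of_int c * j" unfolding c1 using nz by (simp add: w)
    finally show ?thesis by (simp add: j_def g lowleft_def)
  qed
qed

lemma hcomp_hpsi: "g \<in> SL2Z \<Longrightarrow> hcomp g hpsi = hj g * hj g * hpsi - 2 * hc g * hj g"
proof (rule hol_eqI)
  fix z :: complex assume g: "g \<in> SL2Z" and z: "0 < Im z"
  have two: "hfun 2 z = 2" using hfun_of_nat[of 2 z] z by simp
  show "hfun (hcomp g hpsi) z = hfun (hj g * hj g * hpsi - 2 * hc g * hj g) z"
    using hpsi_transform[OF g z] z
    by (simp add: hfun_hcomp[OF g] hfun_hj hc_def hfun_hconst two power2_eq_square)
qed

lemma hD_zero_const:
  assumes "hD u = 0" shows "\<exists>c. u = hconst c"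
proof -
  have "\<exists>c. \<forall>x\<in>UHP. hfun u x = c"
    by (rule has_field_derivative_zero_constant[OF convex_UHP])
       (use hfun_has_derivative[of _ u] assms in \<open>auto simp: UHP_def intro: has_field_derivative_at_within\<close>)
  then obtain c where "\<And>x. 0 < Im x \<Longrightarrow> hfun u x = c" by (auto simp: UHP_def)
  then show ?thesis by (intro exI[of _ c] hol_eqI) (simp add: hfun_hconst)
qed

text \<open>With j = c\<tau> + d, the quotient of hh times the composite of p with g by p has
  logarithmic derivative 2c/j + (\<psi> - 2c/j) - \<psi> = 0, by the transformation law of
  \<open>hpsi\<close>; so it is constant. The function p is the exponential of a primitive, hence
  nowhere zero.\<close>

lemma automorphy_root:
  obtains p q where "p * q = 1" "hD p = hpsi * p"
    "\<And>g. g \<in> SL2Z \<Longrightarrow> \<exists>c. c \<noteq> 0 \<and> hh g * hcomp g p = hconst c * p"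
proof -
  obtain \<Phi> where "\<And>w. w \<in> UHP \<Longrightarrow> (\<Phi> has_field_derivative hfun hpsi w) (at w within UHP)"
    using holomorphic_convex_primitive'[OF convex_UHP open_UHP hfun_holomorphic] by blast
  then have \<Phi>: "(\<Phi> has_field_derivative hfun hpsi w) (at w)" if "0 < Im w" for w
    using that at_within_open[OF _ open_UHP] by (metis UHP_def mem_Collect_eq)
  have hol: "\<Phi> holomorphic_on UHP" by (rule holomorphic_UHPI[OF \<Phi>])
  define p q where "p = hmask (\<lambda>z. exp (\<Phi> z))" and "q = hmask (\<lambda>z. exp (- \<Phi> z))"
  have p: "hfun p z = exp (\<Phi> z)" and q: "hfun q z = exp (- \<Phi> z)" if "0 < Im z" for z
    using that unfolding p_def q_def
    by (subst hfun_hmask; auto intro!: holomorphic_intros hol simp: mask_def)+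
  have pq: "p * q = 1" by (rule hol_eqI) (simp add: p q hfun_one flip: exp_add)
  have hDp: "hD p = hpsi * p"
    by (rule hD_eqI, rule has_field_derivative_UHP_cong[of "\<lambda>z. exp (\<Phi> z)"])
       (auto simp: p intro!: derivative_eq_intros \<Phi>)
  have "\<exists>c. c \<noteq> 0 \<and> hh g * hcomp g p = hconst c * p" if g: "g \<in> SL2Z" for g
  proof -
    let ?J = "hj g" and ?I = "hji g"
    let ?u = "hh g * hcomp g p * q"
    have JI: "?J * ?I = 1" by (rule hj_hji[OF g])
    have "hD ?u = hD (hh g) * hcomp g p * q + hh g * hD (hcomp g p) * q + hh g * hcomp g p * hD q"
      by (simp add: hD_mult algebra_simps)
    also have "\<dots> = 0"
    proof (rule hol_eqI)
      fix z :: complex assume z: "0 < Im z"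
      have two: "hfun 2 z = 2" using hfun_of_nat[of 2 z] z by simp
      show "hfun (hD (hh g) * hcomp g p * q + hh g * hD (hcomp g p) * q + hh g * hcomp g p * hD q) z = hfun 0 z"
        unfolding hD_hh[OF g] hD_hcomp[OF g] hDp hDq[OF pq hDp] hcomp_simps[OF g] hcomp_hpsi[OF g]
        unfolding hh_def[OF g] using z jfac_nonzero[OF g z]
        by (simp add: hfun_hcomp[OF g] hfun_hj hfun_hji[OF g] hc_def hfun_hconst two field_simps)
    qed
    finally obtain c where c: "?u = hconst c" using hD_zero_const by blast
    have "hh g * hcomp g p = ?u * p" using pq by (simp add: mult.assoc mult.commute[of q])
    with c have 1: "hh g * hcomp g p = hconst c * p" by simp
    have "c \<noteq> 0"
    proof
      assume "c = 0"
      then have "hfun (hh g * hcomp g p) \<i> = 0" using 1 by simp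
      then show False
        using jfac_nonzero[OF g, of \<i>] mob_UHP[OF g, of \<i>] by (simp add: hh_def[OF g] hfun_hj hfun_hcomp[OF g] p)
    qed
    with 1 show ?thesis by blast
  qed
  with pq hDp that show ?thesis by blast
qed

subsection \<open>The order on partition pairs\<close>

lemma part_gt_lexord: "part_gt l l' \<longleftrightarrow> (plist l', plist l) \<in> lexord {(a, b). a < b}"
  unfolding part_gt_def part_gt_list_def lexord_take_index_conv
  by (auto simp: min.commute)

lemma part_gt_irrefl: "\<not> part_gt l l"
  unfolding part_gt_lexord by (rule lexord_irreflexive) simp

lemma part_gt_trans: "part_gt l l' \<Longrightarrow> part_gt l' l'' \<Longrightarrow> part_gt l l''"
  unfolding part_gt_lexord by (erule lexord_trans) (auto simp: trans_def)

lemma pp_gt_irrefl: "\<not> pp_gt k k"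
  by (simp add: pp_gt_def part_gt_irrefl)

lemma pp_gt_trans: "pp_gt k k' \<Longrightarrow> pp_gt k' k'' \<Longrightarrow> pp_gt k k''"
  unfolding pp_gt_def by (elim disjE) (auto intro: part_gt_trans simp: lval_def)

lemma pp_le_gt_trans: "pp_gt k k' \<Longrightarrow> pp_le k'' k' \<Longrightarrow> pp_gt k k''"
  using pp_gt_trans unfolding pp_le_def by blast

lemma pp_le_lval: "pp_le k k' \<Longrightarrow> lval k \<le> lval k'"
  by (auto simp: pp_le_def pp_gt_def lval_def)

lemma Vfilt_mono:
  assumes "pp_gt k0 k1" "weight k1 = weight k0"
  shows "Vfilt k1 \<subseteq> Vfilt k0"
  using pp_le_gt_trans[OF assms(1)] assms(2) by (auto simp: Vfilt_def pp_le_def)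

subsection \<open>Slash action and growth at the cusps\<close>

lemma hfun_leading_factor:
  assumes g: "g \<in> SL2Z" and z: "0 < Im z"
  shows "hfun (hh g ^ a * hD (hmb g) ^ b * hcomp g f) z = jfac g z powi (- (2 * (int b - int a))) * hfun f (mob g z)"
proof -
  let ?j = "jfac g z"
  have j: "?j \<noteq> 0" using jfac_nonzero[OF g z] .
  have "hfun (hh g) z = ?j\<^sup>2" using z by (simp add: hh_def[OF g] hfun_hj power2_eq_square)
  moreover have "hfun (hD (hmb g)) z = (1 / ?j)\<^sup>2"
    using z by (simp add: hmb_def[OF g] hD_hcomp[OF g] hcomp_simps[OF g] hfun_hji[OF g] power2_eq_square)
  moreover have "?j powi (- (2 * (int b - int a))) = (?j\<^sup>2) ^ a * ((1 / ?j)\<^sup>2) ^ b"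
  proof -
    have "?j powi (- (2 * (int b - int a))) = ?j powi (int (2 * a) - int (2 * b))" by simp
    also have "\<dots> = ?j ^ (2 * a) / ?j ^ (2 * b)" using j power_int_diff[of ?j "int (2 * a)" "int (2 * b)"] by (simp only: power_int_of_nat simp_thms)
    finally show ?thesis by (simp add: power_mult power_one_over)
  qed
  ultimately show ?thesis using z by (simp add: hfun_power hfun_hcomp[OF g])
qed

lemma powi_cancel:
  fixes x :: complex assumes "x \<noteq> 0"
  shows "x powi k * (x powi (- k) * u) = u" "x powi (- k) * (x powi k * u) = u"
  using assms by (simp_all add: power_int_minus)

lemma slash_eq_hfun:
  assumes g: "g \<in> SL2Z"
  shows "slash (2 * (int b - int a)) g (hfun f) = hfun (hh g ^ a * hD (hmb g) ^ b * hcomp g f)"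
proof
  fix z
  show "slash (2 * (int b - int a)) g (hfun f) z = hfun (hh g ^ a * hD (hmb g) ^ b * hcomp g f) z"
    unfolding slash_def mask_def
    using hfun_leading_factor[OF g, of z a b f] by (cases "0 < Im z") (simp_all add: hfun_off del: hfun_simps)
qed

lemma slash_periodic:
  assumes G: "congruence_subgroup G" and f: "f \<in> modular_forms k G" and r: "r \<in> SL2Z"
  shows "\<exists>N::nat. 0 < N \<and> (\<forall>z. 0 < Im z \<longrightarrow> slash k r f (z + of_nat N) = slash k r f z)"
proof -
  obtain M :: int where M: "0 < M" "principal_congruence M \<subseteq> G" using G by (auto simp: congruence_subgroup_def)
  define N where "N = nat M"
  have N: "0 < N" "int N = M" using M by (auto simp: N_def)
  obtain a b c d where r_eq: "r = (a, b, c, d)" by (cases r)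
  have det: "a * d - b * c = 1" using r by (simp add: SL2Z_def r_eq)
  then have detc: "of_int a * of_int d - of_int b * of_int c = (1 :: complex)" by (metis of_int_1 of_int_diff of_int_mult)
  \<comment> \<open>This is r T r^-1 with T the translation by M; its entries differ from those of
    the identity by multiples of M. Invariance under it becomes M-periodicity of the slashed
    form.\<close>
  define g where "g = (1 - a * c * M, a * a * M, - (c * c * M), 1 + a * c * M)"
  have "g \<in> SL2Z" by (simp add: SL2Z_def g_def algebra_simps)
  then have "g \<in> principal_congruence M"
    by (simp add: principal_congruence_def g_def mod_eq_dvd_iff)
  then have gG: "g \<in> G" and gS: "g \<in> SL2Z" using M by (auto simp: principal_congruence_def)
  have "slash k r f (z + of_nat N) = slash k r f z" if z: "0 < Im z" for z
  proof -
    let ?j = "jfac r z" and ?w = "mob r z"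
    have M': "of_int M = (of_nat N :: complex)" using N by (metis of_int_of_nat_eq)
    have j: "?j \<noteq> 0" "jfac r (z + of_nat N) \<noteq> 0" using jfac_nonzero[OF r, of z] jfac_nonzero[OF r, of "z + of_nat N"] z by auto
    have w: "0 < Im ?w" using mob_UHP[OF r z] .
    have wj: "?w * ?j = of_int a * z + of_int b" using j by (simp add: mob_def jfac_def r_eq)
    have jg_eq: "jfac g u = - of_int (c * c * M) * u + of_int (1 + a * c * M)" for u
      by (simp add: jfac_def g_def)
    have jg: "jfac g ?w * ?j = jfac r (z + of_nat N)"
    proof -
      have "jfac g ?w * ?j = - of_int (c * c * M) * (?w * ?j) + of_int (1 + a * c * M) * ?j"
        unfolding jg_eq by (simp only: distrib_right mult.assoc)
      also have "\<dots> = ?j + of_nat N * of_int c * (of_int a * of_int d - of_int b * of_int c)"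
        unfolding wj by (simp add: jfac_def r_eq M' algebra_simps)
      finally show ?thesis unfolding detc by (simp add: jfac_def r_eq algebra_simps)
    qed
    have mg: "mob g ?w = mob r (z + of_nat N)"
    proof -
      have "(of_int (1 - a * c * M) * ?w + of_int (a * a * M)) * ?j = of_int (1 - a * c * M) * (?w * ?j) + of_int (a * a * M) * ?j"
        by (simp add: algebra_simps)
      also have "\<dots> = of_int a * z + of_int b + of_nat N * of_int a * (of_int a * of_int d - of_int b * of_int c)"
        unfolding wj by (simp add: jfac_def r_eq M' algebra_simps)
      finally have num: "(of_int (1 - a * c * M) * ?w + of_int (a * a * M)) * ?j = of_int a * (z + of_nat N) + of_int b"
        unfolding detc by (simp add: algebra_simps)
      have "mob g ?w = (of_int (1 - a * c * M) * ?w + of_int (a * a * M)) / jfac g ?w"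
        by (simp add: mob_def g_def jfac_def)
      also have "\<dots> = ((of_int (1 - a * c * M) * ?w + of_int (a * a * M)) * ?j) / (jfac g ?w * ?j)"
        using j by simp
      also have "\<dots> = mob r (z + of_nat N)" unfolding num jg by (simp add: mob_def r_eq jfac_def)
      finally show ?thesis .
    qed
    have "f (mob g ?w) = jfac g ?w powi k * f ?w" using f gG w by (auto simp: modular_forms_def)
    then have "f (mob r (z + of_nat N)) = jfac g ?w powi k * f ?w" by (simp add: mg)
    moreover have "jfac r (z + of_nat N) powi (- k) * jfac g ?w powi k = ?j powi (- k)"
    proof -
      have g0: "jfac g ?w \<noteq> 0" using jfac_nonzero[OF gS w] .
      have "jfac r (z + of_nat N) powi (- k) = jfac g ?w powi (- k) * ?j powi (- k)"
        unfolding jg[symmetric] by (rule power_int_mult_distrib)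
      then show ?thesis using g0 by (simp add: power_int_minus)
    qed
    ultimately show ?thesis using z by (simp add: slash_def mask_def mult.assoc[symmetric])
  qed
  with N show ?thesis by blast
qed

lemma bnd_hol_at_infty: "bnd f \<Longrightarrow> hol_at_infty (hfun f)"
proof -
  assume "bnd f"
  then obtain C where "\<And>z. 1 \<le> Im z \<Longrightarrow> cmod (hfun f z) \<le> C" unfolding bnd_def by (meson zero_less_one)
  then show ?thesis by (rule hol_at_inftyI[OF hfun_holomorphic])
qed

text \<open>Turns the cusp condition at \<open>r\<close> into boundedness of the slashed form on
  every half plane, the input of \<open>lift_bnd\<close>.\<close>

lemma slash_bnd:
  assumes G: "congruence_subgroup G" and f: "hfun f \<in> modular_forms (2 * (int b - int a)) G" and r: "r \<in> SL2Z"
  shows "bnd (hh r ^ a * hD (hmb r) ^ b * hcomp r f)"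
  unfolding bnd_def
proof (intro allI impI)
  fix e :: real assume e: "0 < e"
  obtain N :: nat where N: "0 < N" "\<forall>z. 0 < Im z \<longrightarrow> slash (2 * (int b - int a)) r (hfun f) (z + of_nat N) = slash (2 * (int b - int a)) r (hfun f) z"
    using slash_periodic[OF G f r] by blast
  have "hol_at_infty (slash (2 * (int b - int a)) r (hfun f))"
    using f r unfolding modular_forms_def by blast
  then show "\<exists>C. \<forall>z. e \<le> Im z \<longrightarrow> cmod (hfun (hh r ^ a * hD (hmb r) ^ b * hcomp r f) z) \<le> C"
    using N(2) unfolding slash_eq_hfun[OF r]
    by (intro periodic_bounded[OF hfun_holomorphic N(1) _ _ e]) blast+
qed

section \<open>Exactness of the sequence\<close>

lemma Vfilt_supp:
  assumes "to_cdo V \<in> Vfilt k0" "k \<in> supp V"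
  shows "pp_le k k0" "weight k = weight k0"
proof -
  have "to_cdo V k \<noteq> 0" using assms(2) by (simp add: supp_def to_cdo_def)
  then show "pp_le k k0" "weight k = weight k0" using assms(1) unfolding Vfilt_def by blast+
qed

text \<open>Inside \<open>Vfilt\<close> the pair (l0, m0) has maximal \<open>lval\<close>, so by
  \<open>Pi_leading_coefficient\<close> its coefficient transforms by the slash action alone.
  Invariance and the cusp conditions of the vector then pass to it.\<close>

lemma leading_coefficient_modular:
  assumes G: "congruence_subgroup G" and l: "is_partition l0" and m: "is_partition m0"
    and v: "v \<in> Vinv0 G (l0, m0)"
  shows "v (l0, m0) \<in> modular_forms (2 * (int (size m0) - int (size l0))) G"
proof -
  let ?k = "2 * (int (size m0) - int (size l0))"
  have vF: "v \<in> Vfilt (l0, m0)" and inv: "\<And>g. g \<in> G \<Longrightarrow> piact g v = v"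
    and cusp: "\<And>r k. r \<in> SL2Z \<Longrightarrow> hol_at_infty (piact r v k)"
    using v by (auto simp: Vinv0_def)
  have "cdo_elem v" using vF by (simp add: Vfilt_def)
  then obtain V where V: "v = to_cdo V" by (rule cdo_elem_imp_to_cdo)
  define F where "F = cf V (l0, m0)"
  have lv: "lval k \<le> lval (l0, m0)" if "k \<in> supp V" for k
    using Vfilt_supp[of V "(l0, m0)" k] vF that pp_le_lval by (simp add: V)
  have act: "piact g v (l0, m0) = slash ?k g (hfun F)" if g: "g \<in> SL2Z" for g
    unfolding slash_eq_hfun[OF g] V piact_to_cdo[OF g] F_def
    by (simp add: to_cdo_def Pi_leading_coefficient[OF g l m lv] del: hfun_simps)
  have vk: "v (l0, m0) = hfun F" by (simp add: V to_cdo_def F_def)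
  have "hfun F (mob g z) = jfac g z powi ?k * hfun F z" if g: "g \<in> G" and z: "0 < Im z" for g z
  proof -
    have gS: "g \<in> SL2Z" using g G by (auto simp: congruence_subgroup_def)
    have "hfun F z = slash ?k g (hfun F) z" using act[OF gS] inv[OF g] vk by simp
    then have "hfun F z = jfac g z powi (- ?k) * hfun F (mob g z)" using z by (simp add: slash_def mask_def)
    then show ?thesis using powi_cancel(1)[OF jfac_nonzero[OF gS z], of ?k "hfun F (mob g z)"] by (simp only:)
  qed
  moreover have "hol_at_infty (slash ?k r (hfun F))" if "r \<in> SL2Z" for r
    using cusp[OF that, of "(l0, m0)"] act[OF that] by simp
  ultimately show ?thesis
    unfolding vk modular_forms_def using hfun_holomorphic hfun_off by auto
qed

text \<open>Acting by g on the lift of u gives the lift of the slashed u, for every u and every g in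
  the full modular group. Modularity thus gives invariance, and at a cusp the transformed vector is
  again a lift, now of a bounded function.\<close>

lemma modular_form_lift:
  assumes G: "congruence_subgroup G" and l: "is_partition l0" and m: "is_partition m0"
    and f: "f \<in> modular_forms (2 * (int (size m0) - int (size l0))) G"
  shows "\<exists>v\<in>Vinv0 G (l0, m0). v (l0, m0) = f"
proof -
  let ?k = "2 * (int (size m0) - int (size l0))"
  have "f \<in> {f. f holomorphic_on UHP \<and> (\<forall>z. Im z \<le> 0 \<longrightarrow> f z = 0)}" using f by (auto simp: modular_forms_def)
  from Abs_hol_inverse[OF this] obtain F where F: "f = hfun F" by (metis (full_types))
  obtain p q where pq: "p * q = 1" and hDp: "hD p = hpsi * p"
    and tr: "\<And>g. g \<in> SL2Z \<Longrightarrow> \<exists>c. c \<noteq> 0 \<and> hh g * hcomp g p = hconst c * p"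
    using automorphy_root by blast
  define xs ys where "xs = sorted_list_of_multiset l0" and "ys = sorted_list_of_multiset m0"
  have xy: "mset xs = l0" "mset ys = m0" "length xs = size l0" "length ys = size m0" "0 \<notin> set xs" "0 \<notin> set ys"
    using l m by (auto simp: xs_def ys_def is_partition_def simp flip: size_mset)
  define lft where "lft = lift_form p q hpsi xs ys"
  have act: "pi_op g (lft u) = lft (hh g ^ size l0 * hD (hmb g) ^ size m0 * hcomp g u)" if g: "g \<in> SL2Z" for g u
  proof -
    obtain c where c: "c \<noteq> 0" "hh g * hcomp g p = hconst c * p" using tr[OF g] by blast
    have "hD (hmb g) = hji g * hji g" by (simp add: hmb_def[OF g] hD_hcomp[OF g] hcomp_simps[OF g])
    then show ?thesis
      unfolding lft_def Pi_lift[OF pq hDp g hcomp_hpsi[OF g] c(2) c(1)] xy by (simp add: ac_simps)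
  qed
  have lead: "lead (l0, m0) F (lft F)"
    using lift_lead[OF pq hDp xy(5,6), of F] by (simp add: lft_def xy)
  have hom: "homog (int (weight (l0, m0))) (lft F)"
    using lift_homog[OF pq hDp, of xs ys F] by (simp add: lft_def xy)
  have filt: "to_cdo (lft F) \<in> Vfilt (l0, m0)"
    unfolding Vfilt_def
  proof (intro CollectI conjI allI impI cdo_elem_to_cdo)
    fix k assume "to_cdo (lft F) k \<noteq> 0"
    then have k: "k \<in> supp (lft F)" by (simp add: supp_def to_cdo_def)
    show "pp_le k (l0, m0)"
      using lead_cf(2)[OF lead _ _ k] l m by (auto simp: pp_le_def pp_gt_def)
    show "weight k = weight (l0, m0)" using hom k by (auto simp: homog_def)
  qed
  have inv: "piact g (to_cdo (lft F)) = to_cdo (lft F)" if g: "g \<in> G" for g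
  proof -
    have gS: "g \<in> SL2Z" using g G by (auto simp: congruence_subgroup_def)
    have "hfun (hh g ^ size l0 * hD (hmb g) ^ size m0 * hcomp g F) z = hfun F z" if z: "0 < Im z" for z
    proof -
      have "hfun F (mob g z) = jfac g z powi ?k * hfun F z" using f g z by (auto simp: modular_forms_def F)
      then show ?thesis
        unfolding hfun_leading_factor[OF gS z] using powi_cancel(2)[OF jfac_nonzero[OF gS z], of ?k] by (simp only:)
    qed
    then have "hh g ^ size l0 * hD (hmb g) ^ size m0 * hcomp g F = F" by (rule hol_eqI)
    then show ?thesis by (simp add: piact_to_cdo[OF gS] act[OF gS])
  qed
  have cusp: "hol_at_infty (piact r (to_cdo (lft F)) k)" if r: "r \<in> SL2Z" for r k
  proof -
    have "bnd (hh r ^ size l0 * hD (hmb r) ^ size m0 * hcomp r F)"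
      by (rule slash_bnd[OF G _ r]) (use f in \<open>simp add: F\<close>)
    from lift_bnd[OF pq hDp hpsi_bnd this, of xs ys k] show ?thesis
      unfolding piact_to_cdo[OF r] act[OF r] by (simp add: to_cdo_def bnd_hol_at_infty lft_def)
  qed
  have "to_cdo (lft F) (l0, m0) = f"
    using lead_cf(1)[OF lead] l m by (simp add: to_cdo_def F)
  moreover have "to_cdo (lft F) \<in> Vinv0 G (l0, m0)"
    using filt inv cusp by (simp add: Vinv0_def)
  ultimately show ?thesis by blast
qed

theorem theorem2p5:
  fixes G :: "mat set" and l0 m0 l1 m1 :: "nat multiset"
  assumes "congruence_subgroup G"
    and "is_partition l0" "is_partition m0" "is_partition l1" "is_partition m1"
    and "pp_gt (l0, m0) (l1, m1)" "weight (l1, m1) = weight (l0, m0)"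
    and "\<forall>l m. is_partition l \<and> is_partition m \<and> weight (l, m) = weight (l0, m0)
            \<and> pp_gt (l0, m0) (l, m) \<longrightarrow> pp_le (l, m) (l1, m1)"
  shows "Vinv0 G (l1, m1) \<subseteq> Vinv0 G (l0, m0)
    \<and> (\<forall>v\<in>Vinv0 G (l0, m0). v (l0, m0) \<in> modular_forms (2 * (int (size m0) - int (size l0))) G)
    \<and> {v \<in> Vinv0 G (l0, m0). v (l0, m0) = 0} = Vinv0 G (l1, m1)
    \<and> (\<forall>f\<in>modular_forms (2 * (int (size m0) - int (size l0))) G.
         \<exists>v\<in>Vinv0 G (l0, m0). v (l0, m0) = f)"
proof -
  have sub: "Vinv0 G (l1, m1) \<subseteq> Vinv0 G (l0, m0)"
    using Vfilt_mono[OF assms(6,7)] by (auto simp: Vinv0_def)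
  have "v \<in> Vinv0 G (l1, m1)" if v: "v \<in> Vinv0 G (l0, m0)" "v (l0, m0) = 0" for v
  proof -
    have vF: "cdo_elem v" "\<And>k. v k \<noteq> 0 \<Longrightarrow> pp_le k (l0, m0) \<and> weight k = weight (l0, m0)"
      using v(1) by (auto simp: Vinv0_def Vfilt_def)
    \<comment> \<open>A vanishing top coefficient leaves only pairs strictly below (l0, m0), and
      maximality of (l1, m1) puts these into the smaller filtration step.\<close>
    have "pp_le k (l1, m1)" if "v k \<noteq> 0" for k
    proof -
      have "pp_gt (l0, m0) k" using vF(2)[OF that] v(2) that by (auto simp: pp_le_def)
      moreover have "is_partition (fst k)" "is_partition (snd k)"
        using vF(1) that unfolding cdo_elem_def by blast+
      ultimately show ?thesis using assms(8)[rule_format, of "fst k" "snd k"] vF(2)[OF that] by simp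
    qed
    then have "v \<in> Vfilt (l1, m1)" using vF assms(7) by (simp add: Vfilt_def)
    then show ?thesis using v(1) by (auto simp: Vinv0_def)
  qed
  moreover have "v (l0, m0) = 0" if "v \<in> Vinv0 G (l1, m1)" for v
  proof (rule ccontr)
    assume "v (l0, m0) \<noteq> 0"
    then have "pp_le (l0, m0) (l1, m1)" using that by (auto simp: Vinv0_def Vfilt_def)
    then show False using pp_le_gt_trans[OF assms(6)] pp_gt_irrefl by blast
  qed
  ultimately have "{v \<in> Vinv0 G (l0, m0). v (l0, m0) = 0} = Vinv0 G (l1, m1)" using sub by blast
  then show ?thesis
    using sub leading_coefficient_modular[OF assms(1,2,3)] modular_form_lift[OF assms(1,2,3)]
    by (intro conjI ballI) simp_all
qed

end
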